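(* Let $M$ be a compact path-connected Riemannian manifold without boundary and let $\widehat M$ be a free abelian cover of $M$, with the metric $\widehat d$ induced by the lifted Riemannian metric, with associated linear epimorphism $\mathfrak f:H_1(M,\mathbb R)\to\operatorname{im}\mathfrak f\approx\mathbb R^\ell$ and associated maps $\widehat G:\widehat M\to\operatorname{im}\mathfrak f$ and $\widehat F_\varepsilon=\varepsilon\,\widehat G$ (see context). Then $$\lim_{\varepsilon\to0}(\widehat M,\varepsilon\,\widehat d,\widehat F_\varepsilon)=\operatorname{im}\mathfrak f$$ in the sense of convergence of metric spaces through the maps $\widehat F_\varepsilon$ (see context), where $\operatorname{im}\mathfrak f$ carries the distance of any norm.
   Context: Maximal free abelian cover: $\widetilde M$ is the covering space of $M$ with $\pi_1(\widetilde M)=\ker[\pi_1(M)\to H_1(M,\mathbb R)]$; its deck group is $\mathbb G=\operatorname{im}[\pi_1(M)\to H_1(M,\mathbb R)]\approx\mathbb Z^k$. The map $G$: fix a basis $c_1,\dots,c_k$ of $H^1(M,\mathbb R)$, closed $1$-forms $\omega_i$ on $M$ in the class $c_i$, and $x_0\in\widetilde M$; let $\widetilde\omega_i$ be the (exact) lift of $\omega_i$ to $\widetilde M$. With $H_1(M,\mathbb R)=H^1(M,\mathbb R)^*$, define $G:\widetilde M\to H_1(M,\mathbb R)$ by $G(x)\cdot(\sum_i a_ic_i)=\int_{x_0}^x\sum_ia_i\widetilde\omega_i$ (integral along any path in $\widetilde M$ from $x_0$ to $x$). Free abelian covers: let $\mathfrak g:\pi_1(M)\to\operatorname{im}\mathfrak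 g$ be an epimorphism onto a free abelian group $\operatorname{im}\mathfrak g\approx\mathbb Z^\ell$, and let $\widehat M$ be the covering space of $M$ with $\pi_1(\widehat M)=\ker\mathfrak g$ (deck group $\operatorname{im}\mathfrak g$). Then $\mathfrak g=\mathfrak f\circ\mathfrak h$, with $\mathfrak h:\pi_1(M)\to H_1(M,\mathbb Z)$ the Hurewicz map and $\mathfrak f:H_1(M,\mathbb Z)\to\operatorname{im}\mathfrak g$; its linearization is a linear epimorphism still denoted $\mathfrak f:H_1(M,\mathbb R)\to\operatorname{im}\mathfrak f\approx\mathbb R^\ell$. Let $\pi:\widetilde M\to\widehat M$ be the covering projection. Since $\mathfrak f(G(x))=\mathfrak f(G(y))$ whenever $\pi(x)=\pi(y)$, there is a unique map $\widehat G:\widehat M\to\operatorname{im}\mathfrak f$ with $\widehat G\circ\pi=\mathfrak f\circ G$; set $\widehat F_\varepsilon=\varepsilon\,\widehat G$. Convergence of spaces: let $(\mathcal M,\mathrm d)$ and $(\mathcal M_\varepsilon,\mathrm d_\varepsilon)$, $\varepsilon>0$, be metric spaces and $F_\varepsilon:\mathcal M_\varepsilon\to\mathcal M$ continuous maps. One writes $\lim_{\varepsilon\to 0}(\mathcal M_\varepsilon,\mathrm d_\varepsilon,F_\varepsilon)=(\mathcal M,\mathrm d)$ if (a) there are $K>1$ and $A_\varepsilon>0$ with $\lim_{\varepsilon\to 0} A_\varepsilon=0$ such that for all $x,y\in\mathcal M_\varepsilon$, $K^{-1}\mathrm d_\varepsilon(x,y)-A_\varepsilon\le \mathrm d(F_\varepsilon(x),F_\varepsilon(y))\le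 K\,\mathrm d_\varepsilon(x,y)$; and (b) for every $y\in\mathcal M$ there are $x_\varepsilon\in\mathcal M_\varepsilon$ with $\lim_{\varepsilon\to 0} F_\varepsilon(x_\varepsilon)=y$. *)

theory Defs
  imports "HOL-Analysis.Analysis" "HOL-Algebra.Coset"
begin

section \<open>Smooth maps between open sets\<close>

fun Ck_on :: "nat \<Rightarrow> 'e::real_normed_vector set \<Rightarrow> ('e \<Rightarrow> 'f::real_normed_vector) \<Rightarrow> bool" where
  "Ck_on 0 S f \<longleftrightarrow> continuous_on S f"
| "Ck_on (Suc n) S f \<longleftrightarrow>
     (\<forall>x\<in>S. f differentiable (at x)) \<and> (\<forall>v. Ck_on n S (\<lambda>x. frechet_derivative f (at x) v))"

definition smooth_on :: "'e::real_normed_vector set \<Rightarrow> ('e \<Rightarrow> 'f::real_normed_vector) \<Rightarrow> bool" where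
  "smooth_on S f \<longleftrightarrow> (\<forall>n. Ck_on n S f)"

section \<open>Manifolds\<close>

text \<open>Charts are indexed, so that a tensor field can be given by its components in every chart.\<close>

record ('a, 'e, 'i) atlas =
  charts :: "'i set"
  chart_dom :: "'i \<Rightarrow> 'a set"
  chart_map :: "'i \<Rightarrow> 'a \<Rightarrow> 'e"

definition chart_inv :: "('a, 'e, 'i) atlas \<Rightarrow> 'i \<Rightarrow> 'e \<Rightarrow> 'a" where
  "chart_inv A i = inv_into (chart_dom A i) (chart_map A i)"

definition chart_image :: "('a, 'e, 'i) atlas \<Rightarrow> 'i \<Rightarrow> 'e set" where
  "chart_image A i = chart_map A i ` chart_dom A i"

text \<open>A smooth manifold without boundary. The sort of \<open>'e\<close> says that the model space is a
  finite-dimensional inner product space, as the Heine-Borel property forces finite dimension;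
  unlike the class \<open>euclidean_space\<close> this also allows dimension 0. The Hausdorff property is part
  of the sort of \<open>'a\<close>. Second countability is not listed, as it follows for compact \<open>M\<close>.\<close>

definition smooth_manifold ::
    "('a::t2_space, 'e::{real_inner,heine_borel}, 'i) atlas \<Rightarrow> 'a set \<Rightarrow> bool" where
  "smooth_manifold A M \<longleftrightarrow>
     (\<Union>i\<in>charts A. chart_dom A i) = M \<and>
     (\<forall>i\<in>charts A. openin (top_of_set M) (chart_dom A i) \<and> open (chart_image A i) \<and>
        homeomorphism (chart_dom A i) (chart_image A i) (chart_map A i) (chart_inv A i)) \<and>
     (\<forall>i\<in>charts A. \<forall>j\<in>charts A.
        smooth_on (chart_map A i ` (chart_dom A i \<inter> chart_dom A j)) (chart_map A j \<circ> chart_inv A i))"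

text \<open>\<open>coord_change A i j x\<close> sends the components in chart \<open>i\<close> of a tangent vector at \<open>x\<close> to its
  components in chart \<open>j\<close>.\<close>

definition coord_change ::
    "('a, 'e::real_normed_vector, 'i) atlas \<Rightarrow> 'i \<Rightarrow> 'i \<Rightarrow> 'a \<Rightarrow> 'e \<Rightarrow> 'e" where
  "coord_change A i j x =
     frechet_derivative (chart_map A j \<circ> chart_inv A i) (at (chart_map A i x))"

text \<open>\<open>gm i x u v\<close> is the inner product of the tangent vectors at \<open>x\<close> with components \<open>u\<close>, \<open>v\<close>
  in chart \<open>i\<close>.\<close>

definition riemannian_metric ::
    "('a, 'e::real_normed_vector, 'i) atlas \<Rightarrow> ('i \<Rightarrow> 'a \<Rightarrow> 'e \<Rightarrow> 'e \<Rightarrow> real) \<Rightarrow> bool" where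
  "riemannian_metric A gm \<longleftrightarrow>
     (\<forall>i\<in>charts A. \<forall>x\<in>chart_dom A i.
        bilinear (gm i x) \<and> (\<forall>u v. gm i x u v = gm i x v u) \<and> (\<forall>v. v \<noteq> 0 \<longrightarrow> gm i x v v > 0)) \<and>
     (\<forall>i\<in>charts A. \<forall>u v. smooth_on (chart_image A i) (\<lambda>y. gm i (chart_inv A i y) u v)) \<and>
     (\<forall>i\<in>charts A. \<forall>j\<in>charts A. \<forall>x\<in>chart_dom A i \<inter> chart_dom A j. \<forall>u v.
        gm i x u v = gm j x (coord_change A i j x u) (coord_change A i j x v))"

section \<open>One-forms and de Rham cohomology in degree one\<close>

type_synonym ('a, 'e, 'i) form = "'i \<Rightarrow> 'a \<Rightarrow> 'e \<Rightarrow> real"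

definition one_form :: "('a, 'e::real_normed_vector, 'i) atlas \<Rightarrow> ('a, 'e, 'i) form \<Rightarrow> bool" where
  "one_form A \<omega> \<longleftrightarrow>
     (\<forall>i\<in>charts A. \<forall>x\<in>chart_dom A i. linear (\<omega> i x)) \<and>
     (\<forall>i\<in>charts A. \<forall>v. smooth_on (chart_image A i) (\<lambda>y. \<omega> i (chart_inv A i y) v)) \<and>
     (\<forall>i\<in>charts A. \<forall>j\<in>charts A. \<forall>x\<in>chart_dom A i \<inter> chart_dom A j. \<forall>v.
        \<omega> i x v = \<omega> j x (coord_change A i j x v))"

definition closed_form :: "('a, 'e::real_normed_vector, 'i) atlas \<Rightarrow> ('a, 'e, 'i) form \<Rightarrow> bool" where
  "closed_form A \<omega> \<longleftrightarrow> one_form A \<omega> \<and>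
     (\<forall>i\<in>charts A. \<forall>y\<in>chart_image A i. \<forall>u v.
        frechet_derivative (\<lambda>z. \<omega> i (chart_inv A i z) v) (at y) u =
        frechet_derivative (\<lambda>z. \<omega> i (chart_inv A i z) u) (at y) v)"

definition exact_form :: "('a, 'e::real_normed_vector, 'i) atlas \<Rightarrow> ('a, 'e, 'i) form \<Rightarrow> bool" where
  "exact_form A \<omega> \<longleftrightarrow>
     (\<exists>h :: 'a \<Rightarrow> real. \<forall>i\<in>charts A. smooth_on (chart_image A i) (h \<circ> chart_inv A i) \<and>
        (\<forall>x\<in>chart_dom A i. \<omega> i x = frechet_derivative (h \<circ> chart_inv A i) (at (chart_map A i x))))"

text \<open>The classes of the closed forms \<open>\<omega> 0, \<dots>, \<omega> (k - 1)\<close> are a basis of \<open>H\<^sup>1(M, \<real>)\<close>, the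
  closed forms modulo the exact ones.\<close>

definition cohomology_basis ::
    "('a, 'e::real_normed_vector, 'i) atlas \<Rightarrow> nat \<Rightarrow> (nat \<Rightarrow> ('a, 'e, 'i) form) \<Rightarrow> bool" where
  "cohomology_basis A k \<omega> \<longleftrightarrow>
     (\<forall>j<k. closed_form A (\<omega> j)) \<and>
     (\<forall>\<eta>. closed_form A \<eta> \<longrightarrow>
        (\<exists>a. exact_form A (\<lambda>i x v. \<eta> i x v - (\<Sum>j<k. a j * \<omega> j i x v)))) \<and>
     (\<forall>a. exact_form A (\<lambda>i x v. \<Sum>j<k. a j * \<omega> j i x v) \<longrightarrow> (\<forall>j<k. a j = 0))"

text \<open>\<open>H\<^sub>1(M, \<real>) = H\<^sup>1(M, \<real>)\<^sup>*\<close>: a linear functional on the quotient of the closed forms by the exact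
  forms is a linear functional on the closed forms which vanishes on the exact ones. It is set to
  0 on arguments which are not closed forms, to have one representative for each functional.\<close>

definition real_homology :: "('a, 'e::real_normed_vector, 'i) atlas \<Rightarrow> (('a, 'e, 'i) form \<Rightarrow> real) set" where
  "real_homology A = {l.
     (\<forall>\<omega> \<eta>. closed_form A \<omega> \<longrightarrow> closed_form A \<eta> \<longrightarrow> l (\<lambda>i x v. \<omega> i x v + \<eta> i x v) = l \<omega> + l \<eta>) \<and>
     (\<forall>c \<omega>. closed_form A \<omega> \<longrightarrow> l (\<lambda>i x v. c * \<omega> i x v) = c * l \<omega>) \<and>
     (\<forall>\<omega>. exact_form A \<omega> \<longrightarrow> l \<omega> = 0) \<and>
     (\<forall>\<omega>. \<not> closed_form A \<omega> \<longrightarrow> l \<omega> = 0)}"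

definition linear_on_homology ::
    "('a, 'e::real_normed_vector, 'i) atlas \<Rightarrow> ((('a, 'e, 'i) form \<Rightarrow> real) \<Rightarrow> 'v::real_vector) \<Rightarrow> bool" where
  "linear_on_homology A f \<longleftrightarrow>
     (\<forall>l\<in>real_homology A. \<forall>m\<in>real_homology A. f (\<lambda>\<omega>. l \<omega> + m \<omega>) = f l + f m) \<and>
     (\<forall>c. \<forall>l\<in>real_homology A. f (\<lambda>\<omega>. c * l \<omega>) = c *\<^sub>R f l)"

section \<open>Piecewise smooth paths, length and line integrals\<close>

text \<open>One-sided derivatives are required at both ends of \<open>{a..b}\<close> and the derivative is continuous
  up to the ends, which makes speeds bounded. The library's \<open>piecewise_C1_differentiable_on\<close>
  allows the derivative to blow up at the break points, where \<open>integral\<close> might default to 0.\<close>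

definition C1_path_on ::
    "('a, 'e::real_normed_vector, 'i) atlas \<Rightarrow> real \<Rightarrow> real \<Rightarrow> (real \<Rightarrow> 'a) \<Rightarrow> bool" where
  "C1_path_on A a b \<gamma> \<longleftrightarrow>
     (\<forall>i\<in>charts A. \<exists>D.
        (\<forall>t\<in>{a..b}. \<gamma> t \<in> chart_dom A i \<longrightarrow>
           ((chart_map A i \<circ> \<gamma>) has_vector_derivative D t) (at t within {a..b})) \<and>
        continuous_on {t\<in>{a..b}. \<gamma> t \<in> chart_dom A i} D)"

definition piecewise_C1_path ::
    "('a::topological_space, 'e::real_normed_vector, 'i) atlas \<Rightarrow> 'a set \<Rightarrow> (real \<Rightarrow> 'a) \<Rightarrow> bool" where
  "piecewise_C1_path A X \<gamma> \<longleftrightarrow> path \<gamma> \<and> path_image \<gamma> \<subseteq> X \<and>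
     (\<exists>n (s :: nat \<Rightarrow> real). s 0 = 0 \<and> s n = 1 \<and>
        (\<forall>j<n. s j < s (Suc j) \<and> C1_path_on A (s j) (s (Suc j)) \<gamma>))"

definition C1_paths_between ::
    "('a::topological_space, 'e::real_normed_vector, 'i) atlas \<Rightarrow> 'a set \<Rightarrow> 'a \<Rightarrow> 'a \<Rightarrow> (real \<Rightarrow> 'a) set" where
  "C1_paths_between A X x y = {\<gamma>. piecewise_C1_path A X \<gamma> \<and> pathstart \<gamma> = x \<and> pathfinish \<gamma> = y}"

definition chart_at :: "('a, 'e, 'i) atlas \<Rightarrow> 'a \<Rightarrow> 'i" where
  "chart_at A x = (SOME i. i \<in> charts A \<and> x \<in> chart_dom A i)"

definition velocity :: "('a, 'e::real_normed_vector, 'i) atlas \<Rightarrow> (real \<Rightarrow> 'a) \<Rightarrow> real \<Rightarrow> 'e" where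
  "velocity A \<gamma> t = vector_derivative (chart_map A (chart_at A (\<gamma> t)) \<circ> \<gamma>) (at t within {0..1})"

definition line_integral ::
    "('a, 'e::real_normed_vector, 'i) atlas \<Rightarrow> ('a, 'e, 'i) form \<Rightarrow> (real \<Rightarrow> 'a) \<Rightarrow> real" where
  "line_integral A \<omega> \<gamma> = integral {0..1} (\<lambda>t. \<omega> (chart_at A (\<gamma> t)) (\<gamma> t) (velocity A \<gamma> t))"

definition path_length ::
    "('a, 'e::real_normed_vector, 'i) atlas \<Rightarrow> ('i \<Rightarrow> 'a \<Rightarrow> 'e \<Rightarrow> 'e \<Rightarrow> real) \<Rightarrow> (real \<Rightarrow> 'a) \<Rightarrow> real" where
  "path_length A gm \<gamma> =
     integral {0..1} (\<lambda>t. sqrt (gm (chart_at A (\<gamma> t)) (\<gamma> t) (velocity A \<gamma> t) (velocity A \<gamma> t)))"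

definition riemannian_dist ::
    "('a::topological_space, 'e::real_normed_vector, 'i) atlas \<Rightarrow> ('i \<Rightarrow> 'a \<Rightarrow> 'e \<Rightarrow> 'e \<Rightarrow> real) \<Rightarrow>
     'a set \<Rightarrow> 'a \<Rightarrow> 'a \<Rightarrow> real" where
  "riemannian_dist A gm X x y = Inf (path_length A gm ` C1_paths_between A X x y)"

section \<open>Fundamental group and coverings\<close>

definition loops_at :: "'a::topological_space set \<Rightarrow> 'a \<Rightarrow> (real \<Rightarrow> 'a) set" where
  "loops_at X x = {\<gamma>. path \<gamma> \<and> path_image \<gamma> \<subseteq> X \<and> pathstart \<gamma> = x \<and> pathfinish \<gamma> = x}"

definition path_class :: "'a::topological_space set \<Rightarrow> (real \<Rightarrow> 'a) \<Rightarrow> (real \<Rightarrow> 'a) set" where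
  "path_class X \<gamma> = {\<delta>. homotopic_paths X \<gamma> \<delta>}"

definition fundamental_group :: "'a::topological_space set \<Rightarrow> 'a \<Rightarrow> (real \<Rightarrow> 'a) set monoid" where
  "fundamental_group X x =
     \<lparr>carrier = path_class X ` loops_at X x,
      monoid.mult = (\<lambda>P Q. {\<delta>. \<exists>\<alpha>\<in>P. \<exists>\<beta>\<in>Q. homotopic_paths X (\<alpha> +++ \<beta>) \<delta>}),
      one = path_class X (\<lambda>_. x)\<rparr>"

text \<open>The image of the fundamental group of a covering space \<open>X\<close> of \<open>M\<close> under the projection.\<close>

definition covering_subgroup ::
    "'b::topological_space set \<Rightarrow> ('b \<Rightarrow> 'a::topological_space) \<Rightarrow> 'a set \<Rightarrow> 'b \<Rightarrow> (real \<Rightarrow> 'a) set set" where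
  "covering_subgroup X p M x = (\<lambda>\<sigma>. path_class M (p \<circ> \<sigma>)) ` loops_at X x"

text \<open>The smooth structure lifted to a covering space: the charts are \<open>\<phi>\<^sub>i \<circ> p\<close>, restricted to open
  sets \<open>V\<close> which \<open>p\<close> maps homeomorphically onto an open subset of the domain of \<open>\<phi>\<^sub>i\<close>. In these
  charts a lifted form or metric has the same components as the original one.\<close>

definition lift_atlas ::
    "('a::topological_space, 'e, 'i) atlas \<Rightarrow> 'a set \<Rightarrow> ('b::topological_space \<Rightarrow> 'a) \<Rightarrow> 'b set \<Rightarrow>
     ('b, 'e, 'i \<times> 'b set) atlas" where
  "lift_atlas A M p X =
     \<lparr>charts = {(i, V). i \<in> charts A \<and> openin (top_of_set X) V \<and> openin (top_of_set M) (p ` V) \<and>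
                  p ` V \<subseteq> chart_dom A i \<and> (\<exists>q. homeomorphism V (p ` V) p q)},
      chart_dom = (\<lambda>(i, V). V),
      chart_map = (\<lambda>(i, V). chart_map A i \<circ> p)\<rparr>"

text \<open>Used for forms as well as for Riemannian metrics.\<close>

definition lift_tensor :: "('b \<Rightarrow> 'a) \<Rightarrow> ('i \<Rightarrow> 'a \<Rightarrow> 't) \<Rightarrow> 'i \<times> 'b set \<Rightarrow> 'b \<Rightarrow> 't" where
  "lift_tensor p \<tau> = (\<lambda>(i, V) x. \<tau> i (p x))"

text \<open>The class in \<open>H\<^sub>1(M, \<real>) = H\<^sup>1(M, \<real>)\<^sup>*\<close> of a loop.\<close>

definition period_class ::
    "('a, 'e::real_normed_vector, 'i) atlas \<Rightarrow> (real \<Rightarrow> 'a) \<Rightarrow> (('a, 'e, 'i) form \<Rightarrow> real)" where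
  "period_class A \<gamma> = (\<lambda>\<omega>. if closed_form A \<omega> then line_integral A \<omega> \<gamma> else 0)"

text \<open>The kernel of \<open>\<pi>\<^sub>1(M, x) \<rightarrow> H\<^sub>1(M, \<real>)\<close>; every homotopy class contains piecewise \<open>C\<^sup>1\<close> loops, and
  their periods do not depend on the loop chosen.\<close>

definition real_hurewicz_kernel ::
    "('a::topological_space, 'e::real_normed_vector, 'i) atlas \<Rightarrow> 'a set \<Rightarrow> 'a \<Rightarrow> (real \<Rightarrow> 'a) set set" where
  "real_hurewicz_kernel A M x =
     {path_class M \<gamma> | \<gamma>. \<gamma> \<in> C1_paths_between A M x x \<and> period_class A \<gamma> = (\<lambda>_. 0)}"

definition maximal_free_abelian_cover ::
    "('a::topological_space, 'e::real_normed_vector, 'i) atlas \<Rightarrow> 'a set \<Rightarrow>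
     'c::topological_space set \<Rightarrow> ('c \<Rightarrow> 'a) \<Rightarrow> 'c \<Rightarrow> bool" where
  "maximal_free_abelian_cover A M X p x \<longleftrightarrow>
     covering_space X p M \<and> path_connected X \<and> x \<in> X \<and>
     covering_subgroup X p M x = real_hurewicz_kernel A M (p x)"

text \<open>A free abelian group of finite rank, sitting in its linearization \<open>span B\<close> as the lattice
  generated by the finite linearly independent set \<open>B\<close>.\<close>

definition lattice_group :: "'v::real_vector set \<Rightarrow> 'v monoid" where
  "lattice_group B =
     \<lparr>carrier = {(\<Sum>b\<in>B. of_int (n b) *\<^sub>R b) | n :: 'v \<Rightarrow> int. True}, monoid.mult = (+), one = 0\<rparr>"

definition free_abelian_cover ::
    "'a::topological_space set \<Rightarrow> 'b::topological_space set \<Rightarrow> ('b \<Rightarrow> 'a) \<Rightarrow> 'b \<Rightarrow>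
     'v::real_vector set \<Rightarrow> ((real \<Rightarrow> 'a) set \<Rightarrow> 'v) \<Rightarrow> bool" where
  "free_abelian_cover M X p x B g \<longleftrightarrow>
     finite B \<and> independent B \<and>
     g \<in> hom (fundamental_group M (p x)) (lattice_group B) \<and>
     g ` carrier (fundamental_group M (p x)) = carrier (lattice_group B) \<and>
     covering_space X p M \<and> path_connected X \<and> x \<in> X \<and>
     covering_subgroup X p M x = kernel (fundamental_group M (p x)) (lattice_group B) g"

text \<open>\<open>f\<close> is the linear epimorphism \<open>H\<^sub>1(M, \<real>) \<rightarrow> span B\<close> which extends the homomorphism induced by
  \<open>g\<close> on the integral homology classes, these being the classes of loops.\<close>

definition linearization ::
    "('a::topological_space, 'e::real_normed_vector, 'i) atlas \<Rightarrow> 'a set \<Rightarrow> 'a \<Rightarrow> 'v::real_vector set \<Rightarrow>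
     ((real \<Rightarrow> 'a) set \<Rightarrow> 'v) \<Rightarrow> ((('a, 'e, 'i) form \<Rightarrow> real) \<Rightarrow> 'v) \<Rightarrow> bool" where
  "linearization A M x B g f \<longleftrightarrow>
     linear_on_homology A f \<and> f ` real_homology A = span B \<and>
     (\<forall>\<gamma>\<in>C1_paths_between A M x x. f (period_class A \<gamma>) = g (path_class M \<gamma>))"

text \<open>\<open>G : X \<rightarrow> H\<^sub>1(M, \<real>)\<close> is the map with \<open>G(x) \<cdot> c\<^sub>j\<close> equal to the integral of the lift of \<open>\<omega>\<^sub>j\<close> along
  any path from \<open>x0\<close> to \<open>x\<close>, where \<open>c\<^sub>j\<close> is the class of \<open>\<omega>\<^sub>j\<close>.\<close>

definition abel_map ::
    "('a::topological_space, 'e::real_normed_vector, 'i) atlas \<Rightarrow> 'a set \<Rightarrow>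
     'c::topological_space set \<Rightarrow> ('c \<Rightarrow> 'a) \<Rightarrow> 'c \<Rightarrow> nat \<Rightarrow> (nat \<Rightarrow> ('a, 'e, 'i) form) \<Rightarrow>
     ('c \<Rightarrow> (('a, 'e, 'i) form \<Rightarrow> real)) \<Rightarrow> bool" where
  "abel_map A M X p x0 k \<omega> G \<longleftrightarrow>
     (\<forall>x\<in>X. G x \<in> real_homology A \<and>
        (\<forall>\<gamma>\<in>C1_paths_between (lift_atlas A M p X) X x0 x. \<forall>j<k.
           G x (\<omega> j) = line_integral (lift_atlas A M p X) (lift_tensor p (\<omega> j)) \<gamma>))"

section \<open>Convergence of spaces\<close>

text \<open>The locale \<open>Metric_space\<close> requires symmetry and nonnegativity also outside of the carrier.\<close>

definition dist_on :: "'a set \<Rightarrow> ('a \<Rightarrow> 'a \<Rightarrow> real) \<Rightarrow> 'a \<Rightarrow> 'a \<Rightarrow> real" where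
  "dist_on X d x y = (if x \<in> X \<and> y \<in> X then d x y else 0)"

definition spaces_converge ::
    "(real \<Rightarrow> 'a set) \<Rightarrow> (real \<Rightarrow> 'a \<Rightarrow> 'a \<Rightarrow> real) \<Rightarrow> (real \<Rightarrow> 'a \<Rightarrow> 'b) \<Rightarrow>
     'b set \<Rightarrow> ('b \<Rightarrow> 'b \<Rightarrow> real) \<Rightarrow> bool" where
  "spaces_converge Xe de F X d \<longleftrightarrow>
     Metric_space X (dist_on X d) \<and>
     (\<forall>e>0. Metric_space (Xe e) (dist_on (Xe e) (de e)) \<and>
        continuous_map (Metric_space.mtopology (Xe e) (dist_on (Xe e) (de e)))
          (Metric_space.mtopology X (dist_on X d)) (F e)) \<and>
     (\<exists>K>1. \<exists>A. (\<forall>e>0. A e > 0) \<and> (A \<longlongrightarrow> 0) (at_right 0) \<and>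
        (\<forall>e>0. \<forall>x\<in>Xe e. \<forall>y\<in>Xe e.
           inverse K * de e x y - A e \<le> d (F e x) (F e y) \<and> d (F e x) (F e y) \<le> K * de e x y)) \<and>
     (\<forall>y\<in>X. \<exists>x. (\<forall>e>0. x e \<in> Xe e) \<and>
        limitin (Metric_space.mtopology X (dist_on X d)) (\<lambda>e. F e (x e)) y (at_right 0))"

definition norm_on :: "'v::real_vector set \<Rightarrow> ('v \<Rightarrow> real) \<Rightarrow> bool" where
  "norm_on W N \<longleftrightarrow>
     (\<forall>v\<in>W. N v \<ge> 0 \<and> (N v = 0 \<longleftrightarrow> v = 0)) \<and>
     (\<forall>c. \<forall>v\<in>W. N (c *\<^sub>R v) = \<bar>c\<bar> * N v) \<and>
     (\<forall>u\<in>W. \<forall>v\<in>W. N (u + v) \<le> N u + N v)"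

end

theory Submission
  imports Defs
begin

text \<open>Every length and every line integral on a cover equals the one of the projected path, so all
  estimates take place on the compact manifold \<open>M\<close>. The upper bound holds because each \<open>\<omega>\<^sub>j\<close> is
  dominated by a multiple of the metric, and \<open>Gh z - Gh y\<close> is a linear function of the integrals of the
  \<open>\<omega>\<^sub>j\<close> along any path from \<open>y\<close> to \<open>z\<close>. For the lower bound, both points are first moved, by a bounded
  distance, into the fibre over the base point. There \<open>Gh\<close> takes values in the lattice, and a loop
  composed of \<open>n\<^sub>b\<close> copies of a fixed loop for each basis element \<open>b\<close> lifts to a path between any two points
  of the fibre with difference \<open>\<Sum>\<^sub>b n\<^sub>b b\<close>, since the cover belongs to the kernel of \<open>g\<close>; its length is linear
  in \<open>\<Sum>\<^sub>b \<bar>n\<^sub>b\<bar>\<close>. The same loops show that the rescaled images fill up \<open>im f\<close>.\<close>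

section \<open>Covering spaces\<close>

text \<open>Compactness of \<open>M\<close> enters twice: it bounds each \<open>\<omega> j\<close>
  by a multiple of the metric norm, and it puts every point within a fixed length of the fibre over
  the base point. That length produces the additive defect, which after rescaling is
  \<open>e * D\<close> and tends to 0. The hard direction turns algebra into short paths: equal
  values of \<open>g\<close> on two loops must force equal end points of their lifts, which is where
  the kernel condition meets monodromy; equivalence of norms on \<open>span B\<close> then converts
  the word length \<Sum> \<bar>n_b\<bar> into \<open>N\<close>. The main obstacle is that coverings
  speak of continuous paths, while lengths and integrals are taken along piecewise C1 ones. A
  continuous path in a cover is therefore projected, deformed in \<open>M\<close> to a piecewise C1
  path with the same ends, and lifted again. The covers carry only a topology, so lifting properties
  are derived from evenly covered sets. That the infimum of lengths is a metric on the cover belongs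
  to the claim.\<close>

lemma compact_Lebesgue_image:
  fixes h :: "'x::metric_space \<Rightarrow> 'a::topological_space"
  assumes K: "compact K" and h: "continuous_on K h" and hS: "h ` K \<subseteq> S"
    and cov: "\<And>y. y \<in> S \<Longrightarrow> \<exists>U. openin (top_of_set S) U \<and> y \<in> U \<and> P U"
  shows "\<exists>\<delta>>0. \<forall>D\<subseteq>K. D \<noteq> {} \<longrightarrow> (\<forall>x\<in>D. \<forall>y\<in>D. dist x y < \<delta>) \<longrightarrow> (\<exists>U. P U \<and> h ` D \<subseteq> U)"
proof -
  \<comment> \<open>The cover is pulled back to the metric space \<open>K\<close>, where a Lebesgue
    number exists; a nonempty set of small diameter then lies in the ball around any of its own
    points.\<close>
  define \<G> where "\<G> = {G. open G \<and> (\<exists>U. P U \<and> h ` (K \<inter> G) \<subseteq> U)}"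
  have "K \<subseteq> \<Union>\<G>"
  proof
    fix x assume x: "x \<in> K"
    then obtain U where U: "openin (top_of_set S) U" "h x \<in> U" "P U" using cov hS by blast
    have "openin (top_of_set K) (K \<inter> h -` U)"
      by (rule continuous_openin_preimage[OF h _ U(1)]) (use hS in auto)
    then obtain G where "open G" "K \<inter> h -` U = K \<inter> G" unfolding openin_open by auto
    then have "G \<in> \<G>" "x \<in> G" using U x unfolding \<G>_def by auto
    then show "x \<in> \<Union>\<G>" by blast
  qed
  then obtain \<delta> where \<delta>: "0 < \<delta>" "\<And>x. x \<in> K \<Longrightarrow> \<exists>G \<in> \<G>. ball x \<delta> \<subseteq> G"
  proof (rule Heine_Borel_lemma[OF K])
    show "open G" if "G \<in> \<G>" for G using that by (simp add: \<G>_def)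
  qed blast
  show ?thesis
  proof (intro exI[of _ \<delta>] conjI allI impI \<delta>(1))
    fix D assume D: "D \<subseteq> K" "D \<noteq> {}" "\<forall>x\<in>D. \<forall>y\<in>D. dist x y < \<delta>"
    then obtain x where x: "x \<in> D" by blast
    obtain G where "G \<in> \<G>" "ball x \<delta> \<subseteq> G" using \<delta>(2) x D(1) by blast
    moreover have "D \<subseteq> ball x \<delta>" using D(3) x by auto
    ultimately show "\<exists>U. P U \<and> h ` D \<subseteq> U" using D(1) unfolding \<G>_def by blast
  qed
qed

text \<open>The pieces are closed intervals between multiples of \<open>1 / n\<close>, so
  neighbouring pieces share an end point; in this form lifts and C1 replacements can be glued by
  induction.\<close>

lemma path_subdivision:
  assumes g: "path g" "path_image g \<subseteq> S"
    and cov: "\<And>y. y \<in> S \<Longrightarrow> \<exists>U. openin (top_of_set S) U \<and> y \<in> U \<and> P U"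
  shows "\<exists>n>0. \<forall>i<n. \<exists>U. P U \<and> g ` {real i / n .. real (Suc i) / n} \<subseteq> U"
proof -
  obtain \<delta> where \<delta>: "\<delta> > 0" "\<forall>D\<subseteq>{0..1::real}. D \<noteq> {} \<longrightarrow> (\<forall>x\<in>D. \<forall>y\<in>D. dist x y < \<delta>)
      \<longrightarrow> (\<exists>U. P U \<and> g ` D \<subseteq> U)"
    using compact_Lebesgue_image[of "{0..1}" g S P, OF _ _ _ cov] g by (auto simp: path_def path_image_def)
  obtain n :: nat where n: "n > 0" "1 / n < \<delta>" 
    using \<delta>(1) by (metis nat_approx_posE zero_less_Suc)
  show ?thesis
  proof (intro exI[of _ n] conjI allI impI n(1))
    fix i assume i: "i < n"
    show "\<exists>U. P U \<and> g ` {real i / n .. real (Suc i) / n} \<subseteq> U"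
    proof (rule \<delta>(2)[rule_format])
      have "real (Suc i) / n \<le> 1" "0 \<le> real i / n" using i n(1) by auto
      then show "{real i / n .. real (Suc i) / n} \<subseteq> {0..1}" by auto
      show "{real i / n .. real (Suc i) / n} \<noteq> {}" using n by (auto simp: field_simps)
      fix x y assume "x \<in> {real i / n .. real (Suc i) / n}" "y \<in> {real i / n .. real (Suc i) / n}"
      then have "dist x y \<le> real (Suc i) / n - real i / n" by (auto simp: dist_real_def)
      also have "\<dots> = 1 / n" using n by (simp add: field_simps)
      finally show "dist x y < \<delta>" using n by simp
    qed
  qed
qed

text \<open>Openness of the rest of the preimage says that \<open>V\<close> is also closed in the
  preimage of \<open>T\<close>. It stands for disjointness from all other sheets, in the shape that
  a connectedness argument uses.\<close>

definition sheet :: "'b::topological_space set \<Rightarrow> ('b \<Rightarrow> 'a::topological_space) \<Rightarrow> 'a set \<Rightarrow> 'b set \<Rightarrow> ('a \<Rightarrow> 'b) \<Rightarrow> bool" where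
  "sheet C p T V q \<longleftrightarrow> openin (top_of_set C) V \<and> openin (top_of_set C) (C \<inter> p -` T - V) \<and> homeomorphism V T p q"

definition evenly_covered :: "'b::topological_space set \<Rightarrow> ('b \<Rightarrow> 'a::topological_space) \<Rightarrow> 'a set \<Rightarrow> bool" where
  "evenly_covered C p T \<longleftrightarrow> (\<forall>x\<in>C. p x \<in> T \<longrightarrow> (\<exists>V q. x \<in> V \<and> sheet C p T V q))"

lemma covering_space_evenly_covered:
  assumes cov: "covering_space C p S" and y: "y \<in> S"
  shows "\<exists>T. openin (top_of_set S) T \<and> y \<in> T \<and> evenly_covered C p T"
proof -
  obtain T vs where T: "y \<in> T" "openin (top_of_set S) T" "\<Union>vs = C \<inter> p -` T"
    "\<And>u. u \<in> vs \<Longrightarrow> openin (top_of_set C) u" "pairwise disjnt vs" "\<And>u. u \<in> vs \<Longrightarrow> \<exists>q. homeomorphism u T p q"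
    using cov y unfolding covering_space_def by metis
  have "evenly_covered C p T"
    unfolding evenly_covered_def
  proof (intro ballI impI)
    fix x assume "x \<in> C" "p x \<in> T"
    then obtain V where V: "V \<in> vs" "x \<in> V" using T(3) by blast
    obtain q where q: "homeomorphism V T p q" using T(6)[OF V(1)] by blast
    have "C \<inter> p -` T - V = \<Union>(vs - {V})"
    proof -
      have "z \<notin> V" if "z \<in> u" "u \<in> vs" "u \<noteq> V" for z u
        using pairwiseD[OF T(5) that(2) V(1) that(3)] that(1) by (auto simp: disjnt_def)
      then show ?thesis using T(3) by blast
    qed
    moreover have "openin (top_of_set C) (\<Union>(vs - {V}))"
      by (rule openin_Union) (use T(4) in auto)
    ultimately have "sheet C p T V q" using q T(4) V unfolding sheet_def by auto
    then show "\<exists>V q. x \<in> V \<and> sheet C p T V q" using V by blast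
  qed
  then show ?thesis using T by blast
qed

text \<open>\<open>V\<close> and the rest of the preimage of \<open>T\<close> pull back to two
  disjoint open sets covering \<open>D\<close>, so a connected \<open>D\<close> cannot meet both.
  Inside the sheet, \<open>q\<close> recovers the lift from its projection, which in the monodromy
  proof yields continuity in the other variable.\<close>

lemma sheet_connected:
  assumes V: "sheet C p T V q" and D: "connected D" and k: "continuous_on D k" "\<And>d. d \<in> D \<Longrightarrow> k d \<in> C"
    and pk: "\<And>d. d \<in> D \<Longrightarrow> p (k d) \<in> T" and d0: "d0 \<in> D" "k d0 \<in> V" and d: "d \<in> D"
  shows "k d \<in> V \<and> k d = q (p (k d))"
proof -
  let ?W = "C \<inter> p -` T - V"
  have VW: "openin (top_of_set C) V" "openin (top_of_set C) ?W" and h: "homeomorphism V T p q" 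
    using V unfolding sheet_def by auto
  have "k d \<in> V"
  proof (rule ccontr)
    assume nV: "k d \<notin> V"
    have 1: "openin (top_of_set D) (D \<inter> k -` V)" "openin (top_of_set D) (D \<inter> k -` ?W)"
      using continuous_openin_preimage[OF k(1), of C] k(2) VW by auto
    have 2: "D \<inter> k -` ?W \<noteq> {}" using d nV k(2) pk by blast
    have 3: "D \<inter> k -` V \<noteq> {}" using d0 by blast
    have 4: "D \<subseteq> (D \<inter> k -` V) \<union> (D \<inter> k -` ?W)" using k(2) pk by blast
    have 5: "(D \<inter> k -` V) \<inter> (D \<inter> k -` ?W) = {}" by blast
    show False using D 1 2 3 4 5 unfolding connected_openin by blast
  qed
  then show ?thesis using h unfolding homeomorphism_def by auto
qed

text \<open>The library proves the lifting properties of covering spaces only for normed spaces.\<close>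

lemma covering_lift_unique:
  assumes cov: "covering_space C p S" and T: "connected T" "a \<in> T" "x \<in> T" and eq: "g1 a = g2 a"
    and g1: "continuous_on T g1" "g1 ` T \<subseteq> C" and g2: "continuous_on T g2" "g2 ` T \<subseteq> C"
    and pg: "\<And>t. t \<in> T \<Longrightarrow> p (g1 t) = p (g2 t)"
  shows "g1 x = g2 x"
proof -
  \<comment> \<open>The truth value of \<open>g1 t = g2 t\<close> is locally constant. Different
    values are separated by a sheet and its complement, as the total space is not assumed
    Hausdorff.\<close>
  have main: "\<exists>N. openin (top_of_set T) N \<and> z \<in> N \<and> (\<forall>t\<in>N. (g1 t = g2 t) = (g1 z = g2 z))" if z: "z \<in> T" for z
  proof -
    have "p (g1 z) \<in> S" using covering_space_imp_surjective[OF cov] g1(2) z by blast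
    then obtain U where U: "openin (top_of_set S) U" "p (g1 z) \<in> U" "evenly_covered C p U"
      using covering_space_evenly_covered[OF cov, of "p (g1 z)"] by metis
    have z1: "g1 z \<in> C" "g2 z \<in> C" using g1(2) g2(2) z by auto
    then obtain V q where V: "g1 z \<in> V" "sheet C p U V q" using U unfolding evenly_covered_def by blast
    let ?W = "C \<inter> p -` U - V"
    have VW: "openin (top_of_set C) V" "openin (top_of_set C) ?W" and h: "homeomorphism V U p q" 
      using V unfolding sheet_def by auto
    have o: "openin (top_of_set T) (T \<inter> g1 -` V)" "openin (top_of_set T) (T \<inter> g2 -` V)" "openin (top_of_set T) (T \<inter> g2 -` ?W)"
      using continuous_openin_preimage[OF g1(1), of C] continuous_openin_preimage[OF g2(1), of C] g1(2) g2(2) VW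
      by (auto simp: image_subset_iff_funcset)
    have inj: "u = v" if "u \<in> V" "v \<in> V" "p u = p v" for u v
      using h that unfolding homeomorphism_def by metis
    show ?thesis
    proof (cases "g2 z \<in> V")
      case True
      have "g1 z = g2 z" using inj[OF V(1) True] pg z by blast
      moreover have "\<forall>t \<in> (T \<inter> g1 -` V) \<inter> (T \<inter> g2 -` V). g1 t = g2 t" using inj pg by blast
      ultimately show ?thesis using openin_Int[OF o(1,2)] True V z by (intro exI[of _ "(T \<inter> g1 -` V) \<inter> (T \<inter> g2 -` V)"]) auto
    next
      case False
      then have "g2 z \<in> ?W" using z1 U(2) pg z by auto
      moreover have "g1 z \<noteq> g2 z" using False V by auto
      moreover have "\<forall>t \<in> (T \<inter> g1 -` V) \<inter> (T \<inter> g2 -` ?W). g1 t \<noteq> g2 t" by auto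
      ultimately show ?thesis using openin_Int[OF o(1,3)] V z by (intro exI[of _ "(T \<inter> g1 -` V) \<inter> (T \<inter> g2 -` ?W)"]) auto
    qed
  qed
  have "(g1 a = g2 a) = (g1 x = g2 x)"
  proof (rule connected_local_const[OF T(1,2,3), of "\<lambda>t. g1 t = g2 t"], intro ballI)
    fix z assume "z \<in> T"
    then obtain N where N: "openin (top_of_set T) N" "z \<in> N" "\<forall>t\<in>N. (g1 t = g2 t) = (g1 z = g2 z)" using main by blast
    then obtain G where G: "open G" "N = T \<inter> G" unfolding openin_open by blast
    have *: "(g1 z = g2 z) = (g1 b = g2 b)" if "b \<in> G" "b \<in> T" for b using N(3)[rule_format, of b] G that by blast
    show "\<forall>\<^sub>F b in at z within T. (g1 z = g2 z) = (g1 b = g2 b)"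
      unfolding eventually_at_topological
    proof (intro exI[of _ G] conjI ballI impI)
      show "z \<in> G" using N(2) G by blast
    qed (rule G(1) * | assumption)+
  qed
  then show ?thesis using eq by blast
qed

section \<open>Existence of lifts and homotopy invariance of their end points\<close>

lemma covering_path_lift:
  assumes cov: "covering_space C p S" and a: "a \<in> C" and g: "path g" "path_image g \<subseteq> S" "pathstart g = p a"
  obtains h where "path h" "path_image h \<subseteq> C" "pathstart h = a" "\<And>t. t \<in> {0..1} \<Longrightarrow> p (h t) = g t"
proof -
  have gc: "continuous_on {0..1} g" using g by (simp add: path_def)
  obtain n :: nat where n: "n > 0" "\<And>i. i < n \<Longrightarrow> \<exists>U. evenly_covered C p U \<and> g ` {real i / n .. real (Suc i) / n} \<subseteq> U"
    using path_subdivision[OF g(1,2), of "evenly_covered C p", OF covering_space_evenly_covered[OF cov]] by metis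
  \<comment> \<open>Induction over the subdivision: a lift on an initial interval is continued by
    the local inverse \<open>q\<close> of the sheet that contains its current end point.\<close>
  have "\<exists>h. continuous_on {0..real i / n} h \<and> h ` {0..real i / n} \<subseteq> C \<and> h 0 = a \<and> (\<forall>t\<in>{0..real i / n}. p (h t) = g t)"
    if "i \<le> n" for i
    using that
  proof (induction i)
    case 0
    then show ?case using a g(3) by (intro exI[of _ "\<lambda>_. a"]) (auto simp: pathstart_def)
  next
    case (Suc i)
    let ?s = "real i / n" and ?t = "real (Suc i) / n"
    have st: "0 \<le> ?s" "?s \<le> ?t" "?t \<le> 1" using Suc.prems n(1) by (auto simp: field_simps)
    obtain h where h: "continuous_on {0..?s} h" "h ` {0..?s} \<subseteq> C" "h 0 = a" "\<And>t. t \<in> {0..?s} \<Longrightarrow> p (h t) = g t"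
      using Suc by auto
    obtain U where U: "evenly_covered C p U" "g ` {?s..?t} \<subseteq> U" using n(2)[of i] Suc.prems by auto
    have hs: "h ?s \<in> C" "p (h ?s) = g ?s" using h(2,4) st by auto
    then have "p (h ?s) \<in> U" using U(2) st by auto
    then obtain V q where V: "h ?s \<in> V" "sheet C p U V q" using U(1) hs unfolding evenly_covered_def by blast
    have hom: "homeomorphism V U p q" and VC: "V \<subseteq> C" using V(2) openin_imp_subset unfolding sheet_def by auto
    define k where "k = (\<lambda>t. if t \<le> ?s then h t else q (g t))"
    have qs: "q (g ?s) = h ?s" using hom V(1) hs(2) unfolding homeomorphism_def by metis
    have "continuous_on ({0..?s} \<union> {?s..?t}) k"
      unfolding k_def
    proof (rule continuous_on_cases)
      show "continuous_on {?s..?t} (\<lambda>x. q (g x))"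
      proof (rule continuous_on_compose2[of U q])
        show "continuous_on {?s..?t} g" by (rule continuous_on_subset[OF gc]) (use st in auto)
        show "continuous_on U q" using hom by (simp add: homeomorphism_def)
        show "g ` {?s..?t} \<subseteq> U" by (rule U(2))
      qed
      show "\<forall>x. x \<in> {0..?s} \<and> \<not> x \<le> ?s \<or> x \<in> {?s..?t} \<and> x \<le> ?s \<longrightarrow> h x = q (g x)"
        using qs by (metis atLeastAtMost_iff order_antisym)
    qed (rule closed_atLeastAtMost h(1))+
    moreover have "{0..?s} \<union> {?s..?t} = {0..?t}" by (rule ivl_disj_un_two_touch(4)[OF st(1,2)])
    moreover have "k ` {0..?t} \<subseteq> C"
    proof
      fix z assume "z \<in> k ` {0..?t}"
      then obtain t where t: "t \<in> {0..?t}" "z = k t" by blast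
      show "z \<in> C"
      proof (cases "t \<le> ?s")
        case True then show ?thesis using h(2) t by (auto simp: k_def)
      next
        case False
        then have "g t \<in> U" using t U(2) by auto
        then have "q (g t) \<in> V" using hom unfolding homeomorphism_def by auto
        then show ?thesis using False t VC by (auto simp: k_def)
      qed
    qed
    moreover have "k 0 = a" using h(3) st by (auto simp: k_def)
    moreover have "p (k t) = g t" if t: "t \<in> {0..?t}" for t
    proof (cases "t \<le> ?s")
      case True then show ?thesis using h(4) t by (auto simp: k_def)
    next
      case False
      then have "g t \<in> U" using t U(2) by auto
      then show ?thesis using hom False unfolding homeomorphism_def by (auto simp: k_def)
    qed
    ultimately show ?case by (intro exI[of _ k]) auto
  qed
  from this[of n] n(1) obtain h where "continuous_on {0..1} h \<and> h ` {0..1} \<subseteq> C \<and> h 0 = a \<and> (\<forall>t\<in>{0..1}. p (h t) = g t)"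
    by auto
  then show thesis using that[of h] by (auto simp: path_def path_image_def pathstart_def)
qed

lemma covering_monodromy:
  fixes p :: "'b::topological_space \<Rightarrow> 'a::topological_space"
  assumes cov: "covering_space C p S" and hom: "homotopic_paths S g1 g2"
    and h1: "path h1" "path_image h1 \<subseteq> C" "\<And>t. t \<in> {0..1} \<Longrightarrow> p (h1 t) = g1 t"
    and h2: "path h2" "path_image h2 \<subseteq> C" "\<And>t. t \<in> {0..1} \<Longrightarrow> p (h2 t) = g2 t"
    and st: "pathstart h1 = pathstart h2"
  shows "pathfinish h1 = pathfinish h2"
proof -
  obtain h :: "real \<times> real \<Rightarrow> 'a" where h: "continuous_on ({0..1} \<times> {0..1}) h" "h ` ({0..1} \<times> {0..1}) \<subseteq> S"
    "\<And>x. x \<in> {0..1} \<Longrightarrow> h (0, x) = g1 x" "\<And>x. x \<in> {0..1} \<Longrightarrow> h (1, x) = g2 x"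
    "\<And>t. t \<in> {0..1} \<Longrightarrow> h (t, 0) = g1 0" "\<And>t. t \<in> {0..1} \<Longrightarrow> h (t, 1) = g1 1"
    using hom unfolding homotopic_paths by (auto simp: pathstart_def pathfinish_def image_subset_iff_funcset)
  define a where "a = h1 0"
  have a: "a \<in> C" "p a = g1 0" "h2 0 = a" 
    using subsetD[OF h1(2), of "h1 0"] h1(3)[of 0] st by (auto simp: a_def path_image_def pathstart_def)
  have ex: "\<exists>k. path k \<and> path_image k \<subseteq> C \<and> pathstart k = a \<and> (\<forall>t\<in>{0..1}. p (k t) = h (s, t))" if s: "s \<in> {0..1}" for s
  proof -
    have c: "continuous_on {0..1} (\<lambda>t. h (s, t))"
      by (rule continuous_on_compose2[OF h(1)]) (use s in \<open>auto intro!: continuous_intros\<close>)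
    show ?thesis
      by (rule covering_path_lift[OF cov a(1), of "\<lambda>t. h (s, t)"])
        (use c h(2,5) s a in \<open>auto simp: path_def path_image_def pathstart_def\<close>)
  qed
  \<comment> \<open>Each row of the homotopy is lifted from the same point \<open>a\<close>, by an
    independent choice for each \<open>s\<close>; any continuity in \<open>s\<close> has to be
    proved.\<close>
  define k where "k = (\<lambda>s. SOME k. path k \<and> path_image k \<subseteq> C \<and> pathstart k = a \<and> (\<forall>t\<in>{0..1}. p (k t) = h (s, t)))"
  have k: "path (k s)" "path_image (k s) \<subseteq> C" "k s 0 = a" "\<And>t. t \<in> {0..1} \<Longrightarrow> p (k s t) = h (s, t)"
    if "s \<in> {0..1}" for s
    using someI_ex[OF ex[OF that], folded k_def] by (auto simp: k_def pathstart_def)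
  have kC: "k s t \<in> C" if "s \<in> {0..1}" "t \<in> {0..1}" for s t using k(2)[OF that(1)] that(2) by (auto simp: path_image_def)
  have kc: "continuous_on {0..1} (k s)" if "s \<in> {0..1}" for s using k(1)[OF that] by (simp add: path_def)
  have ends: "k 0 1 = h1 1" "k 1 1 = h2 1"
    using covering_lift_unique[OF cov, of "{0..1}" 0 1 "k 0" h1] covering_lift_unique[OF cov, of "{0..1}" 0 1 "k 1" h2]
      k(3)[of 0] k(3)[of 1] k(4)[of 0] k(4)[of 1] kc[of 0] kc[of 1] k(2)[of 0] k(2)[of 1] h1 h2 a(3) h(3,4)
    by (simp_all add: path_def path_image_def pathstart_def a_def)
  obtain \<delta> where \<delta>: "\<delta> > 0" "\<forall>D\<subseteq>{0..1} \<times> {0..1}. D \<noteq> {} \<longrightarrow> (\<forall>x\<in>D. \<forall>y\<in>D. dist x y < \<delta>)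
      \<longrightarrow> (\<exists>U. evenly_covered C p U \<and> h ` D \<subseteq> U)"
    using compact_Lebesgue_image[OF _ h(1,2), of "evenly_covered C p", OF _ covering_space_evenly_covered[OF cov]] 
    by (auto simp: compact_Times)
  obtain n :: nat where n: "n > 0" "1 / n < \<delta> / 2" 
    using \<delta>(1) by (metis half_gt_zero nat_approx_posE zero_less_Suc)
  \<comment> \<open>On a narrow strip of rows, \<open>\<lambda>r. k r t\<close> is shown continuous
    for one grid value of \<open>t\<close> after another. At \<open>t = 1\<close> it lifts a
    constant path, because the homotopy fixes the ends, and uniqueness of lifts makes it
    constant.\<close>
  have row: "k s 1 = k s' 1" if s: "0 \<le> s" "s \<le> s'" "s' \<le> 1" "s' - s < \<delta> / 2" for s s'
  proof -
    let ?I = "{s..s'}"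
    have step: "continuous_on ?I (\<lambda>r. k r v)" 
      if uv: "0 \<le> u" "u \<le> v" "v \<le> 1" "v - u < \<delta> / 2" and cu: "continuous_on ?I (\<lambda>r. k r u)" for u v
    proof -
      have "\<exists>U. evenly_covered C p U \<and> h ` (?I \<times> {u..v}) \<subseteq> U"
      proof (rule \<delta>(2)[rule_format])
        show "?I \<times> {u..v} \<subseteq> {0..1} \<times> {0..1}" using s uv by auto
        show "?I \<times> {u..v} \<noteq> {}" using s uv by auto
        fix x y assume xy: "x \<in> ?I \<times> {u..v}" "y \<in> ?I \<times> {u..v}"
        have "dist (fst x) (fst y) \<le> s' - s" "dist (snd x) (snd y) \<le> v - u" 
          using xy by (auto simp: dist_real_def mem_Times_iff)
        \<comment> \<open>The product distance is at most the sum of the coordinate distances, hence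
          half of \<delta> for each direction.\<close>
        moreover have "dist x y \<le> dist (fst x) (fst y) + dist (snd x) (snd y)"
          unfolding dist_prod_def by (rule sqrt_sum_squares_le_sum) auto
        ultimately show "dist x y < \<delta>" using s uv by linarith
      qed
      then obtain U where U: "evenly_covered C p U" "h ` (?I \<times> {u..v}) \<subseteq> U" by blast
      have kU: "k r t \<in> C \<and> p (k r t) \<in> U" if "r \<in> ?I" "t \<in> {u..v}" for r t
        using kC[of r t] k(4)[of r t] U(2) s uv that by auto
      obtain V q where V: "k s u \<in> V" "sheet C p U V q" 
        using U(1) kU[of s u] s uv unfolding evenly_covered_def by auto
      \<comment> \<open>The sheet through one corner contains the whole edge \<open>t = u\<close> by
        connectedness in \<open>r\<close>, and then each segment from \<open>u\<close> to
        \<open>v\<close> by connectedness in \<open>t\<close>.\<close>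
      have 1: "k r u \<in> V" if r: "r \<in> ?I" for r
        using sheet_connected[OF V(2) _ cu _ _ _ V(1) r] kU s uv by simp
      have 2: "k r v = q (h (r, v))" if r: "r \<in> ?I" for r
      proof -
        have c: "continuous_on {u..v} (k r)" by (rule continuous_on_subset[OF kc]) (use r s uv in auto)
        have "k r v = q (p (k r v))"
          using sheet_connected[OF V(2) _ c _ _ _ 1[OF r], of v] kU r uv by auto
        then show ?thesis using k(4)[of r v] r s uv by auto
      qed
      have "continuous_on ?I (\<lambda>r. q (h (r, v)))"
      proof (rule continuous_on_compose2[of U q])
        show "continuous_on U q" using V(2) unfolding sheet_def homeomorphism_def by blast
        show "continuous_on ?I (\<lambda>r. h (r, v))"
          by (rule continuous_on_compose2[OF h(1)]) (use s uv in \<open>auto intro!: continuous_intros\<close>)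
        show "(\<lambda>r. h (r, v)) ` ?I \<subseteq> U" using U(2) uv by auto
      qed
      then show ?thesis using 2 by (subst continuous_on_cong[OF refl, of _ _ "\<lambda>r. q (h (r, v))"]) auto
    qed
    have "continuous_on ?I (\<lambda>r. k r (real i / n))" if "i \<le> n" for i
      using that
    proof (induction i)
      case 0
      have "continuous_on ?I (\<lambda>r. a)" by simp
      then show ?case using k(3) s by (subst continuous_on_cong[OF refl, of _ _ "\<lambda>_. a"]) auto
    next
      case (Suc i)
      have "real (Suc i) / n - real i / n = 1 / n" using n(1) by (simp add: field_simps)
      moreover have "real (Suc i) / n \<le> 1" using Suc.prems n(1) by simp
      moreover have "real i / n \<le> real (Suc i) / n" by (intro divide_right_mono) auto
      moreover have "0 \<le> real i / n" by simp
      moreover have "continuous_on ?I (\<lambda>r. k r (real i / n))" by (rule Suc.IH) (use Suc.prems in linarith)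
      moreover have "real (Suc i) / n - real i / n < \<delta> / 2" using n(2) calculation(1) by linarith
      ultimately show ?case using step by blast
    qed
    from this[of n] have c1: "continuous_on ?I (\<lambda>r. k r 1)" using n by simp
    have "(\<lambda>r. k r 1) s' = (\<lambda>_. k s 1) s'"
    proof (rule covering_lift_unique[of C p S ?I s s' "\<lambda>r. k r 1" "\<lambda>_. k s 1", OF cov connected_Icc _ _ _ c1])
      show "p (k r 1) = p (k s 1)" if "r \<in> ?I" for r using k(4)[of r 1] k(4)[of s 1] h(6) that s by simp
      show "(\<lambda>r. k r 1) ` ?I \<subseteq> C" "(\<lambda>_. k s 1) ` ?I \<subseteq> C" using kC s by force+
    qed (use s in auto)
    then show ?thesis by simp
  qed
  have "k 0 1 = k (real i / n) 1" if "i \<le> n" for i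
    using that
  proof (induction i)
    case (Suc i)
    have *: "real (Suc i) / n - real i / n = 1 / n" using n(1) by (simp add: field_simps)
    have "k (real i / n) 1 = k (real (Suc i) / n) 1"
    proof (rule row)
      show "0 \<le> real i / n" by simp
      show "real i / n \<le> real (Suc i) / n" by (intro divide_right_mono) auto
      show "real (Suc i) / n \<le> 1" using Suc.prems n(1) by simp
      show "real (Suc i) / n - real i / n < \<delta> / 2" using * n(2) by linarith
    qed
    then show ?case using Suc by simp
  qed simp
  from this[of n] show ?thesis using n ends by (simp add: pathfinish_def)
qed

section \<open>Densities on a manifold\<close>

lemma continuous_on_openin_local:
  fixes f :: "'x::t2_space \<Rightarrow> 'y::topological_space"
  assumes "\<And>x. x \<in> S \<Longrightarrow> \<exists>N. openin (top_of_set S) N \<and> x \<in> N \<and> continuous_on N f"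
  shows "continuous_on S f"
  unfolding continuous_on_eq_continuous_within
proof
  fix x assume "x \<in> S"
  then obtain N where N: "openin (top_of_set S) N" "x \<in> N" "continuous_on N f" using assms by blast
  obtain U where U: "open U" "N = S \<inter> U" using N(1) unfolding openin_open by blast
  have "at x within S = at x within N" using U N(2) by (intro at_within_nhd[of x U]) auto
  then show "continuous (at x within S) f" using N(2,3) by (simp add: continuous_on_eq_continuous_within)
qed

text \<open>As \<open>Q\<close> is monotone in the constant, the largest of finitely many local
  constants works everywhere; the inserted 1 makes it positive. It is applied to the ratio of two
  densities and to the length of a connection to a base point.\<close>

lemma compact_local_bound:
  fixes Q :: "'a::topological_space \<Rightarrow> real \<Rightarrow> bool"
  assumes K: "compact K" and mono: "\<And>x c d. Q x c \<Longrightarrow> c \<le> d \<Longrightarrow> Q x d"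
    and loc: "\<And>x. x \<in> K \<Longrightarrow> \<exists>U c. openin (top_of_set K) U \<and> x \<in> U \<and> (\<forall>y\<in>U. Q y c)"
  shows "\<exists>c>0. \<forall>x\<in>K. Q x c"
proof -
  let ?C = "{U. openin (top_of_set K) U \<and> (\<exists>c. \<forall>y\<in>U. Q y c)}"
  have "\<forall>c\<in>?C. openin (top_of_set K) c" "K \<subseteq> \<Union>?C" using loc by blast+
  then obtain D where D: "D \<subseteq> ?C" "finite D" "K \<subseteq> \<Union>D"
    using K[unfolded compact_eq_openin_cover, rule_format, of ?C] by blast
  have "\<forall>U\<in>D. \<exists>c. \<forall>y\<in>U. Q y c" using D by blast
  then obtain c where c: "\<forall>U\<in>D. \<forall>y\<in>U. Q y (c U)" by metis
  define m where "m = Max (insert 1 (c ` D))"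
  have fin: "finite (insert 1 (c ` D))" using D by simp
  have "1 \<le> m" unfolding m_def using fin by (intro Max_ge) auto
  moreover have "Q x m" if x: "x \<in> K" for x
  proof -
    obtain U where U: "U \<in> D" "x \<in> U" using D x by blast
    have "c U \<le> m" unfolding m_def using fin U by (intro Max_ge) auto
    then show ?thesis using c U mono by blast
  qed
  ultimately show ?thesis by (intro exI[of _ m]) auto
qed

text \<open>Finite dimension in the manner of Riesz: a unit vector orthogonal to the span of a
  finite 1/2-net of the unit ball has distance at least 1 from every point of the net.
  \<open>C\<close> may contain 0, whose term vanishes because division by 0 yields 0.\<close>

lemma heine_borel_orthogonal_basis:
  "\<exists>C::'e::{real_inner,heine_borel} set. finite C \<and> (\<forall>v. v = (\<Sum>c\<in>C. ((v \<bullet> c) / (c \<bullet> c)) *\<^sub>R c))"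
proof -
  have "compact (cball (0::'e) 1)" by simp
  then obtain k where k: "finite k" "cball (0::'e) 1 \<subseteq> (\<Union>x\<in>k. ball x (1/2))"
    unfolding compact_eq_totally_bounded by (metis half_gt_zero zero_less_one)
  obtain C where C: "finite C" "span C = span k" "pairwise orthogonal C"
    using basis_orthogonal[OF k(1)] by blast
  have "v = (\<Sum>c\<in>C. ((v \<bullet> c) / (c \<bullet> c)) *\<^sub>R c)" for v :: 'e
  proof (rule ccontr)
    assume neq: "v \<noteq> (\<Sum>c\<in>C. ((v \<bullet> c) / (c \<bullet> c)) *\<^sub>R c)"
    define w where "w = v - (\<Sum>c\<in>C. ((v \<bullet> c) / (c \<bullet> c)) *\<^sub>R c)"
    define u where "u = (1 / norm w) *\<^sub>R w"
    have wC: "w \<bullet> d = 0" if d: "d \<in> C" for d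
    proof -
      have "(\<Sum>c\<in>C. ((v \<bullet> c) / (c \<bullet> c)) *\<^sub>R c) \<bullet> d = (\<Sum>c\<in>C. ((v \<bullet> c) / (c \<bullet> c)) * (c \<bullet> d))"
        by (simp add: inner_sum_left)
      also have "\<dots> = (\<Sum>c\<in>C. if c = d then v \<bullet> d else 0)"
      proof (rule sum.cong[OF refl])
        fix c assume c: "c \<in> C"
        show "((v \<bullet> c) / (c \<bullet> c)) * (c \<bullet> d) = (if c = d then v \<bullet> d else 0)"
        proof (cases "c = d")
          case False
          then have "c \<bullet> d = 0" using pairwiseD[OF C(3) c d] by (simp add: orthogonal_def)
          then show ?thesis using False by simp
        qed (cases "d = 0"; simp)
      qed
      also have "\<dots> = v \<bullet> d" using C(1) d by simp
      finally show ?thesis by (simp add: w_def inner_diff_left)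
    qed
    have "w \<bullet> x = 0" if "x \<in> span C" for x
      using that
    proof (induction x rule: span_induct_alt)
      case (step c x y)
      then show ?case using wC by (simp add: inner_add_right)
    qed simp
    then have ux: "u \<bullet> x = 0" if "x \<in> span C" for x using that by (simp add: u_def)
    have "w \<noteq> 0" using neq by (simp add: w_def)
    then have nu: "norm u = 1" by (simp add: u_def)
    then have "u \<in> cball 0 1" by simp
    then obtain x where x: "x \<in> k" "u \<in> ball x (1/2)" using k(2) by blast
    then have x2: "dist x u < 1/2" by simp
    have "u \<bullet> x = 0" using x ux C(2) by (simp add: span_base)
    then have "(norm (u - x))\<^sup>2 = (norm u)\<^sup>2 + (norm x)\<^sup>2"
      by (simp add: power2_norm_eq_inner inner_diff_left inner_diff_right inner_commute)
    then have "1 \<le> (norm (u - x))\<^sup>2" using nu by simp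
    moreover have "(norm (u - x))\<^sup>2 < 1\<^sup>2" 
      using x2 by (intro power_strict_mono) (auto simp: dist_norm norm_minus_commute)
    ultimately show False by simp
  qed
  then show ?thesis using C(1) by blast
qed

text \<open>Expansion in a finite basis leaves only finitely many coefficient functions, so
  continuity in \<open>z\<close> for each fixed \<open>v\<close> is enough. The bilinear version
  expands one argument and applies this to the other.\<close>

lemma linear_family_jointly_continuous:
  fixes f :: "'z::topological_space \<Rightarrow> 'e::{real_inner,heine_borel} \<Rightarrow> real"
  assumes lin: "\<And>z. z \<in> S \<Longrightarrow> linear (f z)" and c: "\<And>v. continuous_on S (\<lambda>z. f z v)"
  shows "continuous_on (S \<times> UNIV) (\<lambda>(z, v). f z v)"
proof -
  obtain C :: "'e set" where C: "finite C" "\<And>v::'e. v = (\<Sum>c\<in>C. ((v \<bullet> c) / (c \<bullet> c)) *\<^sub>R c)"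
    using heine_borel_orthogonal_basis by blast
  have 1: "f z v = (\<Sum>c\<in>C. (v \<bullet> c) / (c \<bullet> c) * f z c)" if "z \<in> S" for z v
  proof -
    have "f z v = f z (\<Sum>c\<in>C. ((v \<bullet> c) / (c \<bullet> c)) *\<^sub>R c)" using C(2)[of v] by simp
    then show ?thesis using lin[OF that] by (simp add: linear_sum linear_cmul)
  qed
  have 2: "continuous_on (S \<times> UNIV) (\<lambda>x. f (fst x) c)" for c
    by (rule continuous_on_compose2[OF c continuous_on_fst[OF continuous_on_id]]) auto
  have "continuous_on (S \<times> UNIV) (\<lambda>x. \<Sum>c\<in>C. (snd x \<bullet> c) / (c \<bullet> c) * f (fst x) c)"
    unfolding divide_inverse by (intro continuous_intros 2)
  then show ?thesis
    by (rule continuous_on_eq) (use 1 in auto)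
qed

lemma bilinear_family_jointly_continuous:
  fixes f :: "'z::topological_space \<Rightarrow> 'e::{real_inner,heine_borel} \<Rightarrow> 'e \<Rightarrow> real"
  assumes lin: "\<And>z. z \<in> S \<Longrightarrow> bilinear (f z)" and c: "\<And>u v. continuous_on S (\<lambda>z. f z u v)"
  shows "continuous_on (S \<times> UNIV) (\<lambda>(z, v). f z v v)"
proof -
  obtain C :: "'e set" where C: "finite C" "\<And>v::'e. v = (\<Sum>c\<in>C. ((v \<bullet> c) / (c \<bullet> c)) *\<^sub>R c)"
    using heine_borel_orthogonal_basis by blast
  have 1: "f z v v = (\<Sum>c\<in>C. (v \<bullet> c) / (c \<bullet> c) * f z c v)" if "z \<in> S" for z v
  proof -
    have l: "linear (\<lambda>u. f z u v)" using lin[OF that] by (simp add: bilinear_def)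
    have "f z v v = f z (\<Sum>c\<in>C. ((v \<bullet> c) / (c \<bullet> c)) *\<^sub>R c) v" using C(2)[of v] by simp
    also have "\<dots> = (\<Sum>c\<in>C. f z (((v \<bullet> c) / (c \<bullet> c)) *\<^sub>R c) v)" by (rule linear_sum[OF l])
    also have "\<dots> = (\<Sum>c\<in>C. (v \<bullet> c) / (c \<bullet> c) * f z c v)" by (intro sum.cong refl) (simp add: linear_cmul[OF l])
    finally show ?thesis .
  qed
  have 2: "continuous_on (S \<times> UNIV) (\<lambda>x. f (fst x) c (snd x))" for c
    using linear_family_jointly_continuous[of S "\<lambda>z. f z c"] lin assms(2)
    by (simp add: bilinear_def case_prod_unfold)
  have "continuous_on (S \<times> UNIV) (\<lambda>x. \<Sum>c\<in>C. (snd x \<bullet> c) / (c \<bullet> c) * f (fst x) c (snd x))"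
    unfolding divide_inverse by (intro continuous_intros 2)
  then show ?thesis
    by (rule continuous_on_eq) (use 1 in auto)
qed

text \<open>Positively homogeneous functions on the tangent bundle, given by their chart components; the
  examples are one-forms and the norm of a Riemannian metric, so that line integrals and lengths are
  both integrals of densities.\<close>

definition density :: "('a, 'e::real_normed_vector, 'i) atlas \<Rightarrow> ('i \<Rightarrow> 'a \<Rightarrow> 'e \<Rightarrow> real) \<Rightarrow> bool" where
  "density A F \<longleftrightarrow>
     (\<forall>i\<in>charts A. continuous_on (chart_image A i \<times> UNIV) (\<lambda>(y, v). F i (chart_inv A i y) v)) \<and>
     (\<forall>i\<in>charts A. \<forall>x\<in>chart_dom A i. \<forall>c\<ge>0. \<forall>v. F i x (c *\<^sub>R v) = c * F i x v) \<and>
     (\<forall>i\<in>charts A. \<forall>j\<in>charts A. \<forall>x\<in>chart_dom A i \<inter> chart_dom A j. \<forall>v.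
        F i x v = F j x (coord_change A i j x v))"

definition metric_norm :: "('i \<Rightarrow> 'a \<Rightarrow> 'e \<Rightarrow> 'e \<Rightarrow> real) \<Rightarrow> 'i \<Rightarrow> 'a \<Rightarrow> 'e \<Rightarrow> real" where
  "metric_norm gm i x v = sqrt (gm i x v v)"

section \<open>Charts, transition maps and chain rules\<close>

locale smooth_mfd =
  fixes A :: "('a::t2_space, 'e::{real_inner,heine_borel}, 'i) atlas" and M :: "'a set"
  assumes mfd: "smooth_manifold A M"
begin

lemma homeo: "i \<in> charts A \<Longrightarrow> homeomorphism (chart_dom A i) (chart_image A i) (chart_map A i) (chart_inv A i)"
  using mfd unfolding smooth_manifold_def by blast

lemma open_dom: "i \<in> charts A \<Longrightarrow> openin (top_of_set M) (chart_dom A i)"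
  using mfd unfolding smooth_manifold_def by blast

lemma open_image: "i \<in> charts A \<Longrightarrow> open (chart_image A i)"
  using mfd unfolding smooth_manifold_def by blast

lemma dom_subset: "i \<in> charts A \<Longrightarrow> chart_dom A i \<subseteq> M"
  using open_dom openin_imp_subset by blast

lemma inv_map [simp]: "i \<in> charts A \<Longrightarrow> x \<in> chart_dom A i \<Longrightarrow> chart_inv A i (chart_map A i x) = x"
  using homeo unfolding homeomorphism_def by blast

lemma map_inv [simp]: "i \<in> charts A \<Longrightarrow> y \<in> chart_image A i \<Longrightarrow> chart_map A i (chart_inv A i y) = y"
  using homeo unfolding homeomorphism_def by blast

lemma map_in_image: "x \<in> chart_dom A i \<Longrightarrow> chart_map A i x \<in> chart_image A i"
  unfolding chart_image_def by blast

lemma inv_in_dom: "i \<in> charts A \<Longrightarrow> y \<in> chart_image A i \<Longrightarrow> chart_inv A i y \<in> chart_dom A i"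
  using homeo unfolding homeomorphism_def by blast

lemma continuous_map: "i \<in> charts A \<Longrightarrow> continuous_on (chart_dom A i) (chart_map A i)"
  using homeo unfolding homeomorphism_def by blast

lemma continuous_inv: "i \<in> charts A \<Longrightarrow> continuous_on (chart_image A i) (chart_inv A i)"
  using homeo unfolding homeomorphism_def by blast

lemma chart_at:
  assumes "x \<in> M" shows "chart_at A x \<in> charts A" "x \<in> chart_dom A (chart_at A x)"
proof -
  have "\<exists>i. i \<in> charts A \<and> x \<in> chart_dom A i" using mfd assms unfolding smooth_manifold_def by blast
  from someI_ex[OF this] show "chart_at A x \<in> charts A" "x \<in> chart_dom A (chart_at A x)"
    unfolding chart_at_def by blast+
qed

lemma transition_smooth:
  assumes "i \<in> charts A" "j \<in> charts A"
  shows "smooth_on (chart_map A i ` (chart_dom A i \<inter> chart_dom A j)) (chart_map A j \<circ> chart_inv A i)"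
  using mfd assms unfolding smooth_manifold_def by blast

lemma transition_derivative:
  assumes "i \<in> charts A" "j \<in> charts A" "x \<in> chart_dom A i" "x \<in> chart_dom A j"
  shows "((chart_map A j \<circ> chart_inv A i) has_derivative coord_change A i j x) (at (chart_map A i x))"
proof -
  have "Ck_on (Suc 0) (chart_map A i ` (chart_dom A i \<inter> chart_dom A j)) (chart_map A j \<circ> chart_inv A i)"
    using transition_smooth[OF assms(1,2)] unfolding smooth_on_def by blast
  then have "(chart_map A j \<circ> chart_inv A i) differentiable (at (chart_map A i x))" using assms by auto
  then show ?thesis unfolding coord_change_def by (simp add: frechet_derivative_works)
qed

lemma eventually_in_dom:
  assumes i: "i \<in> charts A" and g: "continuous (at t within S) \<gamma>" "\<gamma> t \<in> chart_dom A i" "\<gamma> ` S \<subseteq> M"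
  shows "\<forall>\<^sub>F s in at t within S. \<gamma> s \<in> chart_dom A i"
proof -
  obtain U where U: "open U" "chart_dom A i = M \<inter> U" using open_dom[OF i] unfolding openin_open by blast
  have "\<forall>\<^sub>F s in at t within S. \<gamma> s \<in> U"
    using g(1,2) U unfolding continuous_within by (intro topological_tendstoD) auto
  moreover have "\<forall>\<^sub>F s in at t within S. s \<in> S" by (simp add: eventually_at_filter)
  ultimately show ?thesis by eventually_elim (use U g(3) in auto)
qed

text \<open>The factorization of \<open>f \<circ> \<gamma>\<close> through the chart holds only
  while \<gamma> is in the chart domain, hence the passage to a neighbourhood of \<open>t\<close>.
  Both another chart map and a potential of an exact form are taken for \<open>f\<close>.\<close>

lemma chart_fun_derivative:
  assumes i: "i \<in> charts A" and g: "continuous (at t within S) \<gamma>" "\<gamma> ` S \<subseteq> M"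
    and t: "t \<in> S" "\<gamma> t \<in> chart_dom A i"
    and T: "((f \<circ> chart_inv A i) has_derivative T) (at (chart_map A i (\<gamma> t)))"
    and d: "((chart_map A i \<circ> \<gamma>) has_vector_derivative D) (at t within S)"
  shows "((f \<circ> \<gamma>) has_vector_derivative T D) (at t within S)"
proof -
  have l: "linear T" using has_derivative_linear[OF T] .
  have "((f \<circ> chart_inv A i) \<circ> (chart_map A i \<circ> \<gamma>) has_derivative T \<circ> (\<lambda>h. h *\<^sub>R D)) (at t within S)"
    by (rule diff_chain_within) (use d T in \<open>auto simp: has_vector_derivative_def intro: has_derivative_at_withinI\<close>)
  moreover have "T \<circ> (\<lambda>h. h *\<^sub>R D) = (\<lambda>h. h *\<^sub>R T D)" using linear_cmul[OF l] by auto
  ultimately have 1: "((f \<circ> chart_inv A i) \<circ> (chart_map A i \<circ> \<gamma>) has_vector_derivative T D) (at t within S)"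
    by (simp add: has_vector_derivative_def)
  obtain \<delta> where \<delta>: "\<delta> > 0" "\<And>s. s \<in> S \<Longrightarrow> s \<noteq> t \<Longrightarrow> dist s t < \<delta> \<Longrightarrow> \<gamma> s \<in> chart_dom A i"
    using eventually_in_dom[OF i g(1) t(2) g(2)] unfolding eventually_at by blast
  show ?thesis
  proof (rule has_vector_derivative_transform_within[OF 1 \<delta>(1) t(1)])
    fix s assume "s \<in> S" "dist s t < \<delta>"
    then have "\<gamma> s \<in> chart_dom A i" using \<delta>(2) t by (cases "s = t") auto
    then show "((f \<circ> chart_inv A i) \<circ> (chart_map A i \<circ> \<gamma>)) s = (f \<circ> \<gamma>) s" using i by simp
  qed
qed

lemma chart_change:
  assumes ij: "i \<in> charts A" "j \<in> charts A" and g: "continuous (at t within S) \<gamma>" "\<gamma> ` S \<subseteq> M"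
    and t: "t \<in> S" "\<gamma> t \<in> chart_dom A i" "\<gamma> t \<in> chart_dom A j"
    and d: "((chart_map A i \<circ> \<gamma>) has_vector_derivative D) (at t within S)"
  shows "((chart_map A j \<circ> \<gamma>) has_vector_derivative coord_change A i j (\<gamma> t) D) (at t within S)"
  by (rule chart_fun_derivative[OF ij(1) g t(1,2) transition_derivative[OF ij t(2,3)] d])

lemma density_one_form:
  assumes "one_form A \<omega>" shows "density A \<omega>"
  unfolding density_def
proof (intro conjI ballI allI impI)
  fix i assume i: "i \<in> charts A"
  have "continuous_on (chart_image A i \<times> UNIV) (\<lambda>(y, v). \<omega> i (chart_inv A i y) v)"
  proof (rule linear_family_jointly_continuous)
    show "linear (\<omega> i (chart_inv A i y))" if "y \<in> chart_image A i" for y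
      using assms i inv_in_dom[OF i that] unfolding one_form_def by blast
    fix v
    have "Ck_on 0 (chart_image A i) (\<lambda>y. \<omega> i (chart_inv A i y) v)"
      using assms i unfolding one_form_def smooth_on_def by blast
    then show "continuous_on (chart_image A i) (\<lambda>y. \<omega> i (chart_inv A i y) v)" by simp
  qed
  then show "continuous_on (chart_image A i \<times> UNIV) (\<lambda>(y, v). \<omega> i (chart_inv A i y) v)" .
next
  fix i x and c :: real and v assume "i \<in> charts A" "x \<in> chart_dom A i" "0 \<le> c"
  then have "linear (\<omega> i x)" using assms unfolding one_form_def by blast
  then show "\<omega> i x (c *\<^sub>R v) = c * \<omega> i x v" by (simp add: linear_cmul)
next
  fix i j x v assume "i \<in> charts A" "j \<in> charts A" "x \<in> chart_dom A i \<inter> chart_dom A j"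
  then show "\<omega> i x v = \<omega> j x (coord_change A i j x v)" using assms unfolding one_form_def by blast
qed

lemma density_metric_norm:
  assumes "riemannian_metric A gm" shows "density A (metric_norm gm)"
  unfolding density_def metric_norm_def
proof (intro conjI ballI allI impI)
  fix i assume i: "i \<in> charts A"
  have "continuous_on (chart_image A i \<times> UNIV) (\<lambda>(y, v). gm i (chart_inv A i y) v v)"
  proof (rule bilinear_family_jointly_continuous[where f = "\<lambda>y. gm i (chart_inv A i y)"])
    show "bilinear (gm i (chart_inv A i y))" if "y \<in> chart_image A i" for y
      using assms i inv_in_dom[OF i that] unfolding riemannian_metric_def by blast
    fix u v
    have "Ck_on 0 (chart_image A i) (\<lambda>y. gm i (chart_inv A i y) u v)"
      using assms i unfolding riemannian_metric_def smooth_on_def by blast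
    then show "continuous_on (chart_image A i) (\<lambda>y. gm i (chart_inv A i y) u v)" by simp
  qed
  then have "continuous_on (chart_image A i \<times> UNIV) (\<lambda>x. sqrt ((\<lambda>(y, v). gm i (chart_inv A i y) v v) x))"
    by (rule continuous_on_real_sqrt)
  then show "continuous_on (chart_image A i \<times> UNIV) (\<lambda>(y, v). sqrt (gm i (chart_inv A i y) v v))"
    by (simp add: case_prod_unfold)
next
  fix i x v and c :: real assume c: "i \<in> charts A" "x \<in> chart_dom A i" "0 \<le> c"
  then have "bilinear (gm i x)" using assms unfolding riemannian_metric_def by blast
  then have "gm i x (c *\<^sub>R v) (c *\<^sub>R v) = c\<^sup>2 * gm i x v v" 
    by (simp add: bilinear_lmul bilinear_rmul power2_eq_square)
  then show "sqrt (gm i x (c *\<^sub>R v) (c *\<^sub>R v)) = c * sqrt (gm i x v v)" using c by (simp add: real_sqrt_mult)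
next
  fix i j x v assume "i \<in> charts A" "j \<in> charts A" "x \<in> chart_dom A i \<inter> chart_dom A j"
  then have "gm i x v v = gm j x (coord_change A i j x v) (coord_change A i j x v)" 
    using assms unfolding riemannian_metric_def by blast
  then show "sqrt (gm i x v v) = sqrt (gm j x (coord_change A i j x v) (coord_change A i j x v))" by simp
qed

lemma metric_norm_pos:
  assumes "riemannian_metric A gm" "i \<in> charts A" "x \<in> chart_dom A i" "v \<noteq> 0"
  shows "0 < metric_norm gm i x v"
proof -
  have "0 < gm i x v v" using assms unfolding riemannian_metric_def by blast
  then show ?thesis by (simp add: metric_norm_def)
qed

lemma metric_norm_minus:
  assumes "riemannian_metric A gm" "i \<in> charts A" "x \<in> chart_dom A i"
  shows "metric_norm gm i x (- v) = metric_norm gm i x v"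
proof -
  have "bilinear (gm i x)" using assms unfolding riemannian_metric_def by blast
  then show ?thesis by (simp add: metric_norm_def bilinear_lneg bilinear_rneg)
qed

lemma density_zero:
  assumes "density A F" "i \<in> charts A" "x \<in> chart_dom A i" shows "F i x 0 = 0"
proof -
  have "F i x (0 *\<^sub>R 0) = 0 * F i x 0" using assms unfolding density_def by blast
  then show ?thesis by simp
qed

lemma metric_norm_nonneg:
  assumes "riemannian_metric A gm" "i \<in> charts A" "x \<in> chart_dom A i"
  shows "0 \<le> metric_norm gm i x v"
  using metric_norm_pos[OF assms, of v] density_zero[OF density_metric_norm[OF assms(1)] assms(2,3)] 
  by (cases "v = 0") auto

section \<open>Upper and lower bounds for densities on compact sets\<close>

lemma density_normalize:
  assumes "density A F" "i \<in> charts A" "x \<in> chart_dom A i" "v \<noteq> 0" 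
  shows "F i x v = norm v * F i x ((1 / norm v) *\<^sub>R v)"
proof -
  have "F i x (norm v *\<^sub>R ((1 / norm v) *\<^sub>R v)) = norm v * F i x ((1 / norm v) *\<^sub>R v)"
    using assms unfolding density_def by (metis norm_ge_zero)
  then show ?thesis using assms(4) by simp
qed

text \<open>By homogeneity a density is governed by its values on unit vectors; over a compact piece
  of a chart these values form a compact set, whose bound and minimum give the two local estimates
  against the norm of the model space.\<close>

lemma density_compact_image:
  assumes F: "density A F" and i: "i \<in> charts A" and K: "compact K" "K \<subseteq> chart_image A i"
  shows "compact ((\<lambda>(y, v). F i (chart_inv A i y) v) ` (K \<times> sphere 0 1))"
proof (rule compact_continuous_image)
  have "continuous_on (chart_image A i \<times> UNIV) (\<lambda>(y, v). F i (chart_inv A i y) v)"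
    using F i unfolding density_def by blast
  then show "continuous_on (K \<times> sphere 0 1) (\<lambda>(y, v). F i (chart_inv A i y) v)"
    by (rule continuous_on_subset) (use K in auto)
  show "compact (K \<times> sphere (0::'e) 1)" 
  proof (rule compact_Times[OF K(1)])
    have "sphere (0::'e) 1 = cball 0 1 \<inter> {v. norm v = 1}" by auto
    moreover have "closed {v::'e. norm v = 1}" by (intro closed_Collect_eq continuous_intros)
    then have "compact (cball (0::'e) 1 \<inter> {v. norm v = 1})" by (rule compact_Int_closed[OF compact_cball])
    ultimately show "compact (sphere (0::'e) 1)" by simp
  qed
qed

lemma density_local_upper:
  assumes F: "density A F" and i: "i \<in> charts A" and K: "compact K" "K \<subseteq> chart_image A i"
  shows "\<exists>C>0. \<forall>y\<in>K. \<forall>v. \<bar>F i (chart_inv A i y) v\<bar> \<le> C * norm v"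
proof -
  have "bounded ((\<lambda>(y, v). F i (chart_inv A i y) v) ` (K \<times> sphere 0 1))"
    by (rule compact_imp_bounded[OF density_compact_image[OF assms]])
  then obtain C where C: "C > 0" "\<And>y v. y \<in> K \<Longrightarrow> norm v = 1 \<Longrightarrow> \<bar>F i (chart_inv A i y) v\<bar> \<le> C"
    unfolding bounded_pos by force
  have "\<bar>F i (chart_inv A i y) v\<bar> \<le> C * norm v" if y: "y \<in> K" for y v
  proof (cases "v = 0")
    case True
    then show ?thesis using density_zero[OF F i inv_in_dom[OF i]] y K by auto
  next
    case False
    have "F i (chart_inv A i y) v = norm v * F i (chart_inv A i y) ((1 / norm v) *\<^sub>R v)"
      using density_normalize[OF F i inv_in_dom[OF i] False] y K by auto
    then have "\<bar>F i (chart_inv A i y) v\<bar> = norm v * \<bar>F i (chart_inv A i y) ((1 / norm v) *\<^sub>R v)\<bar>" 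
      by (simp add: abs_mult)
    also have "\<dots> \<le> norm v * C" using C(2)[OF y] False by (intro mult_left_mono) auto
    finally show ?thesis by (simp add: mult.commute)
  qed
  then show ?thesis using C(1) by blast
qed

lemma density_local_lower:
  assumes F: "density A F" and i: "i \<in> charts A" and K: "compact K" "K \<subseteq> chart_image A i"
    and pos: "\<And>x v. x \<in> chart_dom A i \<Longrightarrow> v \<noteq> 0 \<Longrightarrow> 0 < F i x v"
  shows "\<exists>c>0. \<forall>y\<in>K. \<forall>v. c * norm v \<le> F i (chart_inv A i y) v"
proof -
  let ?I = "(\<lambda>(y, v). F i (chart_inv A i y) v) ` (K \<times> sphere 0 1)"
  have "\<exists>c>0. \<forall>z\<in>?I. c \<le> z"
  \<comment> \<open>\<open>?I\<close> is empty if \<open>K\<close> is empty or the model space has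
    dimension 0; any positive constant is right then.\<close>
  proof (cases "?I = {}")
    case False
    obtain z where z: "z \<in> ?I" "\<forall>w\<in>?I. z \<le> w" 
      using compact_attains_inf[OF density_compact_image[OF F i K] False] by blast
    obtain y v where yv: "y \<in> K" "norm v = 1" "z = F i (chart_inv A i y) v" using z(1) by auto
    have "v \<noteq> 0" using yv(2) by auto
    then have "0 < z" using pos[of "chart_inv A i y" v] yv K inv_in_dom[OF i] by auto
    then show ?thesis using z(2) by blast
  qed (auto intro: exI[of _ 1])
  then obtain c where c: "c > 0" "\<And>y v. y \<in> K \<Longrightarrow> norm v = 1 \<Longrightarrow> c \<le> F i (chart_inv A i y) v" by force
  have "c * norm v \<le> F i (chart_inv A i y) v" if y: "y \<in> K" for y v
  proof (cases "v = 0")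
    case True
    then show ?thesis using density_zero[OF F i inv_in_dom[OF i]] y K by auto
  next
    case False
    have "c * norm v \<le> norm v * F i (chart_inv A i y) ((1 / norm v) *\<^sub>R v)"
      using c(2)[OF y, of "(1 / norm v) *\<^sub>R v"] False by (subst mult.commute, intro mult_left_mono) auto
    also have "\<dots> = F i (chart_inv A i y) v"
      using density_normalize[OF F i inv_in_dom[OF i] False] y K by auto
    finally show ?thesis .
  qed
  then show ?thesis using c(1) by blast
qed

lemma chart_ball:
  assumes x: "x \<in> M"
  shows "\<exists>i r. i \<in> charts A \<and> x \<in> chart_dom A i \<and> r > 0 \<and> cball (chart_map A i x) r \<subseteq> chart_image A i"
proof -
  have i: "chart_at A x \<in> charts A" "x \<in> chart_dom A (chart_at A x)" using chart_at[OF x] by auto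
  then show ?thesis
    using open_contains_cball[of "chart_image A (chart_at A x)"] open_image[OF i(1)] map_in_image[OF i(2)] by blast
qed

lemma chart_ball_open:
  assumes i: "i \<in> charts A"
  shows "openin (top_of_set M) {z \<in> chart_dom A i. chart_map A i z \<in> ball y r}"
proof -
  have "openin (top_of_set (chart_dom A i)) (chart_dom A i \<inter> chart_map A i -` ball y r)"
    by (rule continuous_openin_preimage_gen[OF continuous_map[OF i]]) simp
  then show ?thesis using openin_trans[OF _ open_dom[OF i]] by (simp add: vimage_def Int_def)
qed

text \<open>Near a point both densities are compared with the norm in one chart, and coordinate
  invariance carries the quotient \<open>C / c\<close> to all other charts. With the metric norm as
  \<open>G\<close> it bounds line integrals by lengths.\<close>

lemma density_comparison:
  assumes M: "compact M" and F: "density A F" and G: "density A G"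
    and pos: "\<And>i x v. i \<in> charts A \<Longrightarrow> x \<in> chart_dom A i \<Longrightarrow> v \<noteq> 0 \<Longrightarrow> 0 < G i x v"
  shows "\<exists>C>0. \<forall>x\<in>M. \<forall>i\<in>charts A. x \<in> chart_dom A i \<longrightarrow> (\<forall>v. \<bar>F i x v\<bar> \<le> C * G i x v)"
proof (rule compact_local_bound[OF M])
  have nonneg: "0 \<le> G i x v" if "i \<in> charts A" "x \<in> chart_dom A i" for i x v
    using pos[OF that, of v] density_zero[OF G that] by (cases "v = 0") auto
  fix x c d 
  assume *: "\<forall>i\<in>charts A. x \<in> chart_dom A i \<longrightarrow> (\<forall>v. \<bar>F i x v\<bar> \<le> c * G i x v)" and cd: "c \<le> (d::real)"
  show "\<forall>i\<in>charts A. x \<in> chart_dom A i \<longrightarrow> (\<forall>v. \<bar>F i x v\<bar> \<le> d * G i x v)"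
  proof (intro ballI impI allI)
    fix i v assume i: "i \<in> charts A" "x \<in> chart_dom A i"
    have "c * G i x v \<le> d * G i x v" using nonneg[OF i] cd by (intro mult_right_mono)
    moreover have "\<bar>F i x v\<bar> \<le> c * G i x v" using * i by blast
    ultimately show "\<bar>F i x v\<bar> \<le> d * G i x v" by linarith
  qed
next
  fix x assume x: "x \<in> M"
  obtain i r where i: "i \<in> charts A" "x \<in> chart_dom A i" "r > 0" "cball (chart_map A i x) r \<subseteq> chart_image A i"
    using chart_ball[OF x] by blast
  let ?K = "cball (chart_map A i x) r" and ?U = "{z \<in> chart_dom A i. chart_map A i z \<in> ball (chart_map A i x) r}"
  obtain C where C: "C > 0" "\<forall>y\<in>?K. \<forall>v. \<bar>F i (chart_inv A i y) v\<bar> \<le> C * norm v"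
    using density_local_upper[OF F i(1) compact_cball i(4)] by blast
  obtain c where c: "c > 0" "\<forall>y\<in>?K. \<forall>v. c * norm v \<le> G i (chart_inv A i y) v"
    using density_local_lower[OF G i(1) compact_cball i(4) pos[OF i(1)]] by blast
  have main: "\<bar>F j z w\<bar> \<le> (C / c) * G j z w" if z: "z \<in> ?U" and j: "j \<in> charts A" "z \<in> chart_dom A j" for z j w
  proof -
    define v where "v = coord_change A j i z w"
    have zi: "z \<in> chart_dom A i" and zk: "chart_map A i z \<in> ?K" using z by auto
    have FG: "F j z w = F i z v" "G j z w = G i z v" 
      using F G i(1) j zi unfolding density_def v_def by blast+
    moreover have "\<bar>F i z v\<bar> \<le> C * norm v" using C(2) zk zi i(1) by (metis inv_map)
    moreover have cG: "c * norm v \<le> G i z v" using c(2) zk zi i(1) by (metis inv_map)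
    moreover have "C * norm v \<le> C / c * G i z v"
    proof -
      have "C * norm v = (C / c) * (c * norm v)" using c(1) by simp
      also have "\<dots> \<le> (C / c) * G i z v" using cG C(1) c(1) by (intro mult_left_mono) auto
      finally show ?thesis .
    qed
    ultimately have "\<bar>F i z v\<bar> \<le> C / c * G i z v" by linarith
    then show ?thesis using FG by simp
  qed
  have "openin (top_of_set M) ?U" "x \<in> ?U" using chart_ball_open[OF i(1)] i by auto
  with main show "\<exists>U c. openin (top_of_set M) U \<and> x \<in> U \<and> 
      (\<forall>y\<in>U. \<forall>i\<in>charts A. y \<in> chart_dom A i \<longrightarrow> (\<forall>v. \<bar>F i y v\<bar> \<le> c * G i y v))"
    by (intro exI[of _ ?U] exI[of _ "C / c"]) blast
qed

end

section \<open>Piecewise smooth paths and integrals of densities\<close>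

text \<open>Break points are added on the right, so that facts about piecewise C1 paths follow by
  rule induction. A degenerate interval is the start; \<open>pw_C1_iff\<close> recovers the sequence
  of break points in \<open>piecewise_C1_path\<close>.\<close>

inductive pw_C1 :: "('a, 'e::real_normed_vector, 'i) atlas \<Rightarrow> (real \<Rightarrow> 'a) \<Rightarrow> real \<Rightarrow> real \<Rightarrow> bool"
  for A \<gamma> where
  pw_C1_refl: "pw_C1 A \<gamma> a a"
| pw_C1_step: "pw_C1 A \<gamma> a b \<Longrightarrow> b < c \<Longrightarrow> C1_path_on A b c \<gamma> \<Longrightarrow> pw_C1 A \<gamma> a c"

lemma pw_C1_le: "pw_C1 A \<gamma> a b \<Longrightarrow> a \<le> b"
  by (induction rule: pw_C1.induct) auto

lemma pw_C1_single: "a < b \<Longrightarrow> C1_path_on A a b \<gamma> \<Longrightarrow> pw_C1 A \<gamma> a b"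
  by (rule pw_C1_step[OF pw_C1_refl])

text \<open>The induction runs over the right-hand piece, which is therefore the first
  premise.\<close>

lemma pw_C1_trans: "pw_C1 A \<gamma> b c \<Longrightarrow> pw_C1 A \<gamma> a b \<Longrightarrow> pw_C1 A \<gamma> a c"
  by (induction rule: pw_C1.induct) (auto intro: pw_C1_step)

lemma pw_C1_iff:
  "pw_C1 A \<gamma> a b \<longleftrightarrow>
     (\<exists>n (s :: nat \<Rightarrow> real). s 0 = a \<and> s n = b \<and> (\<forall>j<n. s j < s (Suc j) \<and> C1_path_on A (s j) (s (Suc j)) \<gamma>))"
proof
  assume "pw_C1 A \<gamma> a b"
  then show "\<exists>n (s :: nat \<Rightarrow> real). s 0 = a \<and> s n = b \<and> (\<forall>j<n. s j < s (Suc j) \<and> C1_path_on A (s j) (s (Suc j)) \<gamma>)"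
  proof (induction rule: pw_C1.induct)
    case (pw_C1_refl a)
    show ?case by (rule exI[of _ 0], rule exI[of _ "\<lambda>_. a"]) simp
  next
    case (pw_C1_step a b c)
    then obtain n s where s: "s 0 = a" "s n = b" "\<forall>j<n. s j < s (Suc j) \<and> C1_path_on A (s j) (s (Suc j)) \<gamma>" by blast
    show ?case
    proof (rule exI[of _ "Suc n"], rule exI[of _ "s(Suc n := c)"], intro conjI allI impI)
      fix j assume "j < Suc n"
      then consider "j < n" | "j = n" by linarith
      then show "(s(Suc n := c)) j < (s(Suc n := c)) (Suc j)" 
        "C1_path_on A ((s(Suc n := c)) j) ((s(Suc n := c)) (Suc j)) \<gamma>"
        using s pw_C1_step.hyps by (cases; simp)+
    qed (use s in simp_all)
  qed
next
  assume "\<exists>n (s :: nat \<Rightarrow> real). s 0 = a \<and> s n = b \<and> (\<forall>j<n. s j < s (Suc j) \<and> C1_path_on A (s j) (s (Suc j)) \<gamma>)"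
  then obtain n s where s: "s 0 = a" "s n = b" "\<And>j. j < n \<Longrightarrow> s j < s (Suc j) \<and> C1_path_on A (s j) (s (Suc j)) \<gamma>" by blast
  have "pw_C1 A \<gamma> a (s k)" if "k \<le> n" for k
    using that
  proof (induction k)
    case 0
    then show ?case using s(1) by (simp add: pw_C1_refl)
  next
    case (Suc k)
    then have "pw_C1 A \<gamma> a (s k)" by simp
    from pw_C1_step[OF this] s(3)[of k] Suc.prems show ?case by simp
  qed
  then show "pw_C1 A \<gamma> a b" using s(2) by blast
qed

lemma piecewise_C1_path_iff:
  "piecewise_C1_path A X \<gamma> \<longleftrightarrow> path \<gamma> \<and> path_image \<gamma> \<subseteq> X \<and> pw_C1 A \<gamma> 0 1"
  unfolding piecewise_C1_path_def pw_C1_iff by blast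

section \<open>Changes outside the interval and affine reparametrization\<close>

lemma C1_path_on_cong:
  assumes "C1_path_on A a b \<gamma>" "\<And>t. t \<in> {a..b} \<Longrightarrow> \<delta> t = \<gamma> t"
  shows "C1_path_on A a b \<delta>"
  unfolding C1_path_on_def
proof
  fix i assume "i \<in> charts A"
  then obtain D where D: "\<forall>t\<in>{a..b}. \<gamma> t \<in> chart_dom A i \<longrightarrow> ((chart_map A i \<circ> \<gamma>) has_vector_derivative D t) (at t within {a..b})"
    "continuous_on {t\<in>{a..b}. \<gamma> t \<in> chart_dom A i} D" using assms(1) unfolding C1_path_on_def by blast
  show "\<exists>D. (\<forall>t\<in>{a..b}. \<delta> t \<in> chart_dom A i \<longrightarrow> ((chart_map A i \<circ> \<delta>) has_vector_derivative D t) (at t within {a..b})) \<and>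
        continuous_on {t\<in>{a..b}. \<delta> t \<in> chart_dom A i} D"
  proof (intro exI conjI ballI impI)
    have "{t\<in>{a..b}. \<delta> t \<in> chart_dom A i} = {t\<in>{a..b}. \<gamma> t \<in> chart_dom A i}" using assms(2) by auto
    then show "continuous_on {t\<in>{a..b}. \<delta> t \<in> chart_dom A i} D" using D(2) by simp
    fix t assume t: "t \<in> {a..b}" "\<delta> t \<in> chart_dom A i"
    have "((chart_map A i \<circ> \<gamma>) has_vector_derivative D t) (at t within {a..b})" using D(1) t assms(2)[OF t(1)] by simp
    then show "((chart_map A i \<circ> \<delta>) has_vector_derivative D t) (at t within {a..b})"
      by (rule has_vector_derivative_transform[OF t(1), rotated]) (simp add: assms(2))
  qed
qed

lemma C1_path_on_affine:
  assumes C: "C1_path_on A a b \<gamma>" and sub: "\<And>t. t \<in> {a'..b'} \<Longrightarrow> m * t + c \<in> {a..b}"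
  shows "C1_path_on A a' b' (\<lambda>t. \<gamma> (m * t + c))"
  unfolding C1_path_on_def
proof
  fix i assume "i \<in> charts A"
  then obtain D where D: "\<forall>t\<in>{a..b}. \<gamma> t \<in> chart_dom A i \<longrightarrow> ((chart_map A i \<circ> \<gamma>) has_vector_derivative D t) (at t within {a..b})"
    "continuous_on {t\<in>{a..b}. \<gamma> t \<in> chart_dom A i} D" using C unfolding C1_path_on_def by blast
  show "\<exists>D. (\<forall>t\<in>{a'..b'}. \<gamma> (m * t + c) \<in> chart_dom A i \<longrightarrow> ((chart_map A i \<circ> (\<lambda>t. \<gamma> (m * t + c))) has_vector_derivative D t) (at t within {a'..b'})) \<and>
        continuous_on {t\<in>{a'..b'}. \<gamma> (m * t + c) \<in> chart_dom A i} D"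
  proof (intro exI[of _ "\<lambda>t. m *\<^sub>R D (m * t + c)"] conjI ballI impI)
    have "continuous_on {t\<in>{a'..b'}. \<gamma> (m * t + c) \<in> chart_dom A i} (\<lambda>t. D (m * t + c))"
      by (rule continuous_on_compose2[OF D(2)]) (use sub in \<open>auto intro!: continuous_intros\<close>)
    then show "continuous_on {t\<in>{a'..b'}. \<gamma> (m * t + c) \<in> chart_dom A i} (\<lambda>t. m *\<^sub>R D (m * t + c))"
      by (intro continuous_intros)
    fix t assume t: "t \<in> {a'..b'}" "\<gamma> (m * t + c) \<in> chart_dom A i"
    have 1: "((\<lambda>t. m * t + c) has_vector_derivative m) (at t within {a'..b'})"
      by (auto intro!: derivative_eq_intros simp: has_vector_derivative_def)
    have "((chart_map A i \<circ> \<gamma>) has_vector_derivative D (m * t + c)) (at (m * t + c) within {a..b})" using D(1) t sub by blast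
    then have 2: "((chart_map A i \<circ> \<gamma>) has_vector_derivative D (m * t + c)) (at (m * t + c) within (\<lambda>t. m * t + c) ` {a'..b'})"
      by (rule has_vector_derivative_within_subset) (use sub in auto)
    show "((chart_map A i \<circ> (\<lambda>t. \<gamma> (m * t + c))) has_vector_derivative m *\<^sub>R D (m * t + c)) (at t within {a'..b'})"
      using vector_diff_chain_within[OF 1 2] by (simp add: o_def)
  qed
qed

lemma pw_C1_cong:
  assumes "pw_C1 A \<gamma> a b" "\<And>t. t \<in> {a..b} \<Longrightarrow> \<delta> t = \<gamma> t"
  shows "pw_C1 A \<delta> a b"
  using assms
proof (induction rule: pw_C1.induct)
  case (pw_C1_refl a)
  show ?case by (rule pw_C1.pw_C1_refl)
next
  case (pw_C1_step a b c)
  have "a \<le> b" using pw_C1_le[OF pw_C1_step.hyps(1)] .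
  then show ?case 
    using pw_C1_step by (intro pw_C1.pw_C1_step[of A \<delta> a b c] C1_path_on_cong[of A b c \<gamma> \<delta>]) auto
qed

lemma pw_C1_affine_pos:
  assumes "pw_C1 A \<gamma> a b" "0 < m"
  shows "pw_C1 A (\<lambda>t. \<gamma> (m * t + c)) ((a - c) / m) ((b - c) / m)"
  using assms(1)
proof (induction rule: pw_C1.induct)
  case (pw_C1_refl a)
  show ?case by (rule pw_C1.pw_C1_refl)
next
  case (pw_C1_step a b d)
  show ?case
  proof (rule pw_C1.pw_C1_step[OF pw_C1_step.IH])
    show "(b - c) / m < (d - c) / m" using assms(2) pw_C1_step.hyps by (simp add: divide_strict_right_mono)
    show "C1_path_on A ((b - c) / m) ((d - c) / m) (\<lambda>t. \<gamma> (m * t + c))"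
      by (rule C1_path_on_affine[OF pw_C1_step.hyps(3)]) (use assms(2) in \<open>auto simp: field_simps\<close>)
  qed
qed

text \<open>Reversal turns the last piece into the first one, so each new piece is prepended by
  \<open>pw_C1_trans\<close>.\<close>

lemma pw_C1_affine_neg:
  assumes "pw_C1 A \<gamma> a b" "m < 0"
  shows "pw_C1 A (\<lambda>t. \<gamma> (m * t + c)) ((b - c) / m) ((a - c) / m)"
  using assms(1)
proof (induction rule: pw_C1.induct)
  case (pw_C1_refl a)
  show ?case by (rule pw_C1.pw_C1_refl)
next
  case (pw_C1_step a b d)
  show ?case
  proof (rule pw_C1_trans[OF pw_C1_step.IH], rule pw_C1_single)
    show "(d - c) / m < (b - c) / m" using assms(2) pw_C1_step.hyps by (simp add: divide_strict_right_mono_neg)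
    show "C1_path_on A ((d - c) / m) ((b - c) / m) (\<lambda>t. \<gamma> (m * t + c))"
      by (rule C1_path_on_affine[OF pw_C1_step.hyps(3)]) (use assms(2) in \<open>auto simp: field_simps\<close>)
  qed
qed

text \<open>The two-sided derivative makes the integrand local in \<open>t\<close>, free of the
  fixed interval \<open>{0..1}\<close> in \<open>velocity\<close>; thus it can be studied on
  subintervals and under rescaling. At ends and break points the derivative may be an arbitrary
  value, which an integral does not see.\<close>

definition dens :: "('a, 'e::real_normed_vector, 'i) atlas \<Rightarrow> ('i \<Rightarrow> 'a \<Rightarrow> 'e \<Rightarrow> real) \<Rightarrow> (real \<Rightarrow> 'a) \<Rightarrow> real \<Rightarrow> real" where
  "dens A F \<gamma> t = F (chart_at A (\<gamma> t)) (\<gamma> t) (vector_derivative (chart_map A (chart_at A (\<gamma> t)) \<circ> \<gamma>) (at t))"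

lemma dens_cong:
  assumes "\<And>s. s \<in> {a<..<b} \<Longrightarrow> \<delta> s = \<gamma> s" "t \<in> {a<..<b}"
  shows "dens A F \<delta> t = dens A F \<gamma> t"
proof -
  have "vector_derivative (chart_map A (chart_at A (\<gamma> t)) \<circ> \<delta>) (at t) = vector_derivative (chart_map A (chart_at A (\<gamma> t)) \<circ> \<gamma>) (at t)"
  proof (rule vector_derivative_cong_eq)
    have "\<forall>\<^sub>F x in nhds t. x \<in> {a<..<b}" by (rule eventually_nhds_in_open) (use assms(2) in auto)
    then show "\<forall>\<^sub>F x in nhds t. x \<in> UNIV \<longrightarrow> (chart_map A (chart_at A (\<gamma> t)) \<circ> \<delta>) x = (chart_map A (chart_at A (\<gamma> t)) \<circ> \<gamma>) x"
      by eventually_elim (simp add: assms(1))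
  qed auto
  moreover have "\<delta> t = \<gamma> t" using assms by blast
  ultimately show ?thesis by (simp add: dens_def)
qed

definition dens_integral :: "('a, 'e::real_normed_vector, 'i) atlas \<Rightarrow> ('i \<Rightarrow> 'a \<Rightarrow> 'e \<Rightarrow> real) \<Rightarrow> (real \<Rightarrow> 'a) \<Rightarrow> real" where
  "dens_integral A F \<gamma> = integral {0..1} (dens A F \<gamma>)"

lemma velocity_eq:
  assumes "t \<in> {0..1} - {0, 1}"
  shows "velocity A \<gamma> t = vector_derivative (chart_map A (chart_at A (\<gamma> t)) \<circ> \<gamma>) (at t)"
proof -
  have "0 < t" "t < 1" using assms by auto
  then show ?thesis unfolding velocity_def by (simp add: at_within_Icc_at)
qed

lemma line_integral_eq: "line_integral A \<omega> \<gamma> = dens_integral A \<omega> \<gamma>"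
  unfolding line_integral_def dens_integral_def
proof (rule integral_spike[of "{0, 1}"])
  fix t assume "t \<in> {0..1} - {0, 1 :: real}"
  then show "dens A \<omega> \<gamma> t = \<omega> (chart_at A (\<gamma> t)) (\<gamma> t) (velocity A \<gamma> t)" by (simp only: velocity_eq dens_def)
qed simp

lemma path_length_eq: "path_length A gm \<gamma> = dens_integral A (metric_norm gm) \<gamma>"
  unfolding path_length_def dens_integral_def
proof (rule integral_spike[of "{0, 1}"])
  fix t assume "t \<in> {0..1} - {0, 1 :: real}"
  then show "dens A (metric_norm gm) \<gamma> t = sqrt (gm (chart_at A (\<gamma> t)) (\<gamma> t) (velocity A \<gamma> t) (velocity A \<gamma> t))"
    by (simp only: velocity_eq dens_def metric_norm_def)
qed simp

section \<open>Integrability and change of variables\<close>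

context smooth_mfd
begin

text \<open>The exceptional set consists of break points and serves all charts at once, so that
  integrands can later be computed off one finite set.\<close>

lemma pw_C1_differentiable:
  assumes "pw_C1 A \<gamma> a b"
  shows "\<exists>S. finite S \<and> (\<forall>t\<in>{a<..<b} - S. \<forall>i\<in>charts A. \<gamma> t \<in> chart_dom A i \<longrightarrow>
           (\<exists>D. ((chart_map A i \<circ> \<gamma>) has_vector_derivative D) (at t)))"
  using assms
proof (induction rule: pw_C1.induct)
  case (pw_C1_refl a)
  show ?case by (rule exI[of _ "{}"]) simp
next
  case (pw_C1_step a b c)
  then obtain S where S: "finite S" "\<forall>t\<in>{a<..<b} - S. \<forall>i\<in>charts A. \<gamma> t \<in> chart_dom A i \<longrightarrow>
           (\<exists>D. ((chart_map A i \<circ> \<gamma>) has_vector_derivative D) (at t))" by blast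
  show ?case
  proof (rule exI[of _ "insert b S"], intro conjI ballI impI)
    fix t i assume t: "t \<in> {a<..<c} - insert b S" "i \<in> charts A" "\<gamma> t \<in> chart_dom A i"
    show "\<exists>D. ((chart_map A i \<circ> \<gamma>) has_vector_derivative D) (at t)"
    proof (cases "t < b")
      case True
      then show ?thesis using S(2) t by auto
    next
      case False
      then have bt: "b < t" "t < c" using t by auto
      obtain D where "\<forall>t\<in>{b..c}. \<gamma> t \<in> chart_dom A i \<longrightarrow> ((chart_map A i \<circ> \<gamma>) has_vector_derivative D t) (at t within {b..c})"
        using pw_C1_step.hyps(3) t(2) unfolding C1_path_on_def by blast
      then have "((chart_map A i \<circ> \<gamma>) has_vector_derivative D t) (at t within {b..c})" using bt t by auto
      then show ?thesis using bt by (auto simp: at_within_Icc_at)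
    qed
  qed (use S in simp)
qed

text \<open>\<open>chart_at\<close> may jump from chart to chart along \<gamma>; invariance under
  coordinate changes lets the integrand be computed in whichever chart is convenient.\<close>

lemma dens_eq:
  assumes F: "density A F" and g: "continuous_on {a..b} \<gamma>" "\<gamma> ` {a..b} \<subseteq> M" and t: "t \<in> {a<..<b}"
    and i: "i \<in> charts A" "\<gamma> t \<in> chart_dom A i" and D: "((chart_map A i \<circ> \<gamma>) has_vector_derivative D) (at t)"
  shows "dens A F \<gamma> t = F i (\<gamma> t) D"
proof -
  let ?j = "chart_at A (\<gamma> t)"
  have "\<gamma> t \<in> M" using g t by auto
  then have j: "?j \<in> charts A" "\<gamma> t \<in> chart_dom A ?j" using chart_at by auto
  have at: "at t within {a<..<b} = at t" by (rule at_within_open[OF t open_greaterThanLessThan])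
  have "continuous_on {a<..<b} \<gamma>" using g(1) by (rule continuous_on_subset) auto
  then have c: "continuous (at t within {a<..<b}) \<gamma>" using t by (simp add: continuous_on_eq_continuous_within)
  have "\<gamma> ` {a<..<b} \<subseteq> M" using g(2) by auto
  then have "((chart_map A ?j \<circ> \<gamma>) has_vector_derivative coord_change A i ?j (\<gamma> t) D) (at t)"
    using chart_change[OF i(1) j(1) c _ t i(2) j(2)] D at by simp
  then have "dens A F \<gamma> t = F ?j (\<gamma> t) (coord_change A i ?j (\<gamma> t) D)" by (simp add: dens_def vector_derivative_at)
  moreover have "F i (\<gamma> t) D = F ?j (\<gamma> t) (coord_change A i ?j (\<gamma> t) D)" using F i j unfolding density_def by blast
  ultimately show ?thesis by simp
qed

lemma C1_dens_integrable:
  assumes F: "density A F" and g: "continuous_on {a..b} \<gamma>" "\<gamma> ` {a..b} \<subseteq> M" and ab: "a < b"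
    and C: "C1_path_on A a b \<gamma>"
  shows "dens A F \<gamma> integrable_on {a..b}"
proof -
  let ?j = "\<lambda>t. chart_at A (\<gamma> t)"
  \<comment> \<open>\<open>e\<close> can differ from the integrand only at the ends, where it takes
    one-sided derivatives. In spite of the arbitrary choice of charts it is continuous, being
    \<open>F i (\<gamma> s) (D s)\<close> near each point for one fixed chart
    \<open>i\<close>.\<close>
  define e where "e t = F (?j t) (\<gamma> t) (vector_derivative (chart_map A (?j t) \<circ> \<gamma>) (at t within {a..b}))" for t
  have nt: "at t within {a..b} \<noteq> bot" if "t \<in> {a..b}" for t
    using ab that by (simp add: trivial_limit_within islimpt_Icc)
  have "continuous_on {a..b} e"
  proof (rule continuous_on_openin_local)
    fix t assume t: "t \<in> {a..b}"
    define i where "i = ?j t"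
    have "\<gamma> t \<in> M" using g(2) t by blast
    then have i: "i \<in> charts A" "\<gamma> t \<in> chart_dom A i" unfolding i_def by (rule chart_at)+
    let ?N = "{t \<in> {a..b}. \<gamma> t \<in> chart_dom A i}"
    have N: "openin (top_of_set {a..b}) ?N"
      using continuous_openin_preimage[OF g(1) _ open_dom[OF i(1)]] g(2) 
      by (simp add: image_subset_iff_funcset vimage_def Int_def)
    obtain D where D: "\<forall>t\<in>{a..b}. \<gamma> t \<in> chart_dom A i \<longrightarrow> ((chart_map A i \<circ> \<gamma>) has_vector_derivative D t) (at t within {a..b})"
      "continuous_on ?N D" using C i(1) unfolding C1_path_on_def by blast
    have e: "e s = F i (\<gamma> s) (D s)" if s: "s \<in> ?N" for s
    proof -
      have sM: "\<gamma> s \<in> M" using s g(2) by auto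
      have j: "?j s \<in> charts A" "\<gamma> s \<in> chart_dom A (?j s)" using chart_at[OF sM] by auto
      have c: "continuous (at s within {a..b}) \<gamma>" using g(1) s by (simp add: continuous_on_eq_continuous_within)
      have d: "((chart_map A i \<circ> \<gamma>) has_vector_derivative D s) (at s within {a..b})" using D(1) s by blast
      have sab: "s \<in> {a..b}" "\<gamma> s \<in> chart_dom A i" using s by auto
      have "((chart_map A (?j s) \<circ> \<gamma>) has_vector_derivative coord_change A i (?j s) (\<gamma> s) (D s)) (at s within {a..b})"
        by (rule chart_change[OF i(1) j(1) c g(2) sab(1) sab(2) j(2) d])
      then have "vector_derivative (chart_map A (?j s) \<circ> \<gamma>) (at s within {a..b}) = coord_change A i (?j s) (\<gamma> s) (D s)"
        by (rule vector_derivative_within[OF nt[OF sab(1)]])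
      moreover have "F i (\<gamma> s) (D s) = F (?j s) (\<gamma> s) (coord_change A i (?j s) (\<gamma> s) (D s))" 
        using F i(1) j sab unfolding density_def by blast
      ultimately show ?thesis by (simp add: e_def)
    qed
    have "continuous_on ?N (\<lambda>s. (\<lambda>(y, v). F i (chart_inv A i y) v) (chart_map A i (\<gamma> s), D s))"
    proof (rule continuous_on_compose2[of "chart_image A i \<times> UNIV"])
      show "continuous_on (chart_image A i \<times> UNIV) (\<lambda>(y, v). F i (chart_inv A i y) v)"
        using F i(1) unfolding density_def by blast
      have "continuous_on ?N (\<lambda>s. chart_map A i (\<gamma> s))"
      proof (rule continuous_on_compose2[OF continuous_map[OF i(1)]])
        show "continuous_on ?N \<gamma>" by (rule continuous_on_subset[OF g(1)]) auto
      qed auto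
      then show "continuous_on ?N (\<lambda>s. (chart_map A i (\<gamma> s), D s))" using D(2) by (intro continuous_intros)
      show "(\<lambda>s. (chart_map A i (\<gamma> s), D s)) ` ?N \<subseteq> chart_image A i \<times> UNIV" using map_in_image by auto
    qed
    then have "continuous_on ?N e" by (rule continuous_on_eq) (use e i(1) in auto)
    then show "\<exists>N. openin (top_of_set {a..b}) N \<and> t \<in> N \<and> continuous_on N e" using N i(2) t by blast
  qed
  then have "e integrable_on {a..b}" by (rule integrable_continuous_interval)
  then show ?thesis
  proof (rule integrable_spike_finite[rotated 2])
    show "finite {a, b}" by simp
    fix t assume "t \<in> {a..b} - {a, b}"
    then have "a < t" "t < b" by auto
    then show "dens A F \<gamma> t = e t" by (simp add: dens_def e_def at_within_Icc_at)
  qed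
qed

lemma dens_integrable:
  assumes F: "density A F" and C: "pw_C1 A \<gamma> a b" and g: "continuous_on {a..b} \<gamma>" "\<gamma> ` {a..b} \<subseteq> M"
  shows "dens A F \<gamma> integrable_on {a..b}"
  using C g
proof (induction rule: pw_C1.induct)
  case (pw_C1_refl a)
  show ?case using integrable_on_refl[of _ a] by (simp add: cbox_interval)
next
  case (pw_C1_step a b c)
  have ab: "a \<le> b" using pw_C1_le[OF pw_C1_step.hyps(1)] .
  then have sub: "{a..b} \<subseteq> {a..c}" "{b..c} \<subseteq> {a..c}" using pw_C1_step.hyps(2) by auto
  have 1: "dens A F \<gamma> integrable_on {a..b}"
    using pw_C1_step.IH continuous_on_subset[OF pw_C1_step.prems(1) sub(1)] pw_C1_step.prems(2) sub(1) by blast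
  have 2: "dens A F \<gamma> integrable_on {b..c}"
    using C1_dens_integrable[OF F continuous_on_subset[OF pw_C1_step.prems(1) sub(2)] _ pw_C1_step.hyps(2,3)] 
      pw_C1_step.prems(2) sub(2) by blast
  show ?case using Henstock_Kurzweil_Integration.integrable_combine[OF ab _ 1 2] pw_C1_step.hyps(2) by simp
qed

text \<open>The factor \<open>\<bar>m\<bar>\<close> cancels the one from the substitution. For
  positive \<open>m\<close> the last premise is homogeneity, whereas \<open>m = - 1\<close> asks for
  an even density such as a metric norm. The new interval is written as an image to match the
  substitution rule.\<close>

lemma dens_integral_affine:
  assumes F: "density A F" and C: "pw_C1 A \<gamma> a b" and g: "continuous_on {a..b} \<gamma>" "\<gamma> ` {a..b} \<subseteq> M"
    and m: "m \<noteq> 0" and I: "{a'..b'} = (\<lambda>x. (1 / m) *\<^sub>R x + - ((1 / m) *\<^sub>R c)) ` {a..b}"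
    and hom: "\<And>i x v. i \<in> charts A \<Longrightarrow> x \<in> chart_dom A i \<Longrightarrow> F i x (m *\<^sub>R v) = \<bar>m\<bar> * F i x v"
  shows "integral {a'..b'} (dens A F (\<lambda>t. \<gamma> (m * t + c))) = integral {a..b} (dens A F \<gamma>)"
proof -
  obtain S where S: "finite S" "\<forall>t\<in>{a<..<b} - S. \<forall>i\<in>charts A. \<gamma> t \<in> chart_dom A i \<longrightarrow>
           (\<exists>D. ((chart_map A i \<circ> \<gamma>) has_vector_derivative D) (at t))"
    using pw_C1_differentiable[OF C] by blast
  let ?B = "(\<lambda>x. (x - c) / m) ` (S \<union> {a, b})"
  have "(dens A F \<gamma> has_integral integral {a..b} (dens A F \<gamma>)) (cbox a b)"
    using dens_integrable[OF F C g] by (simp add: integrable_integral cbox_interval)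
  from has_integral_affinity[OF this m, of c]
  have "((\<lambda>x. dens A F \<gamma> (m * x + c)) has_integral (1 / \<bar>m\<bar>) * integral {a..b} (dens A F \<gamma>)) {a'..b'}"
    using I by (simp add: cbox_interval)
  then have "((\<lambda>x. \<bar>m\<bar> * dens A F \<gamma> (m * x + c)) has_integral \<bar>m\<bar> * ((1 / \<bar>m\<bar>) * integral {a..b} (dens A F \<gamma>))) {a'..b'}"
    by (rule has_integral_mult_right)
  then have "((\<lambda>x. \<bar>m\<bar> * dens A F \<gamma> (m * x + c)) has_integral integral {a..b} (dens A F \<gamma>)) {a'..b'}"
    using m by simp
  then have "(dens A F (\<lambda>t. \<gamma> (m * t + c)) has_integral integral {a..b} (dens A F \<gamma>)) {a'..b'}"
  proof (rule has_integral_spike_finite[rotated 2])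
    show "finite ?B" using S(1) by simp
    fix t assume t: "t \<in> {a'..b'} - ?B"
    define s where "s = m * t + c"
    have ts: "t = (s - c) / m" using m by (simp add: s_def)
    have "s \<in> {a..b}" using t m unfolding I s_def by (auto simp: field_simps)
    moreover have "s \<notin> S \<union> {a, b}" using t ts by blast
    ultimately have sab: "s \<in> {a<..<b} - S" "s \<in> {a..b}" by auto
    let ?i = "chart_at A (\<gamma> s)"
    have "\<gamma> s \<in> M" using g(2) sab(2) by blast
    then have i: "?i \<in> charts A" "\<gamma> s \<in> chart_dom A ?i" by (rule chart_at)+
    obtain D where D: "((chart_map A ?i \<circ> \<gamma>) has_vector_derivative D) (at s)" using S(2) sab(1) i by blast
    have 1: "((\<lambda>t. m * t + c) has_vector_derivative m) (at t)"
      by (auto intro!: derivative_eq_intros simp: has_vector_derivative_def)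
    have "((chart_map A ?i \<circ> (\<lambda>t. \<gamma> (m * t + c))) has_vector_derivative m *\<^sub>R D) (at t)"
      using vector_diff_chain_at[OF 1 D[unfolded s_def]] by (simp add: o_def s_def)
    then have "dens A F (\<lambda>t. \<gamma> (m * t + c)) t = F ?i (\<gamma> s) (m *\<^sub>R D)"
      by (simp add: dens_def vector_derivative_at s_def)
    also have "\<dots> = \<bar>m\<bar> * dens A F \<gamma> s" using hom[OF i] D by (simp add: dens_def vector_derivative_at)
    finally show "dens A F (\<lambda>t. \<gamma> (m * t + c)) t = \<bar>m\<bar> * dens A F \<gamma> (m * t + c)" by (simp add: s_def)
  qed
  then show ?thesis by (rule integral_unique)
qed

section \<open>Concatenation, reversal and comparison of integrals\<close>

abbreviation paths :: "'a \<Rightarrow> 'a \<Rightarrow> (real \<Rightarrow> 'a) set" where "paths \<equiv> C1_paths_between A M"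

lemma paths_iff: "\<gamma> \<in> paths x y \<longleftrightarrow> path \<gamma> \<and> path_image \<gamma> \<subseteq> M \<and> pw_C1 A \<gamma> 0 1 \<and> pathstart \<gamma> = x \<and> pathfinish \<gamma> = y"
  unfolding C1_paths_between_def piecewise_C1_path_iff by blast

lemma paths_D:
  assumes "\<gamma> \<in> paths x y"
  shows "path \<gamma>" "path_image \<gamma> \<subseteq> M" "pw_C1 A \<gamma> 0 1" "pathstart \<gamma> = x" "pathfinish \<gamma> = y"
    "continuous_on {0..1} \<gamma>" "\<gamma> ` {0..1} \<subseteq> M" "\<gamma> 0 = x" "\<gamma> 1 = y"
  using assms by (simp_all add: paths_iff path_def path_image_def pathstart_def pathfinish_def)

lemma paths_dens_integrable:
  assumes "density A F" "\<gamma> \<in> paths x y" shows "dens A F \<gamma> integrable_on {0..1}"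
  by (rule dens_integrable[OF assms(1) paths_D(3,6,7)[OF assms(2)]])

lemma paths_join:
  assumes g: "\<gamma> \<in> paths x y" and d: "\<delta> \<in> paths y z"
  shows "\<gamma> +++ \<delta> \<in> paths x z"
proof -
  have "pw_C1 A (\<lambda>t. \<gamma> (2 * t)) 0 (1 / 2)" 
    using pw_C1_affine_pos[OF paths_D(3)[OF g], of 2 0] by simp
  then have 1: "pw_C1 A (\<gamma> +++ \<delta>) 0 (1/2)"
    by (rule pw_C1_cong) (simp add: joinpaths_def)
  have "pw_C1 A (\<lambda>t. \<delta> (2 * t + - 1)) (1 / 2) 1" 
    using pw_C1_affine_pos[OF paths_D(3)[OF d], of 2 "- 1"] by simp
  then have 2: "pw_C1 A (\<gamma> +++ \<delta>) (1/2) 1"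
  proof (rule pw_C1_cong)
    fix t :: real assume "t \<in> {1/2..1}"
    then show "(\<gamma> +++ \<delta>) t = \<delta> (2 * t + - 1)"
    \<comment> \<open>At the joint \<open>joinpaths\<close> evaluates \<gamma>, so this value uses
      that \<gamma> ends where \<delta> starts.\<close>
    proof (cases "t = 1/2")
      case True
      show ?thesis unfolding True using paths_D(8)[OF d] paths_D(9)[OF g] by (simp add: joinpaths_def)
    qed (auto simp: joinpaths_def)
  qed
  have "pw_C1 A (\<gamma> +++ \<delta>) 0 1" by (rule pw_C1_trans[OF 2 1])
  moreover have "path (\<gamma> +++ \<delta>)" "path_image (\<gamma> +++ \<delta>) \<subseteq> M" 
    using paths_D(1,2,5)[OF g] paths_D(1,2,4)[OF d] by (simp_all add: subset_path_image_join)
  ultimately show ?thesis using paths_D(4)[OF g] paths_D(5)[OF d] unfolding paths_iff by simp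
qed

lemma dens_integral_join:
  assumes F: "density A F" and g: "\<gamma> \<in> paths x y" and d: "\<delta> \<in> paths y z"
  shows "dens_integral A F (\<gamma> +++ \<delta>) = dens_integral A F \<gamma> + dens_integral A F \<delta>"
proof -
  have hom: "F i x (2 *\<^sub>R v) = \<bar>2\<bar> * F i x v" if "i \<in> charts A" "x \<in> chart_dom A i" for i x v
    using F that unfolding density_def by (metis abs_numeral zero_le_numeral)
  have "integral {0..1/2} (dens A F (\<gamma> +++ \<delta>)) = integral {0..1/2} (dens A F (\<lambda>t. \<gamma> (2 * t + 0)))"
  proof (rule integral_spike[of "{0, 1/2}"])
    fix t :: real assume "t \<in> {0..1/2} - {0, 1/2}"
    then show "dens A F (\<lambda>t. \<gamma> (2 * t + 0)) t = dens A F (\<gamma> +++ \<delta>) t"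
      by (intro dens_cong[of 0 "1/2"]) (auto simp: joinpaths_def)
  qed simp
  also have "\<dots> = dens_integral A F \<gamma>"
    unfolding dens_integral_def
    by (rule dens_integral_affine[OF F paths_D(3)[OF g] paths_D(6)[OF g] paths_D(7)[OF g] _ _ hom])
      (auto simp: image_affinity_atLeastAtMost_div)
  finally have 1: "integral {0..1/2} (dens A F (\<gamma> +++ \<delta>)) = dens_integral A F \<gamma>" .
  have "integral {1/2..1} (dens A F (\<gamma> +++ \<delta>)) = integral {1/2..1} (dens A F (\<lambda>t. \<delta> (2 * t + - 1)))"
  proof (rule integral_spike[of "{1/2, 1}"])
    fix t :: real assume "t \<in> {1/2..1} - {1/2, 1}"
    then show "dens A F (\<lambda>t. \<delta> (2 * t + - 1)) t = dens A F (\<gamma> +++ \<delta>) t"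
      by (intro dens_cong[of "1/2" 1]) (auto simp: joinpaths_def)
  qed simp
  also have "\<dots> = dens_integral A F \<delta>"
    unfolding dens_integral_def
    by (rule dens_integral_affine[OF F paths_D(3)[OF d] paths_D(6)[OF d] paths_D(7)[OF d] _ _ hom])
      (auto simp: image_affinity_atLeastAtMost_div)
  finally have 2: "integral {1/2..1} (dens A F (\<gamma> +++ \<delta>)) = dens_integral A F \<delta>" .
  have "integral {0..1/2} (dens A F (\<gamma> +++ \<delta>)) + integral {1/2..1} (dens A F (\<gamma> +++ \<delta>)) = dens_integral A F (\<gamma> +++ \<delta>)"
    unfolding dens_integral_def
    by (rule Henstock_Kurzweil_Integration.integral_combine) (use paths_dens_integrable[OF F paths_join[OF g d]] in auto)
  then show ?thesis using 1 2 by simp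
qed

lemma paths_reverse:
  assumes g: "\<gamma> \<in> paths x y" shows "reversepath \<gamma> \<in> paths y x"
proof -
  have "pw_C1 A (\<lambda>t. \<gamma> (1 - t)) 0 1" 
    using pw_C1_affine_neg[OF paths_D(3)[OF g], of "- 1" 1] by simp
  then have "pw_C1 A (reversepath \<gamma>) 0 1" by (rule pw_C1_cong) (simp add: reversepath_def)
  then show ?thesis using paths_D(1,2,4,5)[OF g] unfolding paths_iff by simp
qed

lemma dens_integral_reverse:
  assumes F: "density A F" and g: "\<gamma> \<in> paths x y"
    and even: "\<And>i x v. i \<in> charts A \<Longrightarrow> x \<in> chart_dom A i \<Longrightarrow> F i x (- v) = F i x v"
  shows "dens_integral A F (reversepath \<gamma>) = dens_integral A F \<gamma>"
proof -
  have "reversepath \<gamma> = (\<lambda>t. \<gamma> (- 1 * t + 1))" by (simp add: reversepath_def)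
  moreover have "integral {0..1} (dens A F (\<lambda>t. \<gamma> (- 1 * t + 1))) = integral {0..1} (dens A F \<gamma>)"
    by (rule dens_integral_affine[OF F paths_D(3)[OF g] paths_D(6)[OF g] paths_D(7)[OF g]])
      (use even in \<open>auto simp: image_iff intro: bexI[of _ "1 - _"]\<close>)
  ultimately show ?thesis by (simp add: dens_integral_def)
qed

lemma paths_const:
  assumes "x \<in> M" shows "(\<lambda>_. x) \<in> paths x x"
proof -
  have "C1_path_on A 0 1 (\<lambda>_. x)"
    unfolding C1_path_on_def by (intro ballI exI[of _ "\<lambda>_. 0"]) (auto simp: o_def)
  then show ?thesis using assms unfolding paths_iff by (auto simp: path_def path_image_def pathstart_def pathfinish_def intro: pw_C1_single)
qed

lemma dens_integral_const:
  assumes F: "density A F" and x: "x \<in> M"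
  shows "dens_integral A F (\<lambda>_. x) = 0"
proof -
  have "dens A F (\<lambda>_. x) t = 0" for t
    using density_zero[OF F chart_at[OF x]] by (simp add: dens_def o_def)
  then have "dens A F (\<lambda>_. x) = (\<lambda>_. 0)" by (rule ext)
  then show ?thesis by (simp add: dens_integral_def)
qed

lemma dens_integral_bound:
  assumes F: "density A F" and G: "density A G" and g: "\<gamma> \<in> paths x y"
    and le: "\<And>x i v. x \<in> M \<Longrightarrow> i \<in> charts A \<Longrightarrow> x \<in> chart_dom A i \<Longrightarrow> \<bar>F i x v\<bar> \<le> C * G i x v"
  shows "\<bar>dens_integral A F \<gamma>\<bar> \<le> C * dens_integral A G \<gamma>"
proof -
  have "norm (integral {0..1} (dens A F \<gamma>)) \<le> integral {0..1} (\<lambda>t. C * dens A G \<gamma> t)"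
  proof (rule integral_norm_bound_integral)
    show "(\<lambda>t. C * dens A G \<gamma> t) integrable_on {0..1}"
      using integrable_cmul[OF paths_dens_integrable[OF G g], of C] by simp
    fix t :: real assume "t \<in> {0..1}"
    then have "\<gamma> t \<in> M" using paths_D(7)[OF g] by auto
    then show "norm (dens A F \<gamma> t) \<le> C * dens A G \<gamma> t" unfolding dens_def using le chart_at by simp
  qed (rule paths_dens_integrable[OF F g])
  then show ?thesis by (simp add: dens_integral_def)
qed

end

section \<open>Path lengths in charts\<close>

text \<open>The library's \<open>subpath\<close> and its homotopy laws for inverse paths need a normed space; in a
  general space they are instances of the following lemma, which rests on the convexity of \<open>{0..1}\<close>.\<close>

lemma homotopic_reparametrizations:
  fixes f g :: "real \<Rightarrow> real"
  assumes "path \<gamma>" "path_image \<gamma> \<subseteq> S"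
    and f: "path f" "path_image f \<subseteq> {0..1}" and g: "path g" "path_image g \<subseteq> {0..1}"
    and ends: "pathstart g = pathstart f" "pathfinish g = pathfinish f"
  shows "homotopic_paths S (\<gamma> \<circ> f) (\<gamma> \<circ> g)"
proof (rule homotopic_paths_continuous_image)
  show "homotopic_paths {0..1} f g"
  proof (rule homotopic_paths_linear)
    fix t :: real assume t: "t \<in> {0..1}"
    have "f t \<in> {0..1}" "g t \<in> {0..1}" using f(2) g(2) t unfolding path_image_def by blast+
    then show "closed_segment (f t) (g t) \<subseteq> {0..1}" by (rule closed_segment_subset) (rule convex_real_interval)
  qed (use f g ends in auto)
  show "continuous_on {0..1} \<gamma>" "\<gamma> \<in> {0..1} \<rightarrow> S" using assms(1,2) by (auto simp: path_def path_image_def)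
qed

context smooth_mfd
begin

lemma path_continuous_within:
  assumes "\<gamma> \<in> paths x y" "t \<in> {0<..<1}"
  shows "continuous (at t within {0<..<1}) \<gamma>" "at t within {0<..<1} = at t" "\<gamma> ` {0<..<1} \<subseteq> M"
proof -
  have "continuous_on {0<..<1} \<gamma>" by (rule continuous_on_subset[OF paths_D(6)[OF assms(1)]]) auto
  then show "continuous (at t within {0<..<1}) \<gamma>" using assms(2) by (simp add: continuous_on_eq_continuous_within)
  show "at t within {0<..<1} = at t" by (rule at_within_open[OF assms(2) open_greaterThanLessThan])
  show "\<gamma> ` {0<..<1} \<subseteq> M" using paths_D(7)[OF assms(1)] by auto
qed

text \<open>The fundamental theorem of calculus for \<open>h \<circ> \<gamma>\<close>, which
  tolerates finitely many exceptional points as \<open>h \<circ> \<gamma>\<close> is continuous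
  across them. On loops it makes the periods of exact forms vanish.\<close>

lemma dens_integral_exact:
  assumes h: "\<And>i. i \<in> charts A \<Longrightarrow> smooth_on (chart_image A i) (h \<circ> chart_inv A i)"
    and \<omega>: "\<And>i x. i \<in> charts A \<Longrightarrow> x \<in> chart_dom A i \<Longrightarrow> \<omega> i x = frechet_derivative (h \<circ> chart_inv A i) (at (chart_map A i x))"
    and g: "\<gamma> \<in> paths x y"
  shows "dens_integral A \<omega> \<gamma> = h y - h x"
proof -
  have dh: "((h \<circ> chart_inv A i) has_derivative \<omega> i z) (at (chart_map A i z))" if i: "i \<in> charts A" "z \<in> chart_dom A i" for i z
  proof -
    have "Ck_on (Suc 0) (chart_image A i) (h \<circ> chart_inv A i)" using h[OF i(1)] unfolding smooth_on_def by blast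
    then have "(h \<circ> chart_inv A i) differentiable (at (chart_map A i z))" using map_in_image[OF i(2)] by simp
    then show ?thesis using \<omega>[OF i] by (simp add: frechet_derivative_works)
  qed
  have "continuous_on M h"
  proof (rule continuous_on_openin_local)
    fix z assume "z \<in> M"
    then have i: "chart_at A z \<in> charts A" "z \<in> chart_dom A (chart_at A z)" by (rule chart_at)+
    let ?i = "chart_at A z"
    have "Ck_on 0 (chart_image A ?i) (h \<circ> chart_inv A ?i)" using h[OF i(1)] unfolding smooth_on_def by blast
    then have "continuous_on (chart_image A ?i) (h \<circ> chart_inv A ?i)" by simp
    then have "continuous_on (chart_dom A ?i) (\<lambda>z. (h \<circ> chart_inv A ?i) (chart_map A ?i z))"
      by (rule continuous_on_compose2[OF _ continuous_map[OF i(1)]]) (auto simp: map_in_image)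
    then have "continuous_on (chart_dom A ?i) h" by (rule continuous_on_eq) (use i(1) in simp)
    then show "\<exists>N. openin (top_of_set M) N \<and> z \<in> N \<and> continuous_on N h" using open_dom[OF i(1)] i(2) by blast
  qed
  then have hc: "continuous_on {0..1} (h \<circ> \<gamma>)"
    using paths_D(6,7)[OF g] by (intro continuous_on_compose) (auto intro: continuous_on_subset)
  obtain S where S: "finite S" "\<forall>t\<in>{0<..<1} - S. \<forall>i\<in>charts A. \<gamma> t \<in> chart_dom A i \<longrightarrow>
           (\<exists>D. ((chart_map A i \<circ> \<gamma>) has_vector_derivative D) (at t))"
    using pw_C1_differentiable[OF paths_D(3)[OF g]] by blast
  have "(dens A \<omega> \<gamma> has_integral (h \<circ> \<gamma>) 1 - (h \<circ> \<gamma>) 0) {0..1}"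
  proof (rule fundamental_theorem_of_calculus_interior_strong[OF S(1) _ _ hc])
    fix t :: real assume t: "t \<in> {0<..<1} - S"
    then have t01: "t \<in> {0<..<1}" by blast
    then have "\<gamma> t \<in> M" using paths_D(7)[OF g] by auto
    then have i: "chart_at A (\<gamma> t) \<in> charts A" "\<gamma> t \<in> chart_dom A (chart_at A (\<gamma> t))" by (rule chart_at)+
    obtain D where D: "((chart_map A (chart_at A (\<gamma> t)) \<circ> \<gamma>) has_vector_derivative D) (at t)" using S(2) t i by blast
    have "((h \<circ> \<gamma>) has_vector_derivative \<omega> (chart_at A (\<gamma> t)) (\<gamma> t) D) (at t within {0<..<1})"
      using chart_fun_derivative[OF i(1) path_continuous_within(1)[OF g t01] path_continuous_within(3)[OF g t01] t01 i(2) dh[OF i]]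
        D path_continuous_within(2)[OF g t01] by simp
    then show "((h \<circ> \<gamma>) has_vector_derivative dens A \<omega> \<gamma> t) (at t)"
      using D path_continuous_within(2)[OF g t01] by (simp add: dens_def vector_derivative_at)
  qed simp
  then show ?thesis using paths_D(8,9)[OF g] by (simp add: dens_integral_def integral_unique)
qed

text \<open>Pairing with the displacement \<open>w\<close> itself reduces the fundamental theorem to
  a real function; Cauchy-Schwarz and the lower bound for the metric norm then give
  \<open>w \<bullet> w\<close> at most \<open>norm w / c\<close> times the length. Only the part of
  \<gamma> up to \<open>t\<close> has to stay in the chart.\<close>

lemma chart_displacement_bound:
  assumes gm: "riemannian_metric A gm" and i: "i \<in> charts A" and g: "\<gamma> \<in> paths x y"
    and c: "c > 0" "\<And>z v. z \<in> W \<Longrightarrow> c * norm v \<le> metric_norm gm i (chart_inv A i z) v"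
    and t: "0 \<le> t" "t \<le> 1" and inW: "\<And>s. s \<in> {0..t} \<Longrightarrow> \<gamma> s \<in> chart_dom A i \<and> chart_map A i (\<gamma> s) \<in> W"
  shows "c * norm (chart_map A i (\<gamma> t) - chart_map A i x) \<le> dens_integral A (metric_norm gm) \<gamma>"
proof -
  let ?f = "chart_map A i \<circ> \<gamma>" and ?F = "metric_norm gm"
  have F: "density A ?F" using density_metric_norm[OF gm] .
  define w where "w = ?f t - chart_map A i x"
  obtain S where S: "finite S" "\<forall>t\<in>{0<..<1} - S. \<forall>i\<in>charts A. \<gamma> t \<in> chart_dom A i \<longrightarrow>
           (\<exists>D. ((chart_map A i \<circ> \<gamma>) has_vector_derivative D) (at t))"
    using pw_C1_differentiable[OF paths_D(3)[OF g]] by blast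
  have dF: "dens A ?F \<gamma> s \<ge> 0" if "s \<in> {0..1}" for s
  proof -
    have "\<gamma> s \<in> M" using paths_D(7)[OF g] that by blast
    then show ?thesis unfolding dens_def using metric_norm_nonneg[OF gm] chart_at by blast
  qed
  have fc: "continuous_on {0..t} ?f"
  proof (rule continuous_on_compose)
    show "continuous_on {0..t} \<gamma>" by (rule continuous_on_subset[OF paths_D(6)[OF g]]) (use t in auto)
    show "continuous_on (\<gamma> ` {0..t}) (chart_map A i)" 
      by (rule continuous_on_subset[OF continuous_map[OF i]]) (use inW in auto)
  qed
  let ?B = "S \<union> {0, t}"
  \<comment> \<open>At the finitely many bad points the derivative is replaced by 0, so that the
    pointwise comparison with the nonnegative integrand holds there too.\<close>
  define f' where "f' s = (if s \<in> ?B then 0 else vector_derivative ?f (at s) \<bullet> w)" for s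
  have D: "(?f has_vector_derivative vector_derivative ?f (at s)) (at s)" if s: "s \<in> {0<..<t} - S" for s
  proof -
    have "s \<in> {0<..<1} - S" "\<gamma> s \<in> chart_dom A i" using s t inW[of s] by auto
    then obtain D where "(?f has_vector_derivative D) (at s)" using S(2) i by blast
    then show ?thesis by (simp add: vector_derivative_at)
  qed
  have "((\<lambda>s. if s \<in> ?B then 0 else vector_derivative ?f (at s) \<bullet> w) has_integral ?f t \<bullet> w - ?f 0 \<bullet> w) {0..t}"
  proof (rule fundamental_theorem_of_calculus_interior_strong[of ?B])
    fix s assume s: "s \<in> {0<..<t} - ?B"
    have "((\<lambda>s. ?f s \<bullet> w) has_vector_derivative (vector_derivative ?f (at s) \<bullet> w)) (at s)"
      using has_derivative_inner_left[OF D[unfolded has_vector_derivative_def], of s w] s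
      by (simp add: has_vector_derivative_def)
    then show "((\<lambda>s. ?f s \<bullet> w) has_vector_derivative (if s \<in> ?B then 0 else vector_derivative ?f (at s) \<bullet> w)) (at s)" using s by auto
  qed (use S(1) t fc in \<open>auto simp: o_def intro!: continuous_intros\<close>)
  then have 1: "(f' has_integral ?f t \<bullet> w - ?f 0 \<bullet> w) {0..t}" unfolding f'_def .
  have int: "dens A ?F \<gamma> integrable_on {0..t}"
    by (rule integrable_on_subinterval[OF paths_dens_integrable[OF F g]]) (use t in auto)
  have 2: "((\<lambda>s. (norm w / c) * dens A ?F \<gamma> s) has_integral (norm w / c) * integral {0..t} (dens A ?F \<gamma>)) {0..t}"
    by (rule has_integral_mult_right[OF integrable_integral[OF int]])
  have le: "f' s \<le> (norm w / c) * dens A ?F \<gamma> s" if s: "s \<in> {0..t}" for s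
  proof (cases "s \<in> ?B")
    case True
    then show ?thesis using dF[of s] s t c(1) by (simp add: f'_def)
  next
    case False
    then have s': "s \<in> {0<..<t} - S" "s \<in> {0<..<1}" using s t by auto
    let ?D = "vector_derivative ?f (at s)"
    have "dens A ?F \<gamma> s = ?F i (\<gamma> s) ?D"
      by (rule dens_eq[OF F paths_D(6,7)[OF g] s'(2) i _ D[OF s'(1)]]) (use inW[OF s] in blast)
    moreover have "c * norm ?D \<le> ?F i (\<gamma> s) ?D" using c(2)[of "chart_map A i (\<gamma> s)" ?D] inW[OF s] i by simp
    ultimately have "c * norm ?D \<le> dens A ?F \<gamma> s" by simp
    then have "norm ?D \<le> dens A ?F \<gamma> s / c" using c(1) by (simp add: field_simps)
    then have "norm ?D * norm w \<le> dens A ?F \<gamma> s / c * norm w" by (rule mult_right_mono) simp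
    moreover have "f' s \<le> norm ?D * norm w" using False norm_cauchy_schwarz[of ?D w] by (simp add: f'_def)
    ultimately show ?thesis by (simp add: mult.commute)
  qed
  have "?f t \<bullet> w - ?f 0 \<bullet> w \<le> (norm w / c) * integral {0..t} (dens A ?F \<gamma>)"
    by (rule has_integral_le[OF 1 2 le])
  also have "\<dots> \<le> (norm w / c) * dens_integral A ?F \<gamma>"
  proof (rule mult_left_mono)
    show "integral {0..t} (dens A ?F \<gamma>) \<le> dens_integral A ?F \<gamma>"
      unfolding dens_integral_def
      by (rule integral_subset_le[OF _ int paths_dens_integrable[OF F g]]) (use t dF in auto)
  qed (use c(1) in simp)
  finally have "w \<bullet> w \<le> (norm w / c) * dens_integral A ?F \<gamma>"
    using paths_D(8)[OF g] by (simp add: w_def inner_diff_left)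
  then have "norm w * (c * norm w) \<le> norm w * dens_integral A ?F \<gamma>"
    using c(1) by (simp add: dot_square_norm power2_eq_square field_simps)
  moreover have "0 \<le> dens_integral A ?F \<gamma>" unfolding dens_integral_def
    by (rule integral_nonneg[OF paths_dens_integrable[OF F g] dF])
  ultimately have "c * norm w \<le> dens_integral A ?F \<gamma>"
    by (cases "w = 0") auto
  then show ?thesis by (simp add: w_def)
qed

lemma metric_dens_integral_nonneg:
  assumes gm: "riemannian_metric A gm" and g: "\<gamma> \<in> paths x y"
  shows "0 \<le> dens_integral A (metric_norm gm) \<gamma>"
  unfolding dens_integral_def
proof (rule integral_nonneg[OF paths_dens_integrable[OF density_metric_norm[OF gm] g]])
  fix s :: real assume "s \<in> {0..1}"
  then have "\<gamma> s \<in> M" using paths_D(7)[OF g] by blast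
  then show "0 \<le> dens A (metric_norm gm) \<gamma> s" unfolding dens_def using metric_norm_nonneg[OF gm] chart_at by blast
qed

text \<open>Before a first exit time from the open set \<open>U\<close> the displacement is at most
  \<open>?L / c\<close>, strictly less than \<open>r\<close>. Hence the path has been in the compact
  set \<open>K\<close> inside \<open>U\<close>; as the space is Hausdorff, \<open>K\<close> is
  closed and still contains the point at the exit time.\<close>

lemma short_path_stays_in_chart:
  assumes gm: "riemannian_metric A gm" and i: "i \<in> charts A" "x \<in> chart_dom A i" and g: "\<gamma> \<in> paths x y"
    and W: "cball (chart_map A i x) r \<subseteq> chart_image A i"
    and c: "c > 0" "\<And>z v. z \<in> cball (chart_map A i x) r \<Longrightarrow> c * norm v \<le> metric_norm gm i (chart_inv A i z) v"
    and L: "dens_integral A (metric_norm gm) \<gamma> < c * r" and t: "t \<in> {0..1}"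
  shows "\<gamma> t \<in> chart_dom A i \<and> chart_map A i (\<gamma> t) \<in> ball (chart_map A i x) r"
proof (rule ccontr)
  let ?L = "dens_integral A (metric_norm gm) \<gamma>"
  define U where "U = {z \<in> chart_dom A i. chart_map A i z \<in> ball (chart_map A i x) r}"
  define K where "K = chart_inv A i ` cball (chart_map A i x) (?L / c)"
  have rL: "?L / c < r" "0 \<le> ?L / c" using L c(1) metric_dens_integral_nonneg[OF gm g] by (auto simp: field_simps)
  then have sub: "cball (chart_map A i x) (?L / c) \<subseteq> cball (chart_map A i x) r" by auto
  have K: "closed K"
    unfolding K_def
    by (intro compact_imp_closed compact_continuous_image continuous_on_subset[OF continuous_inv[OF i(1)]]) (use sub W in auto)
  have KU: "K \<subseteq> U"
  proof
    fix z assume "z \<in> K"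
    then obtain y where y: "y \<in> cball (chart_map A i x) (?L / c)" "z = chart_inv A i y" unfolding K_def by blast
    then have "y \<in> chart_image A i" using sub W by blast
    then show "z \<in> U" using y rL(1) i(1) inv_in_dom[OF i(1)] unfolding U_def by auto
  qed
  assume "\<not> (\<gamma> t \<in> chart_dom A i \<and> chart_map A i (\<gamma> t) \<in> ball (chart_map A i x) r)"
  then have t': "\<gamma> t \<notin> U" unfolding U_def by blast
  have oU: "openin (top_of_set M) U" unfolding U_def by (rule chart_ball_open[OF i(1)])
  define T where "T = {s \<in> {0..1}. \<gamma> s \<notin> U}"
  have "openin (top_of_set {0..1}) ({0..1} \<inter> \<gamma> -` U)"
    by (rule continuous_openin_preimage[OF paths_D(6)[OF g] _ oU]) (use paths_D(7)[OF g] in auto)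
  then have "closedin (top_of_set {0..1}) ({0..1} - ({0..1} \<inter> \<gamma> -` U))" by (simp add: closedin_diff)
  moreover have "{0..1} - ({0..1} \<inter> \<gamma> -` U) = T" unfolding T_def by auto
  ultimately have "closedin (top_of_set {0..1}) T" by simp
  then have "compact T" by (rule closedin_compact[OF compact_Icc])
  moreover have "T \<noteq> {}" using t t' unfolding T_def by blast
  ultimately obtain t0 where t0: "t0 \<in> T" "\<And>s. s \<in> T \<Longrightarrow> t0 \<le> s" using compact_attains_inf by metis
  have "\<gamma> 0 \<in> U" using paths_D(8)[OF g] i(2) rL unfolding U_def by simp
  then have "t0 \<noteq> 0" using t0(1) unfolding T_def by auto
  then have t01: "0 < t0" "t0 \<le> 1" using t0(1) unfolding T_def by auto
  have inK: "\<gamma> s \<in> K" if s: "s \<in> {0..<t0}" for s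
  proof -
    have qin: "\<gamma> q \<in> U" if "q \<in> {0..s}" for q using t0(2)[of q] that s t01 unfolding T_def by force
    have qU: "\<gamma> q \<in> chart_dom A i \<and> chart_map A i (\<gamma> q) \<in> cball (chart_map A i x) r" if "q \<in> {0..s}" for q
      using qin[OF that] unfolding U_def by auto
    have "c * norm (chart_map A i (\<gamma> s) - chart_map A i x) \<le> ?L"
      by (rule chart_displacement_bound[OF gm i(1) g c _ _ qU]) (use s t01 in auto)
    then have "chart_map A i (\<gamma> s) \<in> cball (chart_map A i x) (?L / c)"
      using c(1) by (simp add: dist_norm norm_minus_commute field_simps)
    moreover have "\<gamma> s \<in> chart_dom A i" using qin[of s] s unfolding U_def by auto
    ultimately show ?thesis unfolding K_def using inv_map[OF i(1)] by (metis imageI)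
  qed
  have "closed ({0..1} \<inter> \<gamma> -` K)" by (rule continuous_closed_preimage[OF paths_D(6)[OF g] closed_atLeastAtMost K])
  moreover have "{0..<t0} \<subseteq> {0..1} \<inter> \<gamma> -` K" using inK t01 by auto
  ultimately have "closure {0..<t0} \<subseteq> {0..1} \<inter> \<gamma> -` K" by (rule closure_minimal[rotated])
  then have "\<gamma> t0 \<in> K" using t01 by (simp add: closure_atLeastLessThan subset_iff)
  then show False using t0(1) KU unfolding T_def by blast
qed

section \<open>Coordinate segments and smoothing of continuous paths\<close>

definition chart_segment :: "'i \<Rightarrow> 'e \<Rightarrow> 'e \<Rightarrow> real \<Rightarrow> 'a" where
  "chart_segment i y z t = chart_inv A i (linepath y z t)"

lemma chart_segment_paths:
  assumes i: "i \<in> charts A" and sub: "closed_segment y z \<subseteq> chart_image A i"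
  shows "chart_segment i y z \<in> paths (chart_inv A i y) (chart_inv A i z)"
proof -
  let ?\<gamma> = "chart_segment i y z"
  have l: "linepath y z t \<in> chart_image A i" if "t \<in> {0..1}" for t using linepath_in_path[OF that] sub by blast
  have dom: "?\<gamma> t \<in> chart_dom A i" if "t \<in> {0..1}" for t
    unfolding chart_segment_def by (rule inv_in_dom[OF i l[OF that]])
  have c: "continuous_on {0..1} ?\<gamma>"
    unfolding chart_segment_def
    by (rule continuous_on_compose2[OF continuous_inv[OF i]]) (use l in \<open>auto intro: continuous_on_linepath\<close>)
  have M: "?\<gamma> ` {0..1} \<subseteq> M" using dom dom_subset[OF i] by blast
  have "C1_path_on A 0 1 ?\<gamma>"
    unfolding C1_path_on_def
  proof
    fix j assume j: "j \<in> charts A"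
    show "\<exists>D. (\<forall>t\<in>{0..1}. ?\<gamma> t \<in> chart_dom A j \<longrightarrow> ((chart_map A j \<circ> ?\<gamma>) has_vector_derivative D t) (at t within {0..1})) \<and>
        continuous_on {t\<in>{0..1}. ?\<gamma> t \<in> chart_dom A j} D"
    proof (intro exI[of _ "\<lambda>t. coord_change A i j (?\<gamma> t) (z - y)"] conjI ballI impI)
      fix t :: real assume t: "t \<in> {0..1}" "?\<gamma> t \<in> chart_dom A j"
      have "(linepath y z has_vector_derivative (z - y)) (at t within {0..1})" by (rule has_vector_derivative_linepath_within)
      then have d: "((chart_map A i \<circ> ?\<gamma>) has_vector_derivative (z - y)) (at t within {0..1})"
        by (rule has_vector_derivative_transform[OF t(1), rotated]) (simp add: chart_segment_def i l)
      have "continuous (at t within {0..1}) ?\<gamma>" using c t(1) by (simp add: continuous_on_eq_continuous_within)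
      then show "((chart_map A j \<circ> ?\<gamma>) has_vector_derivative coord_change A i j (?\<gamma> t) (z - y)) (at t within {0..1})"
        by (rule chart_change[OF i j _ M t(1) dom[OF t(1)] t(2) d])
    next
      let ?N = "{t\<in>{0..1}. ?\<gamma> t \<in> chart_dom A j}"
      \<comment> \<open>Membership in \<open>Ck_on (Suc 0)\<close> gives continuity of the
        derivative of the transition map in each fixed direction, here \<open>z - y\<close>; this is
        the continuity that \<open>C1_path_on\<close> demands.\<close>
      have "Ck_on (Suc 0) (chart_map A i ` (chart_dom A i \<inter> chart_dom A j)) (chart_map A j \<circ> chart_inv A i)"
        using transition_smooth[OF i j] unfolding smooth_on_def by blast
      then have "continuous_on (chart_map A i ` (chart_dom A i \<inter> chart_dom A j)) 
          (\<lambda>x. frechet_derivative (chart_map A j \<circ> chart_inv A i) (at x) (z - y))" by simp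
      then have "continuous_on ?N (\<lambda>t. frechet_derivative (chart_map A j \<circ> chart_inv A i) (at (linepath y z t)) (z - y))"
      proof (rule continuous_on_compose2)
        show "continuous_on ?N (linepath y z)" by (rule continuous_on_linepath)
        show "linepath y z ` ?N \<subseteq> chart_map A i ` (chart_dom A i \<inter> chart_dom A j)"
        proof
          fix w assume "w \<in> linepath y z ` ?N"
          then obtain t where t: "t \<in> {0..1}" "?\<gamma> t \<in> chart_dom A j" "w = linepath y z t" by blast
          then have "w = chart_map A i (?\<gamma> t)" using l i by (simp add: chart_segment_def)
          then show "w \<in> chart_map A i ` (chart_dom A i \<inter> chart_dom A j)" using t dom by blast
        qed
      qed
      then show "continuous_on ?N (\<lambda>t. coord_change A i j (?\<gamma> t) (z - y))"
        by (rule continuous_on_eq) (simp add: coord_change_def chart_segment_def i l)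
    qed
  qed
  then have "pw_C1 A ?\<gamma> 0 1" by (intro pw_C1_single) auto
  then show ?thesis
    using c M unfolding paths_iff by (simp add: path_def path_image_def pathstart_def pathfinish_def)
       (simp add: chart_segment_def linepath_def)
qed

lemma chart_segment_dens_integral:
  assumes F: "density A F" and i: "i \<in> charts A" and sub: "closed_segment y z \<subseteq> chart_image A i"
    and C: "0 \<le> C" "\<And>w v. w \<in> closed_segment y z \<Longrightarrow> \<bar>F i (chart_inv A i w) v\<bar> \<le> C * norm v"
  shows "\<bar>dens_integral A F (chart_segment i y z)\<bar> \<le> C * norm (z - y)"
proof -
  let ?\<gamma> = "chart_segment i y z"
  note g = chart_segment_paths[OF i sub]
  have "(dens A F ?\<gamma> has_integral dens_integral A F ?\<gamma>) (cbox 0 1)"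
    unfolding dens_integral_def using paths_dens_integrable[OF F g] by (simp add: integrable_integral cbox_interval)
  then have "norm (dens_integral A F ?\<gamma>) \<le> C * norm (z - y) * Henstock_Kurzweil_Integration.content (cbox 0 (1::real))"
  proof (rule has_integral_bound_spike_finite[of _ "{0, 1}", rotated 2])
    fix t assume "t \<in> cbox 0 1 - {0, 1 :: real}"
    then have t: "t \<in> {0<..<1}" "t \<in> {0..1}" by auto
    have l: "linepath y z s \<in> chart_image A i" if "s \<in> {0..1}" for s using linepath_in_path[OF that] sub by blast
    have "(linepath y z has_vector_derivative (z - y)) (at t within {0<..<1})" by (rule has_vector_derivative_linepath_within)
    then have "((chart_map A i \<circ> ?\<gamma>) has_vector_derivative (z - y)) (at t within {0<..<1})"
      by (rule has_vector_derivative_transform[OF t(1), rotated]) (simp add: chart_segment_def i l)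
    then have d: "((chart_map A i \<circ> ?\<gamma>) has_vector_derivative (z - y)) (at t)"
      using at_within_open[OF t(1) open_greaterThanLessThan] by simp
    have "dens A F ?\<gamma> t = F i (?\<gamma> t) (z - y)"
      by (rule dens_eq[OF F paths_D(6,7)[OF g] t(1) i _ d]) (simp add: chart_segment_def inv_in_dom[OF i l[OF t(2)]])
    then show "norm (dens A F ?\<gamma> t) \<le> C * norm (z - y)" 
      using C(2)[OF linepath_in_path[OF t(2)]] by (simp add: chart_segment_def)
  qed (use C(1) in auto)
  then show ?thesis by simp
qed

text \<open>The straight-line homotopy in the convex set \<open>W\<close> of coordinates,
  transported by the inverse chart.\<close>

lemma homotopic_chart_segment:
  assumes i: "i \<in> charts A" and r: "path \<rho>" "path_image \<rho> \<subseteq> {x \<in> chart_dom A i. chart_map A i x \<in> W}"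
    and W: "convex W" "W \<subseteq> chart_image A i"
  shows "homotopic_paths M \<rho> (chart_segment i (chart_map A i (pathstart \<rho>)) (chart_map A i (pathfinish \<rho>)))"
proof -
  let ?h = "chart_map A i \<circ> \<rho>" and ?l = "linepath (chart_map A i (pathstart \<rho>)) (chart_map A i (pathfinish \<rho>))"
  have h: "path ?h" using r by (intro path_continuous_image continuous_on_subset[OF continuous_map[OF i]]) auto
  have hW: "?h t \<in> W" "\<rho> t \<in> chart_dom A i" if "t \<in> {0..1}" for t
  proof -
    have "\<rho> t \<in> path_image \<rho>" using that by (simp add: path_image_def)
    then show "?h t \<in> W" "\<rho> t \<in> chart_dom A i" using r(2) by auto
  qed
  have ends: "chart_map A i (pathstart \<rho>) \<in> W" "chart_map A i (pathfinish \<rho>) \<in> W"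
    using hW(1)[of 0] hW(1)[of 1] by (auto simp: pathstart_def pathfinish_def)
  have "homotopic_paths W ?h ?l"
  proof (rule homotopic_paths_linear)
    fix t :: real assume t: "t \<in> {0..1}"
    have "?l t \<in> W" using linepath_in_path[OF t] closed_segment_subset[OF ends W(1)] by blast
    then show "closed_segment (?h t) (?l t) \<subseteq> W" by (rule closed_segment_subset[OF hW(1)[OF t] _ W(1)])
  qed (use h in \<open>simp_all add: pathstart_compose pathfinish_compose\<close>)
  then have "homotopic_paths M (chart_inv A i \<circ> ?h) (chart_inv A i \<circ> ?l)"
    by (rule homotopic_paths_continuous_image[OF _ continuous_on_subset[OF continuous_inv[OF i] W(2)]])
      (use inv_in_dom[OF i] W(2) dom_subset[OF i] in blast)
  moreover have "homotopic_paths M \<rho> (chart_inv A i \<circ> ?h)"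
    by (rule homotopic_paths_eq) (use r(1) hW(2) i dom_subset[OF i] in \<open>auto simp: path_image_def\<close>)
  moreover have "chart_inv A i \<circ> ?l = chart_segment i (chart_map A i (pathstart \<rho>)) (chart_map A i (pathfinish \<rho>))"
    by (auto simp: chart_segment_def)
  ultimately show ?thesis using homotopic_paths_trans by metis
qed

text \<open>Each piece of a fine subdivision lies in a convex coordinate set and can be replaced by
  a coordinate segment. This connects homotopy classes and covers with lengths and
  integrals.\<close>

lemma homotopic_C1_path:
  assumes g: "path \<gamma>" "path_image \<gamma> \<subseteq> M"
  shows "\<exists>\<delta>. \<delta> \<in> paths (pathstart \<gamma>) (pathfinish \<gamma>) \<and> homotopic_paths M \<gamma> \<delta>"
proof -
  let ?Q = "\<lambda>U. \<exists>i W. i \<in> charts A \<and> convex W \<and> W \<subseteq> chart_image A i \<and> U = {x \<in> chart_dom A i. chart_map A i x \<in> W}"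
  have cov: "\<exists>U. openin (top_of_set M) U \<and> x \<in> U \<and> ?Q U" if "x \<in> M" for x
  proof -
    obtain i r where i: "i \<in> charts A" "x \<in> chart_dom A i" "r > 0" "cball (chart_map A i x) r \<subseteq> chart_image A i"
      using chart_ball[OF \<open>x \<in> M\<close>] by blast
    let ?U = "{z \<in> chart_dom A i. chart_map A i z \<in> ball (chart_map A i x) r}"
    have "openin (top_of_set M) ?U" "x \<in> ?U" using chart_ball_open[OF i(1)] i by auto
    moreover have "ball (chart_map A i x) r \<subseteq> chart_image A i" using i(4) ball_subset_cball by blast
    then have "?Q ?U" using i(1) convex_ball by blast
    ultimately show ?thesis by blast
  qed
  obtain n :: nat where n: "n > 0" "\<forall>k<n. \<exists>U. ?Q U \<and> \<gamma> ` {real k / n .. real (Suc k) / n} \<subseteq> U"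
    using path_subdivision[OF g, of ?Q] cov by blast
  \<comment> \<open>An initial part of \<gamma> is written as \<gamma> after an affine path;
    prolonging it by the next piece is a reparametrization of the longer part.\<close>
  have "\<exists>\<delta>. \<delta> \<in> paths (\<gamma> 0) (\<gamma> (real k / n)) \<and> homotopic_paths M (\<gamma> \<circ> linepath 0 (real k / n)) \<delta>" if "k \<le> n" for k
    using that
  proof (induction k)
    case 0
    have "\<gamma> 0 \<in> M" using g(2) unfolding path_image_def by auto
    from paths_const[OF this] paths_D(1,2)[OF paths_const[OF this]]
    have "(\<lambda>_. \<gamma> 0) \<in> paths (\<gamma> 0) (\<gamma> 0)" "homotopic_paths M (\<lambda>_. \<gamma> 0) (\<lambda>_. \<gamma> 0)" by auto
    moreover have "\<gamma> \<circ> linepath 0 (real 0 / n) = (\<lambda>_. \<gamma> 0)" by (simp add: o_def linepath_def)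
    ultimately show ?case by (intro exI[of _ "\<lambda>_. \<gamma> 0"]) simp
  next
    case (Suc k)
    define s where "s = real k / n"
    define t where "t = real (Suc k) / n"
    have st: "0 \<le> s" "s \<le> t" "t \<le> 1" using Suc.prems n(1) by (auto simp: s_def t_def field_simps)
    obtain \<delta> where \<delta>: "\<delta> \<in> paths (\<gamma> 0) (\<gamma> s)" "homotopic_paths M ((\<gamma> \<circ> linepath 0 s)) \<delta>"
      using Suc.IH Suc.prems unfolding s_def by (metis Suc_leD)
    obtain i W where W: "i \<in> charts A" "convex W" "W \<subseteq> chart_image A i" "\<gamma> ` {s..t} \<subseteq> {x \<in> chart_dom A i. chart_map A i x \<in> W}"
      using n(2)[rule_format, of k] Suc.prems unfolding s_def t_def by auto
    let ?\<rho> = "\<gamma> \<circ> linepath s t"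
    have r: "path ?\<rho>" "path_image ?\<rho> \<subseteq> {x \<in> chart_dom A i. chart_map A i x \<in> W}"
    proof -
      have lst: "linepath s t ` {0..1} \<subseteq> {s..t}" 
        using st(2) by (metis closed_segment_eq_real_ivl1 linepath_image_01 order_refl)
      have "{s..t} \<subseteq> {0..1}" using st by auto
      then have "continuous_on {s..t} \<gamma>" using g(1) unfolding path_def by (rule continuous_on_subset[rotated])
      then have "continuous_on (linepath s t ` {0..1}) \<gamma>" by (rule continuous_on_subset[OF _ lst])
      then show "path ?\<rho>" unfolding path_def by (rule continuous_on_compose[OF continuous_on_linepath])
      show "path_image ?\<rho> \<subseteq> {x \<in> chart_dom A i. chart_map A i x \<in> W}"
        using W(4) lst unfolding path_image_def by auto
    qed
    have ends: "pathstart ?\<rho> = \<gamma> s" "pathfinish ?\<rho> = \<gamma> t" by (simp_all add: pathstart_def pathfinish_def linepath_def)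
    let ?\<sigma> = "chart_segment i (chart_map A i (\<gamma> s)) (chart_map A i (\<gamma> t))"
    have h: "homotopic_paths M ?\<rho> ?\<sigma>" using homotopic_chart_segment[OF W(1) r W(2,3)] ends by simp
    have "s \<in> {s..t}" "t \<in> {s..t}" using st by auto
    then have st_in: "\<gamma> s \<in> {x \<in> chart_dom A i. chart_map A i x \<in> W}" "\<gamma> t \<in> {x \<in> chart_dom A i. chart_map A i x \<in> W}"
      using W(4) by blast+
    then have seg: "closed_segment (chart_map A i (\<gamma> s)) (chart_map A i (\<gamma> t)) \<subseteq> chart_image A i"
      using closed_segment_subset[OF _ _ W(2)] W(3) by blast
    have P: "?\<sigma> \<in> paths (\<gamma> s) (\<gamma> t)" using chart_segment_paths[OF W(1) seg] st_in W(1) by simp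
    have "homotopic_paths M ((\<gamma> \<circ> linepath 0 s) +++ ?\<rho>) (\<delta> +++ ?\<sigma>)"
      by (rule homotopic_paths_join[OF \<delta>(2) h]) (simp add: pathstart_def pathfinish_def linepath_def)
    moreover have "homotopic_paths M (\<gamma> \<circ> (linepath 0 s +++ linepath s t)) (\<gamma> \<circ> linepath 0 t)"
      by (rule homotopic_reparametrizations[OF g]) (use st in \<open>auto simp: path_image_join closed_segment_eq_real_ivl\<close>)
    ultimately have "homotopic_paths M (\<gamma> \<circ> linepath 0 t) (\<delta> +++ ?\<sigma>)"
      unfolding path_compose_join by (blast intro: homotopic_paths_sym homotopic_paths_trans)
    then show ?case using paths_join[OF \<delta>(1) P] unfolding t_def by blast
  qed
  from this[of n] n(1) obtain \<delta> where \<delta>: "\<delta> \<in> paths (\<gamma> 0) (\<gamma> 1)" "homotopic_paths M (\<gamma> \<circ> linepath 0 1) \<delta>" by auto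
  moreover have "\<gamma> \<circ> linepath 0 1 = \<gamma>" by (simp add: fun_eq_iff linepath_def)
  ultimately show ?thesis by (auto simp: pathstart_def pathfinish_def)
qed

lemma paths_nonempty:
  assumes "path_connected M" "x \<in> M" "y \<in> M" shows "\<exists>\<gamma>. \<gamma> \<in> paths x y"
proof -
  obtain g where "path g" "path_image g \<subseteq> M" "pathstart g = x" "pathfinish g = y"
    using assms unfolding path_connected_def by blast
  then show ?thesis using homotopic_C1_path by blast
qed

text \<open>Near \<open>x\<close>, a coordinate segment to \<open>x\<close> followed by one fixed
  path connects to \<open>p\<close> with a bound independent of the starting point. For the metric
  norm, \<open>D\<close> is the distance within which every point of a cover reaches the fibre over
  \<open>p\<close>.\<close>

lemma paths_uniformly_bounded:
  assumes M: "compact M" "path_connected M" and p: "p \<in> M" and F: "density A F"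
  shows "\<exists>D>0. \<forall>x\<in>M. \<exists>\<gamma>. \<gamma> \<in> paths x p \<and> dens_integral A F \<gamma> \<le> D"
proof (rule compact_local_bound[OF M(1)])
  fix x assume x: "x \<in> M"
  obtain i r where i: "i \<in> charts A" "x \<in> chart_dom A i" "r > 0" "cball (chart_map A i x) r \<subseteq> chart_image A i"
    using chart_ball[OF x] by blast
  let ?K = "cball (chart_map A i x) r" and ?U = "{z \<in> chart_dom A i. chart_map A i z \<in> ball (chart_map A i x) r}"
  obtain C where C: "C > 0" "\<forall>y\<in>?K. \<forall>v. \<bar>F i (chart_inv A i y) v\<bar> \<le> C * norm v"
    using density_local_upper[OF F i(1) compact_cball i(4)] by blast
  obtain \<gamma> where g: "\<gamma> \<in> paths x p" using paths_nonempty[OF M(2) x p] by blast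
  have "\<exists>\<delta>. \<delta> \<in> paths y p \<and> dens_integral A F \<delta> \<le> C * r + dens_integral A F \<gamma>" if y: "y \<in> ?U" for y
  proof -
    let ?\<sigma> = "chart_segment i (chart_map A i y) (chart_map A i x)"
    have seg: "closed_segment (chart_map A i y) (chart_map A i x) \<subseteq> ?K"
      by (rule closed_segment_subset) (use y i(3) in auto)
    then have seg': "closed_segment (chart_map A i y) (chart_map A i x) \<subseteq> chart_image A i" using i(4) by blast
    have s: "?\<sigma> \<in> paths y x" using chart_segment_paths[OF i(1) seg'] i y by simp
    have "\<bar>dens_integral A F ?\<sigma>\<bar> \<le> C * norm (chart_map A i x - chart_map A i y)"
      by (rule chart_segment_dens_integral[OF F i(1) seg']) (use C seg in auto)
    also have "\<dots> \<le> C * r" using y C(1) by (intro mult_left_mono) (auto simp: dist_norm)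
    finally have "dens_integral A F (?\<sigma> +++ \<gamma>) \<le> C * r + dens_integral A F \<gamma>"
      using dens_integral_join[OF F s g] by linarith
    then show ?thesis using paths_join[OF s g] by blast
  qed
  moreover have "openin (top_of_set M) ?U" "x \<in> ?U" using chart_ball_open[OF i(1)] i by auto
  ultimately show "\<exists>U c. openin (top_of_set M) U \<and> x \<in> U \<and> (\<forall>y\<in>U. \<exists>\<gamma>. \<gamma> \<in> paths y p \<and> dens_integral A F \<gamma> \<le> c)" 
    by blast
qed (use order_trans in blast)

end

section \<open>Lifts to covering spaces\<close>

text \<open>A lift satisfies \<open>p (\<gamma> t) = \<delta> t\<close> only on
  \<open>{0..1}\<close>, whereas paths are functions on all reals; this and
  \<open>paths_cong\<close> bridge the difference.\<close>

lemma dens_integral_cong: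
  assumes "\<And>t. t \<in> {0..1} \<Longrightarrow> \<gamma> t = \<delta> t"
  shows "dens_integral A F \<gamma> = dens_integral A F \<delta>"
  unfolding dens_integral_def
proof (rule integral_spike[of "{0, 1}"])
  fix t :: real assume "t \<in> {0..1} - {0, 1}"
  then show "dens A F \<delta> t = dens A F \<gamma> t" by (intro dens_cong[of 0 1]) (use assms in auto)
qed simp

lemma metric_norm_lift_tensor: "metric_norm (lift_tensor p gm) = lift_tensor p (metric_norm gm)"
  by (auto simp: fun_eq_iff metric_norm_def lift_tensor_def)

lemma path_cong_01:
  assumes "path \<gamma>" "\<And>t. t \<in> {0..1} \<Longrightarrow> \<delta> t = \<gamma> t"
  shows "path \<delta>" "path_image \<delta> = path_image \<gamma>" "pathstart \<delta> = pathstart \<gamma>" "pathfinish \<delta> = pathfinish \<gamma>"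
proof -
  show "path \<delta>" using assms unfolding path_def by (metis continuous_on_cong)
  show "path_image \<delta> = path_image \<gamma>" unfolding path_image_def using assms(2) by (intro image_cong) auto
qed (auto simp: pathstart_def pathfinish_def assms(2))

context smooth_mfd
begin

lemma paths_cong:
  assumes g: "\<gamma> \<in> paths x y" and eq: "\<And>t. t \<in> {0..1} \<Longrightarrow> \<delta> t = \<gamma> t"
  shows "\<delta> \<in> paths x y"
  unfolding paths_iff using path_cong_01[OF paths_D(1)[OF g] eq] paths_D(2,4,5)[OF g] pw_C1_cong[OF paths_D(3)[OF g] eq] by simp

end

section \<open>The smooth structure of a cover\<close>

locale smooth_cover = smooth_mfd A M for A :: "('a::t2_space, 'e::{real_inner,heine_borel}, 'i) atlas" and M +
  fixes X :: "'b::topological_space set" and p :: "'b \<Rightarrow> 'a"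
  assumes cov: "covering_space X p M"
begin

abbreviation L where "L \<equiv> lift_atlas A M p X"
abbreviation lift_paths :: "'b \<Rightarrow> 'b \<Rightarrow> (real \<Rightarrow> 'b) set" where "lift_paths \<equiv> C1_paths_between L X"

lemma p_in: "x \<in> X \<Longrightarrow> p x \<in> M"
  using covering_space_imp_surjective[OF cov] by blast

lemma p_cont: "continuous_on X p"
  by (rule covering_space_imp_continuous[OF cov])

lemma lift_chart_iff:
  "iV \<in> charts L \<longleftrightarrow> fst iV \<in> charts A \<and> openin (top_of_set X) (snd iV) \<and> openin (top_of_set M) (p ` snd iV) \<and>
     p ` snd iV \<subseteq> chart_dom A (fst iV) \<and> (\<exists>q. homeomorphism (snd iV) (p ` snd iV) p q)"
  by (cases iV) (simp add: lift_atlas_def)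

lemma lift_chart_dom [simp]: "chart_dom L iV = snd iV"
  by (simp add: lift_atlas_def split_beta)

lemma lift_chart_map [simp]: "chart_map L iV = chart_map A (fst iV) \<circ> p"
  by (simp add: lift_atlas_def split_beta)

text \<open>A sheet over an evenly covered neighbourhood is cut down to the preimage of the chart
  domain.\<close>

lemma lift_chart_ex:
  assumes x: "x \<in> X" and i: "i \<in> charts A" "p x \<in> chart_dom A i"
  shows "\<exists>V. (i, V) \<in> charts L \<and> x \<in> V"
proof -
  obtain T where T: "openin (top_of_set M) T" "p x \<in> T" "evenly_covered X p T"
    using covering_space_evenly_covered[OF cov p_in[OF x]] by blast
  then obtain V0 q where V0: "x \<in> V0" "sheet X p T V0 q" using x unfolding evenly_covered_def by blast
  have V: "openin (top_of_set X) V0" and h: "homeomorphism V0 T p q" using V0(2) unfolding sheet_def by auto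
  define V where "V = V0 \<inter> (X \<inter> p -` chart_dom A i)"
  have "openin (top_of_set X) (X \<inter> p -` chart_dom A i)"
    by (rule continuous_openin_preimage[OF p_cont _ open_dom[OF i(1)]]) (use p_in in auto)
  then have oV: "openin (top_of_set X) V" unfolding V_def using V by (rule openin_Int[rotated])
  have V0X: "V0 \<subseteq> X" using V openin_imp_subset by blast
  have "p ` V0 = T" using h unfolding homeomorphism_def by blast
  then have pV: "p ` V = T \<inter> chart_dom A i" unfolding V_def using V0X by blast
  then have "openin (top_of_set M) (p ` V)" using openin_Int[OF T(1) open_dom[OF i(1)]] by simp
  moreover have "homeomorphism V (p ` V) p q"
    by (rule homeomorphism_of_subsets[OF h]) (use pV in \<open>auto simp: V_def\<close>)
  moreover have "x \<in> V" using V0(1) x i(2) unfolding V_def by simp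
  moreover have "p ` V \<subseteq> chart_dom A i" using pV by blast
  ultimately have "(i, V) \<in> charts L" unfolding lift_chart_iff fst_conv snd_conv using oV i(1) by blast
  then show ?thesis using \<open>x \<in> V\<close> by blast
qed

text \<open>From \<open>A\<close> to \<open>L\<close> the derivative is merely restricted to the
  lifted chart. Conversely, one chart of \<open>A\<close> may have many lifted charts above it, and
  the derivatives found in them must be glued.\<close>

lemma lift_C1_path_on:
  assumes g: "continuous_on {a..b} \<gamma>" "\<gamma> ` {a..b} \<subseteq> X" and ab: "a < b"
  shows "C1_path_on L a b \<gamma> \<longleftrightarrow> C1_path_on A a b (p \<circ> \<gamma>)"
proof
  assume C: "C1_path_on A a b (p \<circ> \<gamma>)"
  show "C1_path_on L a b \<gamma>"
    unfolding C1_path_on_def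
  proof
    fix iV assume iV: "iV \<in> charts L"
    let ?i = "fst iV" and ?V = "snd iV"
    have i: "?i \<in> charts A" "p ` ?V \<subseteq> chart_dom A ?i" using iV unfolding lift_chart_iff by auto
    obtain D where D: "\<forall>t\<in>{a..b}. (p \<circ> \<gamma>) t \<in> chart_dom A ?i \<longrightarrow> ((chart_map A ?i \<circ> (p \<circ> \<gamma>)) has_vector_derivative D t) (at t within {a..b})"
      "continuous_on {t\<in>{a..b}. (p \<circ> \<gamma>) t \<in> chart_dom A ?i} D" using C i(1) unfolding C1_path_on_def by blast
    show "\<exists>D. (\<forall>t\<in>{a..b}. \<gamma> t \<in> chart_dom L iV \<longrightarrow> ((chart_map L iV \<circ> \<gamma>) has_vector_derivative D t) (at t within {a..b})) \<and>
        continuous_on {t\<in>{a..b}. \<gamma> t \<in> chart_dom L iV} D"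
    proof (intro exI[of _ D] conjI ballI impI)
      show "continuous_on {t\<in>{a..b}. \<gamma> t \<in> chart_dom L iV} D" by (rule continuous_on_subset[OF D(2)]) (use i(2) in auto)
      fix t assume "t \<in> {a..b}" "\<gamma> t \<in> chart_dom L iV"
      then show "((chart_map L iV \<circ> \<gamma>) has_vector_derivative D t) (at t within {a..b})" 
        using D(1) i(2) by (auto simp: o_assoc)
    qed
  qed
next
  assume C: "C1_path_on L a b \<gamma>"
  show "C1_path_on A a b (p \<circ> \<gamma>)"
    unfolding C1_path_on_def
  proof
    fix i assume i: "i \<in> charts A"
    let ?f = "chart_map A i \<circ> (p \<circ> \<gamma>)" and ?N = "{t\<in>{a..b}. (p \<circ> \<gamma>) t \<in> chart_dom A i}"
    have nt: "at t within {a..b} \<noteq> bot" if "t \<in> {a..b}" for t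
      using ab that by (simp add: trivial_limit_within islimpt_Icc)
    \<comment> \<open>A derivative defined without reference to a lifted chart agrees with each
      local one, as derivatives on a nondegenerate interval are unique; that is the use of
      \<open>a < b\<close>.\<close>
    define D where "D t = vector_derivative ?f (at t within {a..b})" for t
    have loc: "\<exists>V. \<gamma> t \<in> V \<and> openin (top_of_set X) V \<and> 
        (\<forall>s\<in>{a..b}. \<gamma> s \<in> V \<longrightarrow> (?f has_vector_derivative D s) (at s within {a..b})) \<and>
        continuous_on {s\<in>{a..b}. \<gamma> s \<in> V} D" if t: "t \<in> ?N" for t
    proof -
      have "\<gamma> t \<in> X" using t g(2) by auto
      then obtain V where V: "(i, V) \<in> charts L" "\<gamma> t \<in> V" using lift_chart_ex[of "\<gamma> t" i] i t by auto
      obtain E where E: "\<forall>t\<in>{a..b}. \<gamma> t \<in> V \<longrightarrow> ((chart_map L (i, V) \<circ> \<gamma>) has_vector_derivative E t) (at t within {a..b})"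
        "continuous_on {t\<in>{a..b}. \<gamma> t \<in> V} E" using C V(1) unfolding C1_path_on_def by fastforce
      have f: "chart_map L (i, V) \<circ> \<gamma> = ?f" by (simp add: o_assoc)
      have DE: "D s = E s" if "s \<in> {a..b}" "\<gamma> s \<in> V" for s
        unfolding D_def by (rule vector_derivative_within[OF nt[OF that(1)]]) (use E(1) that in \<open>unfold f, blast\<close>)
      have "openin (top_of_set X) V" using V(1) unfolding lift_chart_iff by simp
      moreover have "\<forall>s\<in>{a..b}. \<gamma> s \<in> V \<longrightarrow> (?f has_vector_derivative D s) (at s within {a..b})"
        using E(1) DE unfolding f by simp
      moreover have "continuous_on {s\<in>{a..b}. \<gamma> s \<in> V} D" by (rule continuous_on_eq[OF E(2)]) (use DE in auto)
      ultimately show ?thesis using V(2) by blast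
    qed
    show "\<exists>D. (\<forall>t\<in>{a..b}. (p \<circ> \<gamma>) t \<in> chart_dom A i \<longrightarrow> (?f has_vector_derivative D t) (at t within {a..b})) \<and>
        continuous_on ?N D"
    proof (intro exI[of _ D] conjI ballI impI)
      fix t assume "t \<in> {a..b}" "(p \<circ> \<gamma>) t \<in> chart_dom A i"
      then show "(?f has_vector_derivative D t) (at t within {a..b})" using loc[of t] by blast
    next
      show "continuous_on ?N D"
      proof (rule continuous_on_openin_local)
        fix t assume t: "t \<in> ?N"
        obtain V where V: "\<gamma> t \<in> V" "openin (top_of_set X) V" "continuous_on {s\<in>{a..b}. \<gamma> s \<in> V} D" using loc[OF t] by blast
        have "openin (top_of_set {a..b}) ({a..b} \<inter> \<gamma> -` V)"
          by (rule continuous_openin_preimage[OF g(1) _ V(2)]) (use g(2) in auto)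
        then obtain G where G: "open G" "{a..b} \<inter> \<gamma> -` V = {a..b} \<inter> G" unfolding openin_open by blast
        have "openin (top_of_set ?N) (?N \<inter> G)" using G(1) by (simp add: openin_open_Int)
        moreover have "t \<in> {a..b} \<inter> \<gamma> -` V" using t V(1) by blast
        then have "t \<in> ?N \<inter> G" using t unfolding G(2) by blast
        moreover have "continuous_on (?N \<inter> G) D" by (rule continuous_on_subset[OF V(3)]) (use G(2) in blast)
        ultimately show "\<exists>N. openin (top_of_set ?N) N \<and> t \<in> N \<and> continuous_on N D" by blast
      qed
    qed
  qed
qed

lemma lift_pw_C1:
  assumes g: "continuous_on {a..b} \<gamma>" "\<gamma> ` {a..b} \<subseteq> X"
  shows "pw_C1 L \<gamma> a b \<longleftrightarrow> pw_C1 A (p \<circ> \<gamma>) a b"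
proof
  assume "pw_C1 L \<gamma> a b"
  then show "pw_C1 A (p \<circ> \<gamma>) a b" using g
  proof (induction rule: pw_C1.induct)
    case (pw_C1_refl a)
    show ?case by (rule pw_C1.pw_C1_refl)
  next
    case (pw_C1_step a b c)
    have sub: "{a..b} \<subseteq> {a..c}" "{b..c} \<subseteq> {a..c}" using pw_C1_le[OF pw_C1_step.hyps(1)] pw_C1_step.hyps(2) by auto
    note g1 = continuous_on_subset[OF pw_C1_step.prems(1) sub(1)] continuous_on_subset[OF pw_C1_step.prems(1) sub(2)]
    have g2: "\<gamma> ` {a..b} \<subseteq> X" "\<gamma> ` {b..c} \<subseteq> X" using pw_C1_step.prems(2) sub by blast+
    have "C1_path_on A b c (p \<circ> \<gamma>)" using lift_C1_path_on[OF g1(2) g2(2) pw_C1_step.hyps(2)] pw_C1_step.hyps(3) by simp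
    then show ?case by (rule pw_C1.pw_C1_step[OF pw_C1_step.IH[OF g1(1) g2(1)] pw_C1_step.hyps(2)])
  qed
next
  assume "pw_C1 A (p \<circ> \<gamma>) a b"
  then show "pw_C1 L \<gamma> a b" using g
  proof (induction rule: pw_C1.induct)
    case (pw_C1_refl a)
    show ?case by (rule pw_C1.pw_C1_refl)
  next
    case (pw_C1_step a b c)
    have sub: "{a..b} \<subseteq> {a..c}" "{b..c} \<subseteq> {a..c}" using pw_C1_le[OF pw_C1_step.hyps(1)] pw_C1_step.hyps(2) by auto
    note g1 = continuous_on_subset[OF pw_C1_step.prems(1) sub(1)] continuous_on_subset[OF pw_C1_step.prems(1) sub(2)]
    have g2: "\<gamma> ` {a..b} \<subseteq> X" "\<gamma> ` {b..c} \<subseteq> X" using pw_C1_step.prems(2) sub by blast+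
    have "C1_path_on L b c \<gamma>" using lift_C1_path_on[OF g1(2) g2(2) pw_C1_step.hyps(2)] pw_C1_step.hyps(3) by simp
    then show ?case by (rule pw_C1.pw_C1_step[OF pw_C1_step.IH[OF g1(1) g2(1)] pw_C1_step.hyps(2)])
  qed
qed

text \<open>Smoothness of a path in the cover is a condition on its projection alone, so joins,
  reversals and integrability are inherited from \<open>M\<close>.\<close>

lemma lift_paths_iff:
  "\<gamma> \<in> lift_paths x y \<longleftrightarrow> path \<gamma> \<and> path_image \<gamma> \<subseteq> X \<and> pathstart \<gamma> = x \<and> pathfinish \<gamma> = y \<and> p \<circ> \<gamma> \<in> paths (p x) (p y)"
proof (cases "path \<gamma> \<and> path_image \<gamma> \<subseteq> X")
  case True
  then have "pw_C1 L \<gamma> 0 1 \<longleftrightarrow> pw_C1 A (p \<circ> \<gamma>) 0 1" by (intro lift_pw_C1) (auto simp: path_def path_image_def)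
  moreover have "path (p \<circ> \<gamma>)" using True by (intro path_continuous_image continuous_on_subset[OF p_cont]) auto
  moreover have "path_image (p \<circ> \<gamma>) \<subseteq> M" using True p_in by (auto simp: path_image_compose)
  ultimately show ?thesis
    unfolding C1_paths_between_def piecewise_C1_path_iff by (auto simp: pathstart_compose pathfinish_compose)
qed (auto simp: C1_paths_between_def piecewise_C1_path_iff)

lemma lift_paths_D:
  assumes "\<gamma> \<in> lift_paths x y"
  shows "path \<gamma>" "path_image \<gamma> \<subseteq> X" "pathstart \<gamma> = x" "pathfinish \<gamma> = y" "p \<circ> \<gamma> \<in> paths (p x) (p y)"
    "x \<in> X" "y \<in> X"
proof -
  show 1: "path \<gamma>" "path_image \<gamma> \<subseteq> X" "pathstart \<gamma> = x" "pathfinish \<gamma> = y" "p \<circ> \<gamma> \<in> paths (p x) (p y)"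
    using assms unfolding lift_paths_iff by auto
  show "x \<in> X" "y \<in> X" using 1 pathstart_in_path_image pathfinish_in_path_image by blast+
qed

lemma lift_dens_integral:
  assumes g: "\<gamma> \<in> lift_paths x y" and F: "density A F"
  shows "dens_integral L (lift_tensor p F) \<gamma> = dens_integral A F (p \<circ> \<gamma>)"
proof -
  note pg = lift_paths_D(5)[OF g]
  obtain S where S: "finite S" "\<forall>t\<in>{0<..<1} - S. \<forall>i\<in>charts A. (p \<circ> \<gamma>) t \<in> chart_dom A i \<longrightarrow>
           (\<exists>D. ((chart_map A i \<circ> (p \<circ> \<gamma>)) has_vector_derivative D) (at t))"
    using pw_C1_differentiable[OF paths_D(3)[OF pg]] by blast
  have "integral {0..1} (dens L (lift_tensor p F) \<gamma>) = integral {0..1} (dens A F (p \<circ> \<gamma>))"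
  proof (rule integral_spike[of "S \<union> {0, 1}"])
    show "negligible (S \<union> {0, 1})" using S(1) by (simp add: negligible_finite)
    fix t :: real assume t: "t \<in> {0..1} - (S \<union> {0, 1})"
    then have t': "t \<in> {0<..<1}" "t \<in> {0<..<1} - S" by auto
    have "\<gamma> t \<in> X" using lift_paths_D(2)[OF g] t unfolding path_image_def by auto
    then obtain i0 where "i0 \<in> charts A" "p (\<gamma> t) \<in> chart_dom A i0" using chart_at[OF p_in] by blast
    then have "\<exists>iV. iV \<in> charts L \<and> \<gamma> t \<in> chart_dom L iV" using lift_chart_ex[OF \<open>\<gamma> t \<in> X\<close>] by fastforce
    from someI_ex[OF this] have iV: "chart_at L (\<gamma> t) \<in> charts L" "\<gamma> t \<in> snd (chart_at L (\<gamma> t))"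
      unfolding chart_at_def by auto
    \<comment> \<open>The chart chosen in the cover need not lie over the one chosen in
      \<open>M\<close>; both integrands are computed in the former.\<close>
    define i where "i = fst (chart_at L (\<gamma> t))"
    have i: "i \<in> charts A" "(p \<circ> \<gamma>) t \<in> chart_dom A i" using iV unfolding i_def lift_chart_iff by auto
    obtain D where D: "((chart_map A i \<circ> (p \<circ> \<gamma>)) has_vector_derivative D) (at t)" using S(2) t'(2) i by blast
    have "dens A F (p \<circ> \<gamma>) t = F i ((p \<circ> \<gamma>) t) D" by (rule dens_eq[OF F paths_D(6,7)[OF pg] t'(1) i D])
    moreover have "dens L (lift_tensor p F) \<gamma> t = F i ((p \<circ> \<gamma>) t) D"
      using D by (simp add: dens_def lift_tensor_def split_beta i_def o_assoc vector_derivative_at)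
    ultimately show "dens A F (p \<circ> \<gamma>) t = dens L (lift_tensor p F) \<gamma> t" by simp
  qed
  then show ?thesis by (simp add: dens_integral_def)
qed

lemma lift_paths_lift:
  assumes x: "x \<in> X" and d: "\<delta> \<in> paths (p x) z"
  shows "\<exists>\<gamma> y. \<gamma> \<in> lift_paths x y \<and> p y = z \<and> (\<forall>t\<in>{0..1}. p (\<gamma> t) = \<delta> t)"
proof -
  obtain \<gamma> where g: "path \<gamma>" "path_image \<gamma> \<subseteq> X" "pathstart \<gamma> = x" "\<And>t. t \<in> {0..1} \<Longrightarrow> p (\<gamma> t) = \<delta> t"
    using covering_path_lift[OF cov x paths_D(1,2,4)[OF d]] by blast
  have "p \<circ> \<gamma> \<in> paths (p x) z" by (rule paths_cong[OF d]) (simp add: g(4))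
  moreover have "p (pathfinish \<gamma>) = z" using g(4)[of 1] paths_D(9)[OF d] by (simp add: pathfinish_def)
  ultimately show ?thesis using g unfolding lift_paths_iff by blast
qed

lemma lift_paths_join:
  assumes "\<gamma> \<in> lift_paths x y" "\<delta> \<in> lift_paths y z"
  shows "\<gamma> +++ \<delta> \<in> lift_paths x z"
  using lift_paths_D[OF assms(1)] lift_paths_D[OF assms(2)] paths_join[OF lift_paths_D(5)[OF assms(1)] lift_paths_D(5)[OF assms(2)]]
  unfolding lift_paths_iff by (simp add: path_compose_join subset_path_image_join)

lemma lift_paths_reverse:
  assumes "\<gamma> \<in> lift_paths x y" shows "reversepath \<gamma> \<in> lift_paths y x"
  using lift_paths_D[OF assms] paths_reverse[OF lift_paths_D(5)[OF assms]] unfolding lift_paths_iff by (simp add: path_compose_reversepath)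

lemma lift_paths_const:
  assumes "x \<in> X" shows "(\<lambda>_. x) \<in> lift_paths x x"
  using assms paths_const[OF p_in[OF assms]] unfolding lift_paths_iff
  by (simp add: o_def path_def path_image_def pathstart_def pathfinish_def)

text \<open>By monodromy the lift of the smoothed projection ends where the given continuous path
  does. This makes the infimum in \<open>riemannian_dist\<close> one over a nonempty set.\<close>

lemma lift_paths_nonempty:
  assumes X: "path_connected X" and x: "x \<in> X" and y: "y \<in> X"
  shows "\<exists>\<gamma>. \<gamma> \<in> lift_paths x y"
proof -
  obtain g where g: "path g" "path_image g \<subseteq> X" "pathstart g = x" "pathfinish g = y"
    using assms unfolding path_connected_def by blast
  have pg: "path (p \<circ> g)" using g by (intro path_continuous_image continuous_on_subset[OF p_cont]) auto
  have "path_image (p \<circ> g) \<subseteq> M" using g p_in by (auto simp: path_image_compose)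
  then obtain \<delta> where d: "\<delta> \<in> paths (p x) (p y)" "homotopic_paths M (p \<circ> g) \<delta>" 
    using homotopic_C1_path[OF pg] g by (auto simp: pathstart_compose pathfinish_compose)
  obtain \<gamma> z where l: "\<gamma> \<in> lift_paths x z" "p z = p y" "\<forall>t\<in>{0..1}. p (\<gamma> t) = \<delta> t" using lift_paths_lift[OF x d(1)] by blast
  have "pathfinish g = pathfinish \<gamma>"
    by (rule covering_monodromy[OF cov d(2) g(1,2) _ lift_paths_D(1,2)[OF l(1)]]) (use l(3) g(3) lift_paths_D(3)[OF l(1)] in auto)
  then show ?thesis using l(1) lift_paths_D(4)[OF l(1)] g(4) by auto
qed

end

section \<open>The length distance of a cover\<close>

locale riemannian_cover = smooth_cover A M X p for A :: "('a::t2_space, 'e::{real_inner,heine_borel}, 'i) atlas"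
  and M and X :: "'b::topological_space set" and p +
  fixes gm :: "'i \<Rightarrow> 'a \<Rightarrow> 'e \<Rightarrow> 'e \<Rightarrow> real"
  assumes gm: "riemannian_metric A gm" and X_connected: "path_connected X"
begin

abbreviation d :: "'b \<Rightarrow> 'b \<Rightarrow> real" where "d \<equiv> riemannian_dist L (lift_tensor p gm) X"

abbreviation len :: "(real \<Rightarrow> 'a) \<Rightarrow> real" where "len \<equiv> dens_integral A (metric_norm gm)"

lemma gm_density: "density A (metric_norm gm)"
  by (rule density_metric_norm[OF gm])

lemma d_eq: "d x y = Inf ((\<lambda>\<gamma>. len (p \<circ> \<gamma>)) ` lift_paths x y)"
proof -
  have "path_length L (lift_tensor p gm) ` lift_paths x y = (\<lambda>\<gamma>. len (p \<circ> \<gamma>)) ` lift_paths x y"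
    by (rule image_cong[OF refl]) (simp add: path_length_eq metric_norm_lift_tensor lift_dens_integral gm_density)
  then show ?thesis unfolding riemannian_dist_def by simp
qed

lemma len_nonneg: "\<gamma> \<in> lift_paths x y \<Longrightarrow> 0 \<le> len (p \<circ> \<gamma>)"
  using metric_dens_integral_nonneg[OF gm] lift_paths_D(5) by blast

lemma d_le: 
  assumes "\<gamma> \<in> lift_paths x y" shows "d x y \<le> len (p \<circ> \<gamma>)"
  unfolding d_eq
  by (rule cInf_lower) (use assms len_nonneg in \<open>auto intro!: bdd_belowI[of _ 0]\<close>)

lemma d_ge:
  assumes "x \<in> X" "y \<in> X" "\<And>\<gamma>. \<gamma> \<in> lift_paths x y \<Longrightarrow> c \<le> len (p \<circ> \<gamma>)"
  shows "c \<le> d x y"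
  unfolding d_eq
  by (rule cInf_greatest) (use assms lift_paths_nonempty[OF X_connected] in auto)

lemma d_nonneg: "x \<in> X \<Longrightarrow> y \<in> X \<Longrightarrow> 0 \<le> d x y"
  by (rule d_ge) (auto intro: len_nonneg)

text \<open>Moves a point of the cover along a path of \<open>M\<close> at no more cost than the
  length of that path; this is how the fibre over the base point is reached.\<close>

lemma d_lift:
  assumes x: "x \<in> X" and g: "\<delta> \<in> paths (p x) z"
  shows "\<exists>y\<in>X. p y = z \<and> d x y \<le> len \<delta>"
proof -
  obtain \<gamma> y where l: "\<gamma> \<in> lift_paths x y" "p y = z" "\<forall>t\<in>{0..1}. p (\<gamma> t) = \<delta> t" using lift_paths_lift[OF assms] by blast
  have "len (p \<circ> \<gamma>) = len \<delta>" by (rule dens_integral_cong) (use l(3) in simp)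
  then show ?thesis using d_le[OF l(1)] l(2) lift_paths_D(7)[OF l(1)] by auto
qed

lemma d_self: 
  assumes "x \<in> X" shows "d x x = 0"
proof -
  have "d x x \<le> len (p \<circ> (\<lambda>_. x))" by (rule d_le[OF lift_paths_const[OF assms]])
  also have "\<dots> = 0" using dens_integral_const[OF gm_density p_in[OF assms]] by (simp add: o_def)
  finally show ?thesis using d_nonneg[OF assms assms] by simp
qed

lemma d_sym_le:
  assumes "x \<in> X" "y \<in> X" shows "d x y \<le> d y x"
proof (rule d_ge[OF assms(2,1)])
  fix \<gamma> assume g: "\<gamma> \<in> lift_paths y x"
  have "d x y \<le> len (p \<circ> reversepath \<gamma>)" by (rule d_le[OF lift_paths_reverse[OF g]])
  also have "\<dots> = len (p \<circ> \<gamma>)"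
    unfolding path_compose_reversepath
    by (rule dens_integral_reverse[OF gm_density lift_paths_D(5)[OF g]]) (rule metric_norm_minus[OF gm])
  finally show "d x y \<le> len (p \<circ> \<gamma>)" .
qed

lemma d_sym: "x \<in> X \<Longrightarrow> y \<in> X \<Longrightarrow> d x y = d y x"
  using d_sym_le by (simp add: order_antisym)

lemma d_triangle:
  assumes "x \<in> X" "y \<in> X" "z \<in> X" shows "d x z \<le> d x y + d y z"
proof -
  \<comment> \<open>The two infima are taken one after the other, the inner one over \<delta> with
    \<gamma> fixed.\<close>
  have "d x z - d y z \<le> d x y"
  proof (rule d_ge[OF assms(1,2)])
    fix \<gamma> assume g: "\<gamma> \<in> lift_paths x y"
    have "d x z - len (p \<circ> \<gamma>) \<le> d y z"
    proof (rule d_ge[OF assms(2,3)])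
      fix \<delta> assume dl: "\<delta> \<in> lift_paths y z"
      have "d x z \<le> len (p \<circ> (\<gamma> +++ \<delta>))" by (rule d_le[OF lift_paths_join[OF g dl]])
      also have "\<dots> = len (p \<circ> \<gamma>) + len (p \<circ> \<delta>)"
        unfolding path_compose_join by (rule dens_integral_join[OF gm_density lift_paths_D(5)[OF g] lift_paths_D(5)[OF dl]])
      finally show "d x z - len (p \<circ> \<gamma>) \<le> len (p \<circ> \<delta>)" by simp
    qed
    then show "d x z - d y z \<le> len (p \<circ> \<gamma>)" by simp
  qed
  then show ?thesis by simp
qed

text \<open>A path shorter than \<open>c * r\<close> projects into a coordinate ball inside an
  evenly covered set, hence stays in the sheet of \<open>x\<close>. Its end is then in that sheet,
  where different points have different coordinates.\<close>

lemma d_pos: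
  assumes x: "x \<in> X" and y: "y \<in> X" and neq: "x \<noteq> y"
  shows "0 < d x y"
proof -
  obtain T where T: "openin (top_of_set M) T" "p x \<in> T" "evenly_covered X p T"
    using covering_space_evenly_covered[OF cov p_in[OF x]] by blast
  then obtain V q where V: "x \<in> V" "sheet X p T V q" using x unfolding evenly_covered_def by blast
  have h: "homeomorphism V T p q" using V(2) unfolding sheet_def by auto
  define i where "i = chart_at A (p x)"
  have i: "i \<in> charts A" "p x \<in> chart_dom A i" unfolding i_def using chart_at[OF p_in[OF x]] by auto
  have "openin (top_of_set (chart_dom A i)) (chart_dom A i \<inter> T)"
    using T(1) dom_subset[OF i(1)] unfolding openin_open by blast
  then have o: "open (chart_map A i ` (chart_dom A i \<inter> T))"
    using homeomorphism_imp_open_map[OF homeo[OF i(1)]] openin_open_trans open_image[OF i(1)] by blast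
  then obtain r0 where r0: "r0 > 0" "cball (chart_map A i (p x)) r0 \<subseteq> chart_map A i ` (chart_dom A i \<inter> T)"
    using open_contains_cball[of "chart_map A i ` (chart_dom A i \<inter> T)"] T(2) i(2) by blast
  \<comment> \<open>If \<open>y\<close> shares sheet and chart with \<open>x\<close>, the radius is
    also kept at most the coordinate distance of the two points; otherwise no short path reaches
    \<open>y\<close> at all.\<close>
  define r where "r = (if y \<in> V \<and> p y \<in> chart_dom A i then min r0 (dist (chart_map A i (p x)) (chart_map A i (p y))) else r0)"
  have "chart_map A i (p x) \<noteq> chart_map A i (p y)" if "y \<in> V" "p y \<in> chart_dom A i"
  proof
    assume "chart_map A i (p x) = chart_map A i (p y)"
    then have "p x = p y" using inv_map[OF i(1)] i(2) that(2) by metis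
    then show False using h V(1) that(1) neq unfolding homeomorphism_def by metis
  qed
  then have r: "0 < r" "r \<le> r0" using r0(1) unfolding r_def by auto
  have sub: "cball (chart_map A i (p x)) r \<subseteq> chart_map A i ` (chart_dom A i \<inter> T)" using r0(2) r(2) by auto
  then have W: "cball (chart_map A i (p x)) r \<subseteq> chart_image A i" unfolding chart_image_def by blast
  obtain c where c: "c > 0" "\<forall>z\<in>cball (chart_map A i (p x)) r. \<forall>v. c * norm v \<le> metric_norm gm i (chart_inv A i z) v"
    using density_local_lower[OF gm_density i(1) compact_cball W metric_norm_pos[OF gm i(1)]] by blast
  have "c * r \<le> d x y"
  proof (rule d_ge[OF x y], rule ccontr)
    fix \<gamma> assume g: "\<gamma> \<in> lift_paths x y" and "\<not> c * r \<le> len (p \<circ> \<gamma>)"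
    then have short: "len (p \<circ> \<gamma>) < c * r" by simp
    have st: "(p \<circ> \<gamma>) t \<in> chart_dom A i \<and> chart_map A i ((p \<circ> \<gamma>) t) \<in> ball (chart_map A i (p x)) r" if "t \<in> {0..1}" for t
      by (rule short_path_stays_in_chart[OF gm i lift_paths_D(5)[OF g] W c(1) _ short that]) (use c(2) in blast)
    have inT: "p (\<gamma> t) \<in> T" if t: "t \<in> {0..1}" for t
    proof -
      have "chart_map A i (p (\<gamma> t)) \<in> chart_map A i ` (chart_dom A i \<inter> T)" using st[OF t] sub by auto
      then obtain z where z: "z \<in> chart_dom A i" "z \<in> T" "chart_map A i (p (\<gamma> t)) = chart_map A i z" by blast
      then have "p (\<gamma> t) = z" using inv_map[OF i(1)] st[OF t] by (metis comp_apply)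
      then show ?thesis using z(2) by simp
    qed
    have g01: "continuous_on {0..1} \<gamma>" "\<And>t. t \<in> {0..1} \<Longrightarrow> \<gamma> t \<in> X" "\<gamma> 0 = x" "\<gamma> 1 = y"
      using lift_paths_D(1,2,3,4)[OF g] by (auto simp: path_def path_image_def pathstart_def pathfinish_def)
    have "\<gamma> 1 \<in> V \<and> \<gamma> 1 = q (p (\<gamma> 1))"
      by (rule sheet_connected[OF V(2) connected_Icc g01(1,2) inT, of 0]) (use g01(3) V(1) in auto)
    then have yV: "y \<in> V" using g01(4) by simp
    have "p y \<in> chart_dom A i" "dist (chart_map A i (p x)) (chart_map A i (p y)) < r" using st[of 1] g01(4) by auto
    then show False using yV unfolding r_def by auto
  qed
  moreover have "0 < c * r" using c(1) r(1) by simp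
  ultimately show ?thesis by linarith
qed

lemma Metric_space_d:
  assumes "e > 0" shows "Metric_space X (dist_on X (\<lambda>x y. e * d x y))"
proof
  fix x y z
  show "0 \<le> dist_on X (\<lambda>x y. e * d x y) x y" using assms d_nonneg by (simp add: dist_on_def)
  show "dist_on X (\<lambda>x y. e * d x y) x y = dist_on X (\<lambda>x y. e * d x y) y x" using d_sym by (auto simp: dist_on_def)
  {
    assume "x \<in> X" "y \<in> X"
    then show "dist_on X (\<lambda>x y. e * d x y) x y = 0 \<longleftrightarrow> x = y"
      using assms d_self[of x] d_pos[of x y] by (cases "x = y") (auto simp: dist_on_def)
  next
    assume "x \<in> X" "y \<in> X" "z \<in> X"
    then show "dist_on X (\<lambda>x y. e * d x y) x z \<le> dist_on X (\<lambda>x y. e * d x y) x y + dist_on X (\<lambda>x y. e * d x y) y z"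
      using assms d_triangle[of x y z] by (simp add: dist_on_def flip: distrib_left)
  }
qed

end

section \<open>Cohomology and homology classes\<close>

text \<open>On an open \<open>S\<close> equal functions agree near each point and so have equal
  derivatives, which carries the congruence through all orders. The rules for sums and multiples
  rely on it, as they rewrite derivatives only on \<open>S\<close>.\<close>

lemma Ck_on_cong:
  assumes S: "open S"
  shows "(\<And>x. x \<in> S \<Longrightarrow> f x = g x) \<Longrightarrow> Ck_on n S f \<Longrightarrow> Ck_on n S g"
proof (induction n arbitrary: f g)
  case 0
  have "continuous_on S f" using 0(2) by simp
  then have "continuous_on S g" using 0(1) by (rule continuous_on_eq)
  then show ?case by simp
next
  case (Suc n)
  have d: "(g has_derivative frechet_derivative f (at x)) (at x)" if x: "x \<in> S" for x
  proof -
    have "f differentiable (at x)" using Suc.prems(2) x by simp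
    then have "(f has_derivative frechet_derivative f (at x)) (at x)" by (simp add: frechet_derivative_works)
    then show ?thesis by (rule has_derivative_transform_within_open[OF _ S x Suc.prems(1)])
  qed
  have "Ck_on n S (\<lambda>x. frechet_derivative g (at x) v)" for v
  proof (rule Suc.IH)
    show "frechet_derivative f (at x) v = frechet_derivative g (at x) v" if "x \<in> S" for x
      using frechet_derivative_at[OF d[OF that]] by simp
    show "Ck_on n S (\<lambda>x. frechet_derivative f (at x) v)" using Suc.prems(2) by simp
  qed
  moreover have "\<forall>x\<in>S. g differentiable (at x)" using d unfolding differentiable_def by blast
  ultimately show ?case by simp
qed

lemma Ck_on_const: "Ck_on n S (\<lambda>_. c)"
  by (induction n arbitrary: c) simp_all

lemma frechet_derivative_add:
  assumes "f differentiable (at x)" "g differentiable (at x)"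
  shows "frechet_derivative (\<lambda>x. f x + g x) (at x) = (\<lambda>v. frechet_derivative f (at x) v + frechet_derivative g (at x) v)"
  using has_derivative_add[OF assms[unfolded frechet_derivative_works]] frechet_derivative_at by metis

lemma frechet_derivative_cmult:
  fixes f :: "'x::real_normed_vector \<Rightarrow> real"
  assumes "f differentiable (at x)"
  shows "frechet_derivative (\<lambda>x. c * f x) (at x) = (\<lambda>v. c * frechet_derivative f (at x) v)"
  using has_derivative_mult_right[OF assms[unfolded frechet_derivative_works], of c] frechet_derivative_at by metis

lemma Ck_on_add:
  assumes S: "open S"
  shows "Ck_on n S f \<Longrightarrow> Ck_on n S g \<Longrightarrow> Ck_on n S (\<lambda>x. f x + g x)"
proof (induction n arbitrary: f g)
  case 0
  then show ?case by (simp add: continuous_on_add)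
next
  case (Suc n)
  have "Ck_on n S (\<lambda>x. frechet_derivative (\<lambda>x. f x + g x) (at x) v)" for v
  proof (rule Ck_on_cong[OF S])
    show "Ck_on n S (\<lambda>x. frechet_derivative f (at x) v + frechet_derivative g (at x) v)"
      by (rule Suc.IH) (use Suc.prems in simp_all)
    show "frechet_derivative f (at x) v + frechet_derivative g (at x) v = frechet_derivative (\<lambda>x. f x + g x) (at x) v"
      if "x \<in> S" for x using frechet_derivative_add[of f x g] Suc.prems that by simp
  qed
  then show ?case using Suc.prems by (simp add: differentiable_add)
qed

lemma Ck_on_cmult:
  fixes f :: "'x::real_normed_vector \<Rightarrow> real"
  assumes S: "open S"
  shows "Ck_on n S f \<Longrightarrow> Ck_on n S (\<lambda>x. c * f x)"
proof (induction n arbitrary: f)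
  case 0
  then show ?case by (simp add: continuous_on_mult_left)
next
  case (Suc n)
  have "Ck_on n S (\<lambda>x. frechet_derivative (\<lambda>x. c * f x) (at x) v)" for v
  proof (rule Ck_on_cong[OF S])
    show "Ck_on n S (\<lambda>x. c * frechet_derivative f (at x) v)"
      by (rule Suc.IH) (use Suc.prems in simp)
    show "c * frechet_derivative f (at x) v = frechet_derivative (\<lambda>x. c * f x) (at x) v"
      if "x \<in> S" for x using frechet_derivative_cmult[of f x c] Suc.prems that by simp
  qed
  then show ?case using Suc.prems by (simp add: differentiable_mult)
qed

lemma smooth_on_differentiable: "smooth_on S f \<Longrightarrow> x \<in> S \<Longrightarrow> f differentiable (at x)"
  unfolding smooth_on_def by (metis Ck_on.simps(2))

lemma smooth_on_add: "open S \<Longrightarrow> smooth_on S f \<Longrightarrow> smooth_on S g \<Longrightarrow> smooth_on S (\<lambda>x. f x + g x)"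
  unfolding smooth_on_def using Ck_on_add by blast

lemma smooth_on_cmult:
  fixes f :: "'x::real_normed_vector \<Rightarrow> real"
  shows "open S \<Longrightarrow> smooth_on S f \<Longrightarrow> smooth_on S (\<lambda>x. c * f x)"
  unfolding smooth_on_def using Ck_on_cmult by blast

section \<open>Linear structure of forms, and coordinates on H_1(M, R)\<close>

context smooth_mfd
begin

lemma closed_form_zero: "closed_form A (\<lambda>i x v. 0)"
  unfolding closed_form_def one_form_def smooth_on_def by (auto simp: Ck_on_const linear_zero)

lemma closed_form_add:
  assumes "closed_form A \<omega>" "closed_form A \<eta>"
  shows "closed_form A (\<lambda>i x v. \<omega> i x v + \<eta> i x v)"
proof -
  have sm: "smooth_on (chart_image A i) (\<lambda>y. \<omega> i (chart_inv A i y) v)" "smooth_on (chart_image A i) (\<lambda>y. \<eta> i (chart_inv A i y) v)"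
    if "i \<in> charts A" for i v using assms that unfolding closed_form_def one_form_def by blast+
  show ?thesis
    unfolding closed_form_def one_form_def
  proof (intro conjI ballI allI)
    fix i x assume "i \<in> charts A" "x \<in> chart_dom A i"
    then have "linear (\<omega> i x)" "linear (\<eta> i x)" using assms unfolding closed_form_def one_form_def by blast+
    then show "linear (\<lambda>v. \<omega> i x v + \<eta> i x v)" by (rule linear_compose_add)
  next
    fix i v assume i: "i \<in> charts A"
    show "smooth_on (chart_image A i) (\<lambda>y. \<omega> i (chart_inv A i y) v + \<eta> i (chart_inv A i y) v)"
      by (rule smooth_on_add[OF open_image[OF i] sm[OF i]])
  next
    fix i j x v assume ij: "i \<in> charts A" "j \<in> charts A" "x \<in> chart_dom A i \<inter> chart_dom A j"
    have "\<omega> i x v = \<omega> j x (coord_change A i j x v)" "\<eta> i x v = \<eta> j x (coord_change A i j x v)"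
      using assms ij unfolding closed_form_def one_form_def by blast+
    then show "\<omega> i x v + \<eta> i x v = \<omega> j x (coord_change A i j x v) + \<eta> j x (coord_change A i j x v)" by simp
  next
    fix i y u v assume iy: "i \<in> charts A" "y \<in> chart_image A i"
    note df = smooth_on_differentiable[OF sm(1)[OF iy(1)] iy(2)] smooth_on_differentiable[OF sm(2)[OF iy(1)] iy(2)]
    have "frechet_derivative (\<lambda>z. \<omega> i (chart_inv A i z) v) (at y) u = frechet_derivative (\<lambda>z. \<omega> i (chart_inv A i z) u) (at y) v"
      "frechet_derivative (\<lambda>z. \<eta> i (chart_inv A i z) v) (at y) u = frechet_derivative (\<lambda>z. \<eta> i (chart_inv A i z) u) (at y) v"
      using assms iy unfolding closed_form_def by blast+
    then show "frechet_derivative (\<lambda>z. \<omega> i (chart_inv A i z) v + \<eta> i (chart_inv A i z) v) (at y) u =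
        frechet_derivative (\<lambda>z. \<omega> i (chart_inv A i z) u + \<eta> i (chart_inv A i z) u) (at y) v"
      unfolding frechet_derivative_add[OF df] by simp
  qed
qed

lemma closed_form_cmult:
  assumes "closed_form A \<omega>"
  shows "closed_form A (\<lambda>i x v. c * \<omega> i x v)"
proof -
  have sm: "smooth_on (chart_image A i) (\<lambda>y. \<omega> i (chart_inv A i y) v)"
    if "i \<in> charts A" for i v using assms that unfolding closed_form_def one_form_def by blast
  show ?thesis
    unfolding closed_form_def one_form_def
  proof (intro conjI ballI allI)
    fix i x assume "i \<in> charts A" "x \<in> chart_dom A i"
    then have "linear (\<omega> i x)" using assms unfolding closed_form_def one_form_def by blast
    then show "linear (\<lambda>v. c * \<omega> i x v)" using linear_compose_scale_right[of "\<omega> i x" c] by simp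
  next
    fix i v assume i: "i \<in> charts A"
    show "smooth_on (chart_image A i) (\<lambda>y. c * \<omega> i (chart_inv A i y) v)"
      by (rule smooth_on_cmult[OF open_image[OF i] sm[OF i]])
  next
    fix i j x v assume ij: "i \<in> charts A" "j \<in> charts A" "x \<in> chart_dom A i \<inter> chart_dom A j"
    have "\<omega> i x v = \<omega> j x (coord_change A i j x v)"
      using assms ij unfolding closed_form_def one_form_def by blast
    then show "c * \<omega> i x v = c * \<omega> j x (coord_change A i j x v)" by simp
  next
    fix i y u v assume iy: "i \<in> charts A" "y \<in> chart_image A i"
    note df = smooth_on_differentiable[OF sm[OF iy(1)] iy(2)]
    have "frechet_derivative (\<lambda>z. \<omega> i (chart_inv A i z) v) (at y) u = frechet_derivative (\<lambda>z. \<omega> i (chart_inv A i z) u) (at y) v"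
      using assms iy unfolding closed_form_def by blast
    then show "frechet_derivative (\<lambda>z. c * \<omega> i (chart_inv A i z) v) (at y) u =
        frechet_derivative (\<lambda>z. c * \<omega> i (chart_inv A i z) u) (at y) v"
      unfolding frechet_derivative_cmult[OF df] by simp
  qed
qed

lemma closed_form_sum:
  fixes k :: nat
  assumes "\<And>j. j < k \<Longrightarrow> closed_form A (\<omega> j)"
  shows "closed_form A (\<lambda>i x v. \<Sum>j<k. a j * \<omega> j i x v)"
  using assms
proof (induction k)
  case (Suc k)
  have "closed_form A (\<lambda>i x v. (\<Sum>j<k. a j * \<omega> j i x v) + a k * \<omega> k i x v)"
    by (rule closed_form_add[OF Suc.IH closed_form_cmult]) (use Suc.prems in simp_all)
  then show ?case by simp
qed (simp add: closed_form_zero)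

lemma exact_form_add:
  assumes "exact_form A \<omega>" "exact_form A \<eta>"
  shows "exact_form A (\<lambda>i x v. \<omega> i x v + \<eta> i x v)"
proof -
  obtain h where h: "\<And>i. i \<in> charts A \<Longrightarrow> smooth_on (chart_image A i) (h \<circ> chart_inv A i)"
    "\<And>i x. i \<in> charts A \<Longrightarrow> x \<in> chart_dom A i \<Longrightarrow> \<omega> i x = frechet_derivative (h \<circ> chart_inv A i) (at (chart_map A i x))"
    using assms(1) unfolding exact_form_def by blast
  obtain h' where h': "\<And>i. i \<in> charts A \<Longrightarrow> smooth_on (chart_image A i) (h' \<circ> chart_inv A i)"
    "\<And>i x. i \<in> charts A \<Longrightarrow> x \<in> chart_dom A i \<Longrightarrow> \<eta> i x = frechet_derivative (h' \<circ> chart_inv A i) (at (chart_map A i x))"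
    using assms(2) unfolding exact_form_def by blast
  have o: "(\<lambda>x. h x + h' x) \<circ> chart_inv A i = (\<lambda>y. (h \<circ> chart_inv A i) y + (h' \<circ> chart_inv A i) y)" for i by (simp add: o_def)
  show ?thesis
    unfolding exact_form_def
  proof (intro exI[of _ "\<lambda>x. h x + h' x"] ballI conjI)
    fix i assume i: "i \<in> charts A"
    show "smooth_on (chart_image A i) ((\<lambda>x. h x + h' x) \<circ> chart_inv A i)"
      unfolding o by (rule smooth_on_add[OF open_image[OF i] h(1)[OF i] h'(1)[OF i]])
    fix x assume x: "x \<in> chart_dom A i"
    show "(\<lambda>v. \<omega> i x v + \<eta> i x v) = frechet_derivative ((\<lambda>x. h x + h' x) \<circ> chart_inv A i) (at (chart_map A i x))"
      unfolding o h(2)[OF i x] h'(2)[OF i x]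
      by (rule frechet_derivative_add[symmetric]) (use h(1)[OF i] h'(1)[OF i] smooth_on_differentiable map_in_image[OF x] in blast)+
  qed
qed

lemma exact_form_cmult:
  assumes "exact_form A \<omega>"
  shows "exact_form A (\<lambda>i x v. c * \<omega> i x v)"
proof -
  obtain h where h: "\<And>i. i \<in> charts A \<Longrightarrow> smooth_on (chart_image A i) (h \<circ> chart_inv A i)"
    "\<And>i x. i \<in> charts A \<Longrightarrow> x \<in> chart_dom A i \<Longrightarrow> \<omega> i x = frechet_derivative (h \<circ> chart_inv A i) (at (chart_map A i x))"
    using assms(1) unfolding exact_form_def by blast
  have o: "(\<lambda>x. c * h x) \<circ> chart_inv A i = (\<lambda>y. c * (h \<circ> chart_inv A i) y)" for i by (simp add: o_def)
  show ?thesis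
    unfolding exact_form_def
  proof (intro exI[of _ "\<lambda>x. c * h x"] ballI conjI)
    fix i assume i: "i \<in> charts A"
    show "smooth_on (chart_image A i) ((\<lambda>x. c * h x) \<circ> chart_inv A i)"
      unfolding o by (rule smooth_on_cmult[OF open_image[OF i] h(1)[OF i]])
    fix x assume x: "x \<in> chart_dom A i"
    show "(\<lambda>v. c * \<omega> i x v) = frechet_derivative ((\<lambda>x. c * h x) \<circ> chart_inv A i) (at (chart_map A i x))"
      unfolding o h(2)[OF i x]
      by (rule frechet_derivative_cmult[symmetric]) (use h(1)[OF i] smooth_on_differentiable map_in_image[OF x] in blast)
  qed
qed

lemma real_homology_D:
  assumes "l \<in> real_homology A"
  shows "closed_form A \<omega> \<Longrightarrow> closed_form A \<eta> \<Longrightarrow> l (\<lambda>i x v. \<omega> i x v + \<eta> i x v) = l \<omega> + l \<eta>"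
    "closed_form A \<omega> \<Longrightarrow> l (\<lambda>i x v. c * \<omega> i x v) = c * l \<omega>"
    "exact_form A \<omega> \<Longrightarrow> l \<omega> = 0" "\<not> closed_form A \<omega> \<Longrightarrow> l \<omega> = 0"
  using assms unfolding real_homology_def by blast+

lemma real_homology_I:
  assumes "\<And>\<omega> \<eta>. closed_form A \<omega> \<Longrightarrow> closed_form A \<eta> \<Longrightarrow> l (\<lambda>i x v. \<omega> i x v + \<eta> i x v) = l \<omega> + l \<eta>"
    "\<And>c \<omega>. closed_form A \<omega> \<Longrightarrow> l (\<lambda>i x v. c * \<omega> i x v) = c * l \<omega>"
    "\<And>\<omega>. closed_form A \<omega> \<Longrightarrow> exact_form A \<omega> \<Longrightarrow> l \<omega> = 0" "\<And>\<omega>. \<not> closed_form A \<omega> \<Longrightarrow> l \<omega> = 0"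
  shows "l \<in> real_homology A"
  using assms unfolding real_homology_def by blast

lemma real_homology_add:
  assumes "l \<in> real_homology A" "m \<in> real_homology A" shows "(\<lambda>\<omega>. l \<omega> + m \<omega>) \<in> real_homology A"
  by (rule real_homology_I) (simp_all add: real_homology_D[OF assms(1)] real_homology_D[OF assms(2)] distrib_left)

lemma real_homology_cmult:
  assumes "l \<in> real_homology A" shows "(\<lambda>\<omega>. c * l \<omega>) \<in> real_homology A"
  by (rule real_homology_I) (simp_all add: real_homology_D[OF assms] algebra_simps)

lemma real_homology_zero: "(\<lambda>\<omega>. 0) \<in> real_homology A"
  by (rule real_homology_I) simp_all

lemma real_homology_sum:
  fixes k :: nat
  assumes "\<And>j. j < k \<Longrightarrow> E j \<in> real_homology A"
  shows "(\<lambda>\<omega>. \<Sum>j<k. c j * E j \<omega>) \<in> real_homology A"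
  using assms
proof (induction k)
  case (Suc k)
  have "(\<lambda>\<omega>. (\<Sum>j<k. c j * E j \<omega>) + c k * E k \<omega>) \<in> real_homology A"
    by (rule real_homology_add[OF Suc.IH real_homology_cmult]) (use Suc.prems in simp_all)
  then show ?case by simp
qed (simp add: real_homology_zero)

text \<open>The difference of \<eta> and its combination of the \<open>\<omega> j\<close> is exact
  and is killed by \<open>l\<close>. It also has to be closed, because the additivity of
  \<open>l\<close> is one on closed forms.\<close>

lemma real_homology_expand:
  fixes k :: nat
  assumes l: "l \<in> real_homology A" and \<omega>: "\<And>j. j < k \<Longrightarrow> closed_form A (\<omega> j)" and \<eta>: "closed_form A \<eta>"
    and ex: "exact_form A (\<lambda>i x v. \<eta> i x v - (\<Sum>j<k. a j * \<omega> j i x v))"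
  shows "l \<eta> = (\<Sum>j<k. a j * l (\<omega> j))"
proof -
  have s: "l (\<lambda>i x v. \<Sum>j<k. a j * \<omega> j i x v) = (\<Sum>j<k. a j * l (\<omega> j))"
    using \<omega>
  proof (induction k)
    case 0
    show ?case using real_homology_D(2)[OF l closed_form_zero, of 0] by simp
  next
    case (Suc k)
    have "l (\<lambda>i x v. (\<Sum>j<k. a j * \<omega> j i x v) + a k * \<omega> k i x v) = l (\<lambda>i x v. \<Sum>j<k. a j * \<omega> j i x v) + l (\<lambda>i x v. a k * \<omega> k i x v)"
      by (rule real_homology_D(1)[OF l closed_form_sum closed_form_cmult]) (use Suc.prems in simp_all)
    then show ?case using Suc real_homology_D(2)[OF l, of "\<omega> k" "a k"] by simp
  qed
  let ?\<sigma> = "\<lambda>i x v. \<Sum>j<k. a j * \<omega> j i x v"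
  have c\<sigma>: "closed_form A ?\<sigma>" by (rule closed_form_sum[OF \<omega>])
  have "closed_form A (\<lambda>i x v. \<eta> i x v + (- 1) * ?\<sigma> i x v)"
    by (rule closed_form_add[OF \<eta> closed_form_cmult[OF c\<sigma>]])
  then have cd: "closed_form A (\<lambda>i x v. \<eta> i x v - ?\<sigma> i x v)" by simp
  have "l \<eta> = l (\<lambda>i x v. ?\<sigma> i x v + (\<eta> i x v - ?\<sigma> i x v))" by simp
  also have "\<dots> = l ?\<sigma> + l (\<lambda>i x v. \<eta> i x v - ?\<sigma> i x v)" by (rule real_homology_D(1)[OF l c\<sigma> cd])
  also have "l (\<lambda>i x v. \<eta> i x v - ?\<sigma> i x v) = 0" by (rule real_homology_D(3)[OF l ex])
  finally show ?thesis using s by simp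
qed

text \<open>The \<open>E j\<close> are the dual basis: \<open>E j \<eta>\<close> is the coefficient
  of \<open>\<omega> j\<close> in the class of \<eta>. Coefficients are picked by choice and turn
  out linear in \<eta>, because independence modulo exact forms makes them unique.\<close>

lemma cohomology_basis_dual:
  assumes B: "cohomology_basis A k \<omega>"
  shows "\<exists>E. (\<forall>j<k. E j \<in> real_homology A) \<and>
     (\<forall>l\<in>real_homology A. l = (\<lambda>\<eta>. \<Sum>j<k. l (\<omega> j) * E j \<eta>))"
proof -
  have cl: "\<And>j. j < k \<Longrightarrow> closed_form A (\<omega> j)" using B unfolding cohomology_basis_def by blast
  define R where "R = (\<lambda>\<eta> a. exact_form A (\<lambda>i x v. \<eta> i x v - (\<Sum>j<k. a j * \<omega> j i x v)))"
  have ex: "\<exists>a. R \<eta> a" if "closed_form A \<eta>" for \<eta> using B that unfolding cohomology_basis_def R_def by blast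
  have uniq: "a j = b j" if ab: "R \<eta> a" "R \<eta> b" and j: "j < k" for \<eta> a b j
  proof -
    have "exact_form A (\<lambda>i x v. (\<eta> i x v - (\<Sum>j<k. b j * \<omega> j i x v)) + (- 1) * (\<eta> i x v - (\<Sum>j<k. a j * \<omega> j i x v)))"
      by (rule exact_form_add[OF ab(2)[unfolded R_def] exact_form_cmult[OF ab(1)[unfolded R_def]]])
    moreover have "(\<lambda>i x v. (\<eta> i x v - (\<Sum>j<k. b j * \<omega> j i x v)) + (- 1) * (\<eta> i x v - (\<Sum>j<k. a j * \<omega> j i x v)))
        = (\<lambda>i x v. \<Sum>j<k. (a j - b j) * \<omega> j i x v)"
      by (simp add: fun_eq_iff left_diff_distrib sum_subtractf)
    ultimately have "exact_form A (\<lambda>i x v. \<Sum>j<k. (a j - b j) * \<omega> j i x v)" by simp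
    moreover have "\<forall>a. exact_form A (\<lambda>i x v. \<Sum>j<k. a j * \<omega> j i x v) \<longrightarrow> (\<forall>j<k. a j = 0)"
      using B unfolding cohomology_basis_def by blast
    ultimately have "\<forall>j<k. a j - b j = 0" by (rule spec[of _ "\<lambda>j. a j - b j", THEN mp, rotated])
    then show ?thesis using j by simp
  qed
  define cf where "cf \<eta> = (SOME a. R \<eta> a)" for \<eta>
  have cf: "R \<eta> (cf \<eta>)" if "closed_form A \<eta>" for \<eta> unfolding cf_def by (rule someI_ex[OF ex[OF that]])
  define E where "E j \<eta> = (if closed_form A \<eta> then cf \<eta> j else 0)" for j \<eta>
  have E: "E j \<in> real_homology A" if j: "j < k" for j
  proof (rule real_homology_I)
    fix \<eta> \<theta> assume c: "closed_form A \<eta>" "closed_form A \<theta>"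
    note cs = closed_form_add[OF c]
    have "exact_form A (\<lambda>i x v. (\<eta> i x v - (\<Sum>j<k. cf \<eta> j * \<omega> j i x v)) + (\<theta> i x v - (\<Sum>j<k. cf \<theta> j * \<omega> j i x v)))"
      by (rule exact_form_add) (use cf c in \<open>unfold R_def, blast+\<close>)
    then have "R (\<lambda>i x v. \<eta> i x v + \<theta> i x v) (\<lambda>j. cf \<eta> j + cf \<theta> j)"
      unfolding R_def by (simp add: distrib_right sum.distrib algebra_simps)
    from uniq[OF cf[OF cs] this j] show "E j (\<lambda>i x v. \<eta> i x v + \<theta> i x v) = E j \<eta> + E j \<theta>" using c cs by (simp add: E_def)
  next
    fix c \<eta> assume cl: "closed_form A \<eta>"
    note cs = closed_form_cmult[OF cl, of c]
    have "exact_form A (\<lambda>i x v. c * (\<eta> i x v - (\<Sum>j<k. cf \<eta> j * \<omega> j i x v)))"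
      by (rule exact_form_cmult) (use cf cl in \<open>unfold R_def, blast\<close>)
    then have "R (\<lambda>i x v. c * \<eta> i x v) (\<lambda>j. c * cf \<eta> j)"
      unfolding R_def by (simp add: right_diff_distrib sum_distrib_left mult.assoc)
    from uniq[OF cf[OF cs] this j] show "E j (\<lambda>i x v. c * \<eta> i x v) = c * E j \<eta>" using cl cs by (simp add: E_def)
  next
    fix \<eta> assume c: "closed_form A \<eta>" and e: "exact_form A \<eta>"
    then have "R \<eta> (\<lambda>_. 0)" unfolding R_def by simp
    from uniq[OF cf[OF c] this j] show "E j \<eta> = 0" by (simp add: E_def)
  qed (simp add: E_def)
  have "l = (\<lambda>\<eta>. \<Sum>j<k. l (\<omega> j) * E j \<eta>)" if l: "l \<in> real_homology A" for l
  proof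
    fix \<eta>
    show "l \<eta> = (\<Sum>j<k. l (\<omega> j) * E j \<eta>)"
    proof (cases "closed_form A \<eta>")
      case True
      have "l \<eta> = (\<Sum>j<k. cf \<eta> j * l (\<omega> j))"
        by (rule real_homology_expand[OF l cl True]) (use cf[OF True] in \<open>simp_all add: R_def\<close>)
      then show ?thesis using True by (simp add: E_def mult.commute)
    next
      case False
      then show ?thesis using real_homology_D(4)[OF l] by (simp add: E_def)
    qed
  qed
  then show ?thesis using E by blast
qed

text \<open>The vectors are the images of the dual basis. They turn \<open>f\<close> into an
  explicit linear expression in the values on the \<open>\<omega> j\<close>, which can be estimated
  although the target carries no topology.\<close>

lemma linear_on_homology_coordinates:
  assumes B: "cohomology_basis A k \<omega>" and f: "linear_on_homology A f"
  shows "\<exists>E. (\<forall>j<k. E j \<in> f ` real_homology A) \<and> (\<forall>l\<in>real_homology A. f l = (\<Sum>j<k. l (\<omega> j) *\<^sub>R E j))"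
proof -
  obtain E where E0: "\<forall>j<k. E j \<in> real_homology A"
    "\<forall>l\<in>real_homology A. l = (\<lambda>\<eta>. \<Sum>j<k. l (\<omega> j) * E j \<eta>)"
    using cohomology_basis_dual[OF B] by (elim exE conjE)
  have E: "j < k \<Longrightarrow> E j \<in> real_homology A" for j using E0(1) by blast
  have E2: "l = (\<lambda>\<eta>. \<Sum>j<k. l (\<omega> j) * E j \<eta>)" if "l \<in> real_homology A" for l by (rule bspec[OF E0(2) that])
  have fa: "f (\<lambda>\<omega>. l \<omega> + m \<omega>) = f l + f m" if "l \<in> real_homology A" "m \<in> real_homology A" for l m
    using f that unfolding linear_on_homology_def by blast
  have fc: "f (\<lambda>\<omega>. c * l \<omega>) = c *\<^sub>R f l" if "l \<in> real_homology A" for l c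
    using f that unfolding linear_on_homology_def by blast
  have sum: "f (\<lambda>\<eta>. \<Sum>j<n. c j * E j \<eta>) = (\<Sum>j<n. c j *\<^sub>R f (E j))" if "n \<le> k" for n c
    using that
  proof (induction n)
    case 0
    show ?case using fc[OF real_homology_zero, of 0] by simp
  next
    case (Suc n)
    have "f (\<lambda>\<eta>. (\<Sum>j<n. c j * E j \<eta>) + c n * E n \<eta>) = f (\<lambda>\<eta>. \<Sum>j<n. c j * E j \<eta>) + f (\<lambda>\<eta>. c n * E n \<eta>)"
      by (rule fa[OF real_homology_sum real_homology_cmult]) (use Suc.prems E in simp_all)
    then show ?case using Suc fc[OF E, of n "c n"] by simp
  qed
  have "f l = (\<Sum>j<k. l (\<omega> j) *\<^sub>R f (E j))" if "l \<in> real_homology A" for l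
    using sum[of k "\<lambda>j. l (\<omega> j)"] arg_cong[OF E2[OF that], of f] by simp
  then show ?thesis using E by (intro exI[of _ "\<lambda>j. f (E j)"]) blast
qed

text \<open>Classes are functions on all forms, so their equality is a claim about every form; the
  dual basis reduces it to the \<open>k\<close> forms \<open>\<omega> j\<close>.\<close>

lemma real_homology_eqI:
  assumes B: "cohomology_basis A k \<omega>" and l: "l \<in> real_homology A" "m \<in> real_homology A"
    and eq: "\<And>j. j < k \<Longrightarrow> l (\<omega> j) = m (\<omega> j)"
  shows "l = m"
proof -
  obtain E where E0: "\<forall>j<k. E j \<in> real_homology A"
    "\<forall>l\<in>real_homology A. l = (\<lambda>\<eta>. \<Sum>j<k. l (\<omega> j) * E j \<eta>)"
    using cohomology_basis_dual[OF B] by (elim exE conjE)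
  note E = bspec[OF E0(2)]
  have "l = (\<lambda>\<eta>. \<Sum>j<k. l (\<omega> j) * E j \<eta>)" by (rule E[OF l(1)])
  also have "\<dots> = (\<lambda>\<eta>. \<Sum>j<k. m (\<omega> j) * E j \<eta>)" using eq by simp
  also have "\<dots> = m" by (rule E[OF l(2), symmetric])
  finally show ?thesis .
qed

text \<open>A potential returns to its value along a loop, so exact forms have period 0; linearity
  is that of the integral.\<close>

lemma period_class_in_real_homology:
  assumes g: "\<gamma> \<in> paths x x"
  shows "period_class A \<gamma> \<in> real_homology A"
proof (rule real_homology_I)
  fix \<omega> \<eta> assume c: "closed_form A \<omega>" "closed_form A \<eta>"
  have d: "density A \<omega>" "density A \<eta>" using c density_one_form unfolding closed_form_def by blast+
  have "dens A (\<lambda>i x v. \<omega> i x v + \<eta> i x v) \<gamma> = (\<lambda>t. dens A \<omega> \<gamma> t + dens A \<eta> \<gamma> t)" by (simp add: dens_def fun_eq_iff)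
  then have "dens_integral A (\<lambda>i x v. \<omega> i x v + \<eta> i x v) \<gamma> = dens_integral A \<omega> \<gamma> + dens_integral A \<eta> \<gamma>"
    unfolding dens_integral_def using Henstock_Kurzweil_Integration.integral_add[OF paths_dens_integrable[OF d(1) g] paths_dens_integrable[OF d(2) g]] by simp
  then show "period_class A \<gamma> (\<lambda>i x v. \<omega> i x v + \<eta> i x v) = period_class A \<gamma> \<omega> + period_class A \<gamma> \<eta>"
    using c closed_form_add[OF c] by (simp add: period_class_def line_integral_eq)
next
  fix c \<omega> assume cl: "closed_form A \<omega>"
  have "dens A (\<lambda>i x v. c * \<omega> i x v) \<gamma> = (\<lambda>t. c * dens A \<omega> \<gamma> t)" by (simp add: dens_def fun_eq_iff)
  then have "dens_integral A (\<lambda>i x v. c * \<omega> i x v) \<gamma> = c * dens_integral A \<omega> \<gamma>"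
    unfolding dens_integral_def by simp
  then show "period_class A \<gamma> (\<lambda>i x v. c * \<omega> i x v) = c * period_class A \<gamma> \<omega>"
    using cl closed_form_cmult[OF cl] by (simp add: period_class_def line_integral_eq)
next
  fix \<omega> assume cl: "closed_form A \<omega>" and "exact_form A \<omega>"
  then obtain h where h: "\<And>i. i \<in> charts A \<Longrightarrow> smooth_on (chart_image A i) (h \<circ> chart_inv A i)"
    "\<And>i x. i \<in> charts A \<Longrightarrow> x \<in> chart_dom A i \<Longrightarrow> \<omega> i x = frechet_derivative (h \<circ> chart_inv A i) (at (chart_map A i x))"
    unfolding exact_form_def by blast
  show "period_class A \<gamma> \<omega> = 0"
    using dens_integral_exact[OF h g] cl by (simp add: period_class_def line_integral_eq)
qed (simp add: period_class_def)

end

section \<open>Norms and the fundamental group\<close>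

lemma norm_on_D:
  assumes "norm_on (span B) N"
  shows "v \<in> span B \<Longrightarrow> 0 \<le> N v" "v \<in> span B \<Longrightarrow> N v = 0 \<longleftrightarrow> v = 0"
    "v \<in> span B \<Longrightarrow> N (c *\<^sub>R v) = \<bar>c\<bar> * N v" "u \<in> span B \<Longrightarrow> v \<in> span B \<Longrightarrow> N (u + v) \<le> N u + N v"
  using assms unfolding norm_on_def by blast+

lemma norm_on_minus:
  assumes "norm_on (span B) N" "u \<in> span B" "v \<in> span B"
  shows "N (u - v) = N (v - u)"
  using norm_on_D(3)[OF assms(1), of "v - u" "- 1"] assms(2,3) by (simp add: span_diff)

lemma norm_on_triangle:
  assumes "norm_on (span B) N" "u \<in> span B" "v \<in> span B" "w \<in> span B"
  shows "N (u - w) \<le> N (u - v) + N (v - w)"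
  using norm_on_D(4)[OF assms(1), of "u - v" "v - w"] assms(2-4) by (simp add: span_diff)

lemma norm_on_Metric_space:
  assumes "norm_on (span B) N"
  shows "Metric_space (span B) (dist_on (span B) (\<lambda>u v. N (u - v)))"
proof
  fix x y z
  show "0 \<le> dist_on (span B) (\<lambda>u v. N (u - v)) x y" 
    using norm_on_D(1)[OF assms] by (simp add: dist_on_def span_diff)
  show "dist_on (span B) (\<lambda>u v. N (u - v)) x y = dist_on (span B) (\<lambda>u v. N (u - v)) y x"
    using norm_on_minus[OF assms] by (simp add: dist_on_def)
  {
    assume "x \<in> span B" "y \<in> span B"
    then show "dist_on (span B) (\<lambda>u v. N (u - v)) x y = 0 \<longleftrightarrow> x = y"
      using norm_on_D(2)[OF assms, of "x - y"] by (simp add: dist_on_def span_diff)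
  next
    assume "x \<in> span B" "y \<in> span B" "z \<in> span B"
    then show "dist_on (span B) (\<lambda>u v. N (u - v)) x z \<le> dist_on (span B) (\<lambda>u v. N (u - v)) x y + dist_on (span B) (\<lambda>u v. N (u - v)) y z"
      using norm_on_triangle[OF assms] by (simp add: dist_on_def)
  }
qed

lemma norm_on_sum_le:
  assumes N: "norm_on (span B) N" and I: "finite I" and v: "\<And>i. i \<in> I \<Longrightarrow> v i \<in> span B"
  shows "N (\<Sum>i\<in>I. c i *\<^sub>R v i) \<le> (\<Sum>i\<in>I. \<bar>c i\<bar> * N (v i))"
  using I v
proof (induction I rule: finite_induct)
  case empty
  show ?case using norm_on_D(2)[OF N span_zero] by simp
next
  case (insert i I)
  have "N (c i *\<^sub>R v i + (\<Sum>i\<in>I. c i *\<^sub>R v i)) \<le> N (c i *\<^sub>R v i) + N (\<Sum>i\<in>I. c i *\<^sub>R v i)"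
    by (rule norm_on_D(4)[OF N]) (use insert.prems in \<open>auto intro!: span_sum span_mul\<close>)
  moreover have "N (c i *\<^sub>R v i) = \<bar>c i\<bar> * N (v i)" by (rule norm_on_D(3)[OF N]) (use insert.prems in simp)
  moreover have "N (\<Sum>i\<in>I. c i *\<^sub>R v i) \<le> (\<Sum>i\<in>I. \<bar>c i\<bar> * N (v i))" using insert.IH insert.prems by simp
  ultimately show ?case using insert.hyps by simp
qed

lemma continuous_coordinate_sum:
  fixes B :: "'v set" and h :: "'v \<Rightarrow> real \<Rightarrow> real"
  assumes "\<And>b. continuous_on UNIV (h b)"
  shows "continuous_on UNIV (\<lambda>c::'v \<Rightarrow> real. \<Sum>b\<in>B. h b (c b))"
proof (rule continuous_on_sum)
  fix b
  show "continuous_on UNIV (\<lambda>c::'v \<Rightarrow> real. h b (c b))"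
    by (rule continuous_on_compose2[OF assms continuous_on_product_coordinates]) simp
qed

text \<open>Equivalence of norms in finite dimension, by the minimum of \<open>N\<close> over the
  unit sphere of the 1-norm; independence of \<open>B\<close> makes it positive. Since
  \<open>'v\<close> carries no topology, compactness is taken in the space of coordinate functions
  with the product topology.\<close>

lemma norm_on_coordinates_bound:
  fixes B :: "'v::real_vector set"
  assumes N: "norm_on (span B) N" and B: "finite B" "independent B"
  shows "\<exists>C>0. \<forall>c. (\<Sum>b\<in>B. \<bar>c b\<bar>) \<le> C * N (\<Sum>b\<in>B. c b *\<^sub>R b)"
proof (cases "B = {}")
  case True
  then show ?thesis using norm_on_D(2)[OF N span_zero] by (intro exI[of _ 1]) simp
next
  case False
  define S where "S c = (\<Sum>b\<in>B. c b *\<^sub>R b)" for c :: "'v \<Rightarrow> real"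
  have S: "S c \<in> span B" for c unfolding S_def by (intro span_sum span_mul span_base)
  have cont: "continuous_on UNIV (\<lambda>c. N (S c))"
    unfolding continuous_on_def
  proof
    fix c :: "'v \<Rightarrow> real"
    let ?D = "\<lambda>c'. \<Sum>b\<in>B. \<bar>c' b - c b\<bar> * N b"
    have le: "norm (N (S c') - N (S c)) \<le> ?D c'" for c'
    proof -
      have "S c' - S c = (\<Sum>b\<in>B. (c' b - c b) *\<^sub>R b)" unfolding S_def by (simp add: sum_subtractf scaleR_left_diff_distrib)
      then have "N (S c' - S c) \<le> ?D c'" using norm_on_sum_le[OF N B(1), of "\<lambda>b. b" "\<lambda>b. c' b - c b"] by (simp add: span_base)
      moreover have "N (S c') \<le> N (S c' - S c) + N (S c)" using norm_on_D(4)[OF N, of "S c' - S c" "S c"] S by (simp add: span_diff)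
      moreover have "N (S c) \<le> N (S c - S c') + N (S c')" using norm_on_D(4)[OF N, of "S c - S c'" "S c'"] S by (simp add: span_diff)
      moreover have "N (S c - S c') = N (S c' - S c)" by (rule norm_on_minus[OF N S S])
      ultimately show ?thesis by simp
    qed
    have "continuous_on UNIV ?D"
      by (rule continuous_coordinate_sum[of "\<lambda>b z. \<bar>z - c b\<bar> * N b"]) (intro continuous_intros)
    then have "(?D \<longlongrightarrow> ?D c) (at c within UNIV)" unfolding continuous_on_def by blast
    then have "(?D \<longlongrightarrow> 0) (at c within UNIV)" by simp
    then have "((\<lambda>c'. N (S c') - N (S c)) \<longlongrightarrow> 0) (at c within UNIV)"
      by (rule Lim_null_comparison[rotated]) (intro always_eventually allI le)
    then show "((\<lambda>c. N (S c)) \<longlongrightarrow> N (S c)) (at c within UNIV)" by (rule LIM_zero_cancel)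
  qed
  \<comment> \<open>Coordinates outside \<open>B\<close> are pinned to 0, so every factor is compact
    and Tychonoff applies.\<close>
  let ?I = "\<lambda>b. if b \<in> B then {- 1..1} else {0 :: real}"
  define K where "K = PiE UNIV ?I \<inter> {c. (\<Sum>b\<in>B. \<bar>c b\<bar>) = 1}"
  have "compactin (product_topology (\<lambda>_. euclidean) UNIV) (PiE UNIV ?I)"
    by (simp add: compactin_PiE)
  then have "compact (PiE UNIV ?I)" by (simp add: euclidean_product_topology)
  moreover have "closed {c::'v \<Rightarrow> real. (\<Sum>b\<in>B. \<bar>c b\<bar>) = 1}"
    by (intro closed_Collect_eq continuous_coordinate_sum continuous_intros)
  ultimately have K: "compact K" unfolding K_def by (rule compact_Int_closed)
  obtain b0 where b0: "b0 \<in> B" using False by blast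
  have "(\<lambda>b. if b = b0 then 1 else 0) \<in> K" using b0 B(1) unfolding K_def by (auto simp: if_distrib cong: if_cong)
  then have ne: "K \<noteq> {}" by blast
  have "compact ((\<lambda>c. N (S c)) ` K)" by (rule compact_continuous_image[OF continuous_on_subset[OF cont] K]) simp
  then obtain c0 where c0: "c0 \<in> K" "\<And>c. c \<in> K \<Longrightarrow> N (S c0) \<le> N (S c)"
    using compact_attains_inf[of "(\<lambda>c. N (S c)) ` K"] ne by auto
  have "S c0 \<noteq> 0"
  proof
    assume "S c0 = 0"
    then have "c0 b = 0" if "b \<in> B" for b using independentD[OF B(2,1) subset_refl _ that] unfolding S_def by blast
    then have "(\<Sum>b\<in>B. \<bar>c0 b\<bar>) = 0" by simp
    then show False using c0(1) unfolding K_def by simp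
  qed
  then have m: "N (S c0) > 0" using norm_on_D(1,2)[OF N S, of c0] by linarith
  have "(\<Sum>b\<in>B. \<bar>c b\<bar>) \<le> (1 / N (S c0)) * N (S c)" for c
  proof (cases "(\<Sum>b\<in>B. \<bar>c b\<bar>) = 0")
    case True
    then show ?thesis using m norm_on_D(1)[OF N S, of c] by simp
  next
    case False
    define s where "s = (\<Sum>b\<in>B. \<bar>c b\<bar>)"
    have "0 \<le> s" unfolding s_def by (rule sum_nonneg) simp
    then have s: "s > 0" using False unfolding s_def by linarith
    define c' where "c' b = (if b \<in> B then c b / s else 0)" for b
    have cs: "\<bar>c b\<bar> \<le> s" if "b \<in> B" for b unfolding s_def by (rule member_le_sum[OF that _ B(1)]) simp
    have "c' b \<in> ?I b" for b
    proof (cases "b \<in> B")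
      case True
      have "- s \<le> c b" "c b \<le> s" using cs[OF True] by linarith+
      then have "- 1 \<le> c b / s" "c b / s \<le> 1" using s by (simp_all add: field_simps)
      then show ?thesis using True unfolding c'_def by simp
    qed (simp add: c'_def)
    moreover have "(\<Sum>b\<in>B. \<bar>c' b\<bar>) = (\<Sum>b\<in>B. \<bar>c b\<bar> / s)" unfolding c'_def using s by (intro sum.cong) auto
    then have "(\<Sum>b\<in>B. \<bar>c' b\<bar>) = 1" using s unfolding s_def by (simp flip: sum_divide_distrib)
    ultimately have "c' \<in> K" unfolding K_def by (simp add: PiE_iff)
    then have "N (S c0) \<le> N (S c')" by (rule c0(2))
    also have "S c' = (1 / s) *\<^sub>R S c" unfolding S_def c'_def scaleR_sum_right by (intro sum.cong) auto
    also have "N \<dots> = (1 / s) * N (S c)" using norm_on_D(3)[OF N S] s by simp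
    finally have "s * N (S c0) \<le> N (S c)" using s by (simp add: field_simps)
    then show ?thesis using m unfolding s_def by (simp add: field_simps)
  qed
  then show ?thesis using m unfolding S_def by (intro exI[of _ "1 / N (\<Sum>b\<in>B. c0 b *\<^sub>R b)"]) (simp add: S_def)
qed

section \<open>Path classes and homomorphisms to a lattice\<close>

lemma path_class_eqI: "homotopic_paths X \<gamma> \<delta> \<Longrightarrow> path_class X \<gamma> = path_class X \<delta>"
  unfolding path_class_def by (blast intro: homotopic_paths_sym homotopic_paths_trans)

lemma path_class_self: "\<gamma> \<in> loops_at X x \<Longrightarrow> \<gamma> \<in> path_class X \<gamma>"
  unfolding path_class_def loops_at_def by simp

lemma loops_at_join: "\<gamma> \<in> loops_at X x \<Longrightarrow> \<delta> \<in> loops_at X x \<Longrightarrow> \<gamma> +++ \<delta> \<in> loops_at X x"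
  unfolding loops_at_def by (simp add: subset_path_image_join)

lemma loops_at_reverse: "\<gamma> \<in> loops_at X x \<Longrightarrow> reversepath \<gamma> \<in> loops_at X x"
  unfolding loops_at_def by simp

lemma loops_at_const: "x \<in> X \<Longrightarrow> (\<lambda>_. x) \<in> loops_at X x"
  unfolding loops_at_def by (auto simp: path_def path_image_def pathstart_def pathfinish_def)

text \<open>The product in \<open>fundamental_group\<close> ranges over all representatives; joins
  respect homotopy, so the given ones already determine it.\<close>

lemma fundamental_group_mult:
  assumes "\<gamma> \<in> loops_at X x" "\<delta> \<in> loops_at X x"
  shows "monoid.mult (fundamental_group X x) (path_class X \<gamma>) (path_class X \<delta>) = path_class X (\<gamma> +++ \<delta>)"
proof -
  have "(\<exists>\<alpha>\<in>path_class X \<gamma>. \<exists>\<beta>\<in>path_class X \<delta>. homotopic_paths X (\<alpha> +++ \<beta>) \<epsilon>) \<longleftrightarrow> homotopic_paths X (\<gamma> +++ \<delta>) \<epsilon>" for \<epsilon>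
  proof
    assume "\<exists>\<alpha>\<in>path_class X \<gamma>. \<exists>\<beta>\<in>path_class X \<delta>. homotopic_paths X (\<alpha> +++ \<beta>) \<epsilon>"
    then obtain \<alpha> \<beta> where ab: "homotopic_paths X \<gamma> \<alpha>" "homotopic_paths X \<delta> \<beta>" "homotopic_paths X (\<alpha> +++ \<beta>) \<epsilon>"
      unfolding path_class_def by blast
    have "pathfinish \<gamma> = pathstart \<delta>" using assms unfolding loops_at_def by simp
    from homotopic_paths_trans[OF homotopic_paths_join[OF ab(1,2) this] ab(3)]
    show "homotopic_paths X (\<gamma> +++ \<delta>) \<epsilon>" .
  next
    assume "homotopic_paths X (\<gamma> +++ \<delta>) \<epsilon>"
    then show "\<exists>\<alpha>\<in>path_class X \<gamma>. \<exists>\<beta>\<in>path_class X \<delta>. homotopic_paths X (\<alpha> +++ \<beta>) \<epsilon>"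
      using path_class_self[OF assms(1)] path_class_self[OF assms(2)] by blast
  qed
  then show ?thesis unfolding fundamental_group_def path_class_def by simp
qed

text \<open>Both sides are \<gamma> composed with a path in \<open>{0..1}\<close> from 0 to 0, so
  \<open>homotopic_reparametrizations\<close> applies.\<close>

lemma homotopic_loop_reverse:
  assumes "\<gamma> \<in> loops_at X x"
  shows "homotopic_paths X (\<gamma> +++ reversepath \<gamma>) (\<lambda>_. x)"
proof -
  have g: "path \<gamma>" "path_image \<gamma> \<subseteq> X" "\<gamma> 0 = x" using assms unfolding loops_at_def pathstart_def by auto
  have "homotopic_paths X (\<gamma> \<circ> (linepath 0 1 +++ reversepath (linepath 0 1))) (\<gamma> \<circ> linepath 0 0)"
    by (rule homotopic_reparametrizations[OF g(1,2)]) (auto simp: path_image_join closed_segment_eq_real_ivl)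
  moreover have "\<gamma> \<circ> (linepath 0 1 +++ reversepath (linepath 0 1)) = \<gamma> +++ reversepath \<gamma>"
    by (auto simp: linepath_def fun_eq_iff joinpaths_def reversepath_def)
  moreover have "\<gamma> \<circ> linepath 0 0 = (\<lambda>_. x)" using g(3) by (auto simp: linepath_def fun_eq_iff)
  ultimately show ?thesis by simp
qed

text \<open>Multiplicativity is all that \<open>hom\<close> yields besides the range. The constant
  loop is its own square, which forces the value 0, and a loop joined with its reverse is homotopic
  to the constant one.\<close>

lemma fundamental_group_hom_lattice:
  assumes g: "g \<in> hom (fundamental_group X x) (lattice_group B)" and x: "x \<in> X"
  shows "\<gamma> \<in> loops_at X x \<Longrightarrow> \<delta> \<in> loops_at X x \<Longrightarrow> g (path_class X (\<gamma> +++ \<delta>)) = g (path_class X \<gamma>) + g (path_class X \<delta>)"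
    and "g (path_class X (\<lambda>_. x)) = 0"
    and "\<gamma> \<in> loops_at X x \<Longrightarrow> g (path_class X (reversepath \<gamma>)) = - g (path_class X \<gamma>)"
proof -
  have c: "path_class X \<gamma> \<in> carrier (fundamental_group X x)" if "\<gamma> \<in> loops_at X x" for \<gamma>
    using that unfolding fundamental_group_def by simp
  show join: "g (path_class X (\<gamma> +++ \<delta>)) = g (path_class X \<gamma>) + g (path_class X \<delta>)"
    if "\<gamma> \<in> loops_at X x" "\<delta> \<in> loops_at X x" for \<gamma> \<delta>
    using hom_mult[OF g c[OF that(1)] c[OF that(2)]] fundamental_group_mult[OF that] by (simp add: lattice_group_def)
  have "(\<lambda>_. x) +++ (\<lambda>_. x) = (\<lambda>_::real. x)" by (simp add: joinpaths_def)
  then show const: "g (path_class X (\<lambda>_. x)) = 0" using join[OF loops_at_const[OF x] loops_at_const[OF x]] by simp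
  show "g (path_class X (reversepath \<gamma>)) = - g (path_class X \<gamma>)" if "\<gamma> \<in> loops_at X x"
    using join[OF that loops_at_reverse[OF that]] path_class_eqI[OF homotopic_loop_reverse[OF that]] const
    by (simp add: eq_neg_iff_add_eq_0 add.commute)
qed

section \<open>Quasi-isometry of a free abelian cover\<close>

locale abelian_cover_setup =
  fixes A :: "('a::t2_space, 'e::{real_inner,heine_borel}, 'i) atlas"
    and M :: "'a set"
    and gm :: "'i \<Rightarrow> 'a \<Rightarrow> 'e \<Rightarrow> 'e \<Rightarrow> real"
    and Mt :: "'c::topological_space set" and pt :: "'c \<Rightarrow> 'a" and x0 :: 'c
    and Mh :: "'b::topological_space set" and ph :: "'b \<Rightarrow> 'a"
    and \<pi> :: "'c \<Rightarrow> 'b"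
    and k :: nat and \<omega> :: "nat \<Rightarrow> ('a, 'e, 'i) form"
    and G :: "'c \<Rightarrow> ('a, 'e, 'i) form \<Rightarrow> real"
    and B :: "'v::real_vector set"
    and g :: "(real \<Rightarrow> 'a) set \<Rightarrow> 'v"
    and f :: "(('a, 'e, 'i) form \<Rightarrow> real) \<Rightarrow> 'v"
    and Gh :: "'b \<Rightarrow> 'v"
    and N :: "'v \<Rightarrow> real"
  assumes mfdA: "smooth_manifold A M" and gmA: "riemannian_metric A gm"
    and compact_M: "compact M" and conn_M: "path_connected M"
    and max_cover: "maximal_free_abelian_cover A M Mt pt x0"
    and free_cover: "free_abelian_cover M Mh ph (\<pi> x0) B g"
    and cov_pi: "covering_space Mt \<pi> Mh" and ph_pi: "\<And>x. x \<in> Mt \<Longrightarrow> ph (\<pi> x) = pt x"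
    and basis: "cohomology_basis A k \<omega>"
    and abel: "abel_map A M Mt pt x0 k \<omega> G"
    and lin: "linearization A M (pt x0) B g f"
    and Gh_pi: "\<And>x. x \<in> Mt \<Longrightarrow> Gh (\<pi> x) = f (G x)"
    and norm_N: "norm_on (f ` real_homology A) N"
begin

sublocale Mh: riemannian_cover A M Mh ph gm
  using mfdA gmA free_cover unfolding free_abelian_cover_def by unfold_locales blast+

sublocale Mt: smooth_cover A M Mt pt
  using max_cover unfolding maximal_free_abelian_cover_def by unfold_locales blast

lemma base_point: "x0 \<in> Mt" "\<pi> x0 \<in> Mh" "ph (\<pi> x0) = pt x0" "pt x0 \<in> M"
proof -
  show "x0 \<in> Mt" using max_cover unfolding maximal_free_abelian_cover_def by blast
  then show "\<pi> x0 \<in> Mh" "ph (\<pi> x0) = pt x0" "pt x0 \<in> M"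
    using covering_space_imp_surjective[OF cov_pi] ph_pi Mt.p_in by blast+
qed

lemma cover_group: "finite B" "independent B" "g \<in> hom (fundamental_group M (pt x0)) (lattice_group B)"
  "g ` carrier (fundamental_group M (pt x0)) = carrier (lattice_group B)"
  "covering_subgroup Mh ph M (\<pi> x0) = kernel (fundamental_group M (pt x0)) (lattice_group B) g"
  using free_cover unfolding free_abelian_cover_def base_point(3) by blast+

lemma linear_f: "linear_on_homology A f" "f ` real_homology A = span B"
  "\<gamma> \<in> Mh.paths (pt x0) (pt x0) \<Longrightarrow> f (period_class A \<gamma>) = g (path_class M \<gamma>)"
  using lin unfolding linearization_def by blast+

lemma norm_span: "norm_on (span B) N"
  using norm_N linear_f(2) by simp

lemma G_in: "x \<in> Mt \<Longrightarrow> G x \<in> real_homology A"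
  using abel unfolding abel_map_def by blast

lemma omega_density: "j < k \<Longrightarrow> density A (\<omega> j)"
  using basis Mh.density_one_form unfolding cohomology_basis_def closed_form_def by blast

section \<open>Increments of \<open>Gh\<close> as integrals of forms\<close>

lemma G_eq:
  assumes "\<gamma> \<in> Mt.lift_paths x0 x" "j < k"
  shows "G x (\<omega> j) = dens_integral A (\<omega> j) (pt \<circ> \<gamma>)"
proof -
  have "G x (\<omega> j) = line_integral (lift_atlas A M pt Mt) (lift_tensor pt (\<omega> j)) \<gamma>"
    using abel assms Mt.lift_paths_D(7)[OF assms(1)] unfolding abel_map_def by blast
  then show ?thesis using Mt.lift_dens_integral[OF assms(1) omega_density[OF assms(2)]] by (simp add: line_integral_eq)
qed

text \<open>The lift is taken through \<pi>, so it projects under \<open>pt\<close> to the same path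
  of \<open>M\<close> as \<beta> does under \<open>ph\<close>, and line integrals along the two
  agree.\<close>

lemma lift_to_Mt:
  assumes b: "\<beta> \<in> Mh.lift_paths y z" and y': "y' \<in> Mt" "\<pi> y' = y"
  shows "\<exists>\<gamma> z'. \<gamma> \<in> Mt.lift_paths y' z' \<and> \<pi> z' = z \<and> (\<forall>t\<in>{0..1}. pt (\<gamma> t) = ph (\<beta> t))"
proof -
  have start: "pathstart \<beta> = \<pi> y'" using Mh.lift_paths_D(3)[OF b] y'(2) by simp
  obtain \<gamma> where \<gamma>: "path \<gamma>" "path_image \<gamma> \<subseteq> Mt" "pathstart \<gamma> = y'" "\<And>t. t \<in> {0..1} \<Longrightarrow> \<pi> (\<gamma> t) = \<beta> t"
    using covering_path_lift[OF cov_pi y'(1) Mh.lift_paths_D(1,2)[OF b] start] by blast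
  have in_Mt: "\<gamma> t \<in> Mt" if "t \<in> {0..1}" for t using \<gamma>(2) that unfolding path_image_def by blast
  have eq: "pt (\<gamma> t) = ph (\<beta> t)" if "t \<in> {0..1}" for t using ph_pi[OF in_Mt[OF that]] \<gamma>(4)[OF that] by simp
  have "pt \<circ> \<gamma> \<in> Mh.paths (ph y) (ph z)" by (rule Mh.paths_cong[OF Mh.lift_paths_D(5)[OF b]]) (simp add: eq)
  moreover have "ph y = pt y'" using ph_pi[OF y'(1)] y'(2) by simp
  moreover have "pt (pathfinish \<gamma>) = ph z" using eq[of 1] Mh.lift_paths_D(4)[OF b] by (simp add: pathfinish_def)
  ultimately have "\<gamma> \<in> Mt.lift_paths y' (pathfinish \<gamma>)" using \<gamma> unfolding Mt.lift_paths_iff by simp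
  moreover have "\<pi> (pathfinish \<gamma>) = z" using \<gamma>(4)[of 1] Mh.lift_paths_D(4)[OF b] by (simp add: pathfinish_def)
  ultimately show ?thesis using eq by blast
qed

text \<open>\<open>G\<close> is prescribed along paths from \<open>x0\<close> only; prefixing such a
  path to the lift of \<beta> and subtracting gives increments along arbitrary paths. The vectors
  \<open>E j\<close> are independent of the path, as a uniform Lipschitz constant requires.\<close>

lemma Gh_diff:
  "\<exists>E. (\<forall>j<k. E j \<in> span B) \<and>
     (\<forall>y z \<beta>. \<beta> \<in> Mh.lift_paths y z \<longrightarrow> Gh z - Gh y = (\<Sum>j<k. dens_integral A (\<omega> j) (ph \<circ> \<beta>) *\<^sub>R E j))"
proof -
  obtain E where E: "\<forall>j<k. E j \<in> f ` real_homology A" "\<forall>l\<in>real_homology A. f l = (\<Sum>j<k. l (\<omega> j) *\<^sub>R E j)"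
    using Mh.linear_on_homology_coordinates[OF basis linear_f(1)] by blast
  have "Gh z - Gh y = (\<Sum>j<k. dens_integral A (\<omega> j) (ph \<circ> \<beta>) *\<^sub>R E j)" if b: "\<beta> \<in> Mh.lift_paths y z" for y z \<beta>
  proof -
    have "y \<in> \<pi> ` Mt" using covering_space_imp_surjective[OF cov_pi] Mh.lift_paths_D(6)[OF b] by simp
    then obtain y' where y': "y' \<in> Mt" "\<pi> y' = y" by blast
    obtain \<gamma> z' where \<gamma>: "\<gamma> \<in> Mt.lift_paths y' z'" "\<pi> z' = z" "\<forall>t\<in>{0..1}. pt (\<gamma> t) = ph (\<beta> t)" using lift_to_Mt[OF b y'] by blast
    have z': "z' \<in> Mt" by (rule Mt.lift_paths_D(7)[OF \<gamma>(1)])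
    have conn: "path_connected Mt" using max_cover unfolding maximal_free_abelian_cover_def by blast
    obtain \<alpha> where \<alpha>: "\<alpha> \<in> Mt.lift_paths x0 y'" using Mt.lift_paths_nonempty[OF conn base_point(1) y'(1)] by blast
    have "G z' (\<omega> j) - G y' (\<omega> j) = dens_integral A (\<omega> j) (ph \<circ> \<beta>)" if j: "j < k" for j
    proof -
      have "G z' (\<omega> j) = dens_integral A (\<omega> j) (pt \<circ> (\<alpha> +++ \<gamma>))" by (rule G_eq[OF Mt.lift_paths_join[OF \<alpha> \<gamma>(1)] j])
      also have "\<dots> = dens_integral A (\<omega> j) (pt \<circ> \<alpha>) + dens_integral A (\<omega> j) (pt \<circ> \<gamma>)"
        unfolding path_compose_join by (rule Mh.dens_integral_join[OF omega_density[OF j] Mt.lift_paths_D(5)[OF \<alpha>] Mt.lift_paths_D(5)[OF \<gamma>(1)]])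
      also have "dens_integral A (\<omega> j) (pt \<circ> \<alpha>) = G y' (\<omega> j)" using G_eq[OF \<alpha> j] by simp
      also have "dens_integral A (\<omega> j) (pt \<circ> \<gamma>) = dens_integral A (\<omega> j) (ph \<circ> \<beta>)"
        by (rule dens_integral_cong) (use \<gamma>(3) in simp)
      finally show ?thesis by simp
    qed
    moreover have "Gh z - Gh y = (\<Sum>j<k. (G z' (\<omega> j) - G y' (\<omega> j)) *\<^sub>R E j)"
    proof -
      have "Gh z = (\<Sum>j<k. G z' (\<omega> j) *\<^sub>R E j)" using Gh_pi[OF z'] E(2) G_in[OF z'] \<gamma>(2) by simp
      moreover have "Gh y = (\<Sum>j<k. G y' (\<omega> j) *\<^sub>R E j)" using Gh_pi[OF y'(1)] E(2) G_in[OF y'(1)] y'(2) by simp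
      ultimately show ?thesis by (simp add: scaleR_left_diff_distrib sum_subtractf)
    qed
    ultimately show ?thesis by simp
  qed
  then show ?thesis using E(1) linear_f(2) by blast
qed

lemma Gh_in: "y \<in> Mh \<Longrightarrow> Gh y \<in> span B"
  using covering_space_imp_surjective[OF cov_pi] Gh_pi G_in linear_f(2) by (metis imageE imageI)

lemma Gh_Lipschitz: "\<exists>K>0. \<forall>y\<in>Mh. \<forall>z\<in>Mh. N (Gh y - Gh z) \<le> K * Mh.d y z"
proof -
  obtain E where E: "\<forall>j<k. E j \<in> span B"
    "\<forall>y z \<beta>. \<beta> \<in> Mh.lift_paths y z \<longrightarrow> Gh z - Gh y = (\<Sum>j<k. dens_integral A (\<omega> j) (ph \<circ> \<beta>) *\<^sub>R E j)"
    using Gh_diff by blast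
  have "\<forall>j. \<exists>C. j < k \<longrightarrow> C > 0 \<and> (\<forall>x\<in>M. \<forall>i\<in>charts A. x \<in> chart_dom A i \<longrightarrow> (\<forall>v. \<bar>\<omega> j i x v\<bar> \<le> C * metric_norm gm i x v))"
    using Mh.density_comparison[OF compact_M omega_density Mh.gm_density Mh.metric_norm_pos[OF gmA]] by blast
  then obtain C where C: "\<And>j. j < k \<Longrightarrow> C j > 0"
    "\<And>j x i v. j < k \<Longrightarrow> x \<in> M \<Longrightarrow> i \<in> charts A \<Longrightarrow> x \<in> chart_dom A i \<Longrightarrow> \<bar>\<omega> j i x v\<bar> \<le> C j * metric_norm gm i x v"
    by metis
  \<comment> \<open>The 1 keeps the constant positive, as the sum vanishes when all
    \<open>E j\<close> do.\<close>
  define K where "K = 1 + (\<Sum>j<k. C j * N (E j))"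
  have NE: "0 \<le> N (E j)" if "j < k" for j using norm_on_D(1)[OF norm_span] E(1) that by blast
  have K: "K > 0" unfolding K_def using C(1) NE by (intro add_pos_nonneg sum_nonneg mult_nonneg_nonneg) (auto intro: less_imp_le)
  have bound: "N (Gh z - Gh y) \<le> K * Mh.len (ph \<circ> \<beta>)" if b: "\<beta> \<in> Mh.lift_paths y z" for y z \<beta>
  proof -
    have "N (Gh z - Gh y) \<le> (\<Sum>j<k. \<bar>dens_integral A (\<omega> j) (ph \<circ> \<beta>)\<bar> * N (E j))"
      using norm_on_sum_le[OF norm_span, of "{..<k}" E "\<lambda>j. dens_integral A (\<omega> j) (ph \<circ> \<beta>)"] E b by simp
    also have "\<dots> \<le> (\<Sum>j<k. (C j * Mh.len (ph \<circ> \<beta>)) * N (E j))"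
    proof (rule sum_mono)
      fix j assume "j \<in> {..<k}"
      then have j: "j < k" by simp
      have "\<bar>dens_integral A (\<omega> j) (ph \<circ> \<beta>)\<bar> \<le> C j * Mh.len (ph \<circ> \<beta>)"
        by (rule Mh.dens_integral_bound[OF omega_density[OF j] Mh.gm_density Mh.lift_paths_D(5)[OF b] C(2)[OF j]])
      then show "\<bar>dens_integral A (\<omega> j) (ph \<circ> \<beta>)\<bar> * N (E j) \<le> (C j * Mh.len (ph \<circ> \<beta>)) * N (E j)"
        by (rule mult_right_mono[OF _ NE[OF j]])
    qed
    also have "\<dots> = (\<Sum>j<k. C j * N (E j)) * Mh.len (ph \<circ> \<beta>)" by (simp add: sum_distrib_left sum_distrib_right mult_ac)
    also have "\<dots> \<le> K * Mh.len (ph \<circ> \<beta>)" unfolding K_def using Mh.len_nonneg[OF b] by (intro mult_right_mono) auto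
    finally show ?thesis .
  qed
  have "N (Gh y - Gh z) \<le> K * Mh.d y z" if yz: "y \<in> Mh" "z \<in> Mh" for y z
  proof -
    have "N (Gh z - Gh y) / K \<le> Mh.d y z"
      by (rule Mh.d_ge[OF yz]) (use bound K in \<open>simp add: field_simps\<close>)
    moreover have "N (Gh y - Gh z) = N (Gh z - Gh y)" by (rule norm_on_minus[OF norm_span Gh_in[OF yz(1)] Gh_in[OF yz(2)]])
    ultimately show ?thesis using K by (simp add: field_simps)
  qed
  then show ?thesis using K by blast
qed

section \<open>The fibre over the base point and the lattice\<close>

lemma paths_loop: "\<gamma> \<in> Mh.paths (pt x0) (pt x0) \<Longrightarrow> \<gamma> \<in> loops_at M (pt x0)"
  using Mh.paths_D(1,2,4,5) unfolding loops_at_def by blast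

lemmas g_join = fundamental_group_hom_lattice(1)[OF cover_group(3) base_point(4)]
lemmas g_const = fundamental_group_hom_lattice(2)[OF cover_group(3) base_point(4)]
lemmas g_reverse = fundamental_group_hom_lattice(3)[OF cover_group(3) base_point(4)]

text \<open>Over the base point the projected path is a loop, and its lift to \<open>Mt\<close>
  starts at \<open>x0\<close>, so \<open>G\<close> at the end of the lift is the period class of the
  loop. The linearization translates this class into \<open>g\<close>.\<close>

lemma Gh_fibre:
  assumes b: "\<beta> \<in> Mh.lift_paths (\<pi> x0) z" and z: "ph z = pt x0"
  shows "Gh z = g (path_class M (ph \<circ> \<beta>))"
proof -
  have P: "ph \<circ> \<beta> \<in> Mh.paths (pt x0) (pt x0)" using Mh.lift_paths_D(5)[OF b] z base_point(3) by simp
  obtain \<gamma> z' where \<gamma>: "\<gamma> \<in> Mt.lift_paths x0 z'" "\<pi> z' = z" "\<forall>t\<in>{0..1}. pt (\<gamma> t) = ph (\<beta> t)" using lift_to_Mt[OF b base_point(1) refl] by blast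
  have z': "z' \<in> Mt" by (rule Mt.lift_paths_D(7)[OF \<gamma>(1)])
  have "G z' = period_class A (ph \<circ> \<beta>)"
  proof (rule Mh.real_homology_eqI[OF basis G_in[OF z'] Mh.period_class_in_real_homology[OF P]])
    fix j assume j: "j < k"
    have "closed_form A (\<omega> j)" using basis j unfolding cohomology_basis_def by blast
    moreover have "dens_integral A (\<omega> j) (pt \<circ> \<gamma>) = dens_integral A (\<omega> j) (ph \<circ> \<beta>)"
      by (rule dens_integral_cong) (use \<gamma>(3) in simp)
    ultimately show "G z' (\<omega> j) = period_class A (ph \<circ> \<beta>) (\<omega> j)"
      using G_eq[OF \<gamma>(1) j] by (simp add: period_class_def line_integral_eq)
  qed
  then show ?thesis using Gh_pi[OF z'] \<gamma>(2) linear_f(3)[OF P] by simp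
qed

text \<open>The projected \<alpha> followed by the reverse of the projected \<beta> lies in the
  kernel of \<open>g\<close>, hence is homotopic to the projection of a loop in \<open>Mh\<close>.
  By monodromy its lift from \<open>\<pi> x0\<close> closes up; the second half read backwards lifts
  the same path as \<beta> from the same point, so it ends where \<beta> does.\<close>

lemma lift_end_unique:
  assumes a: "\<alpha> \<in> Mh.lift_paths (\<pi> x0) a" "ph a = pt x0" and b: "\<beta> \<in> Mh.lift_paths (\<pi> x0) b" "ph b = pt x0"
    and eq: "g (path_class M (ph \<circ> \<alpha>)) = g (path_class M (ph \<circ> \<beta>))"
  shows "a = b"
proof -
  have P: "ph \<circ> \<alpha> \<in> Mh.paths (pt x0) (pt x0)" "ph \<circ> \<beta> \<in> Mh.paths (pt x0) (pt x0)"
    using Mh.lift_paths_D(5)[OF a(1)] Mh.lift_paths_D(5)[OF b(1)] a(2) b(2) base_point(3) by simp_all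
  let ?\<gamma> = "(ph \<circ> \<alpha>) +++ reversepath (ph \<circ> \<beta>)"
  have loop: "?\<gamma> \<in> loops_at M (pt x0)" by (rule loops_at_join[OF paths_loop[OF P(1)] loops_at_reverse[OF paths_loop[OF P(2)]]])
  have "g (path_class M ?\<gamma>) = 0"
    using g_join[OF paths_loop[OF P(1)] loops_at_reverse[OF paths_loop[OF P(2)]]] g_reverse[OF paths_loop[OF P(2)]] eq by simp
  then have "path_class M ?\<gamma> \<in> covering_subgroup Mh ph M (\<pi> x0)"
    unfolding cover_group(5) kernel_def using loop by (simp add: lattice_group_def fundamental_group_def)
  then obtain \<sigma> where \<sigma>: "\<sigma> \<in> loops_at Mh (\<pi> x0)" "path_class M ?\<gamma> = path_class M (ph \<circ> \<sigma>)"
    unfolding covering_subgroup_def by blast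
  have "?\<gamma> \<in> path_class M (ph \<circ> \<sigma>)" using path_class_self[OF loop] \<sigma>(2) by simp
  then have hom: "homotopic_paths M (ph \<circ> \<sigma>) ?\<gamma>" unfolding path_class_def by simp
  have rP: "reversepath (ph \<circ> \<beta>) \<in> Mh.paths (ph a) (pt x0)" using Mh.paths_reverse[OF P(2)] a(2) by simp
  obtain \<rho> c where \<rho>: "\<rho> \<in> Mh.lift_paths a c" "ph c = pt x0" "\<forall>t\<in>{0..1}. ph (\<rho> t) = reversepath (ph \<circ> \<beta>) t"
    using Mh.lift_paths_lift[OF Mh.lift_paths_D(7)[OF a(1)] rP] by blast
  have j: "\<alpha> +++ \<rho> \<in> Mh.lift_paths (\<pi> x0) c" by (rule Mh.lift_paths_join[OF a(1) \<rho>(1)])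
  have s: "path \<sigma>" "path_image \<sigma> \<subseteq> Mh" "pathstart \<sigma> = \<pi> x0" "pathfinish \<sigma> = \<pi> x0" using \<sigma>(1) unfolding loops_at_def by auto
  have "pathfinish \<sigma> = pathfinish (\<alpha> +++ \<rho>)"
  proof (rule covering_monodromy[OF Mh.cov hom s(1,2) _ Mh.lift_paths_D(1,2)[OF j]])
    show "ph ((\<alpha> +++ \<rho>) t) = ?\<gamma> t" if "t \<in> {0..1}" for t
      using that \<rho>(3) by (auto simp: joinpaths_def)
  qed (use s(3) Mh.lift_paths_D(3)[OF j] in auto)
  then have c: "c = \<pi> x0" using s(4) Mh.lift_paths_D(4)[OF j] by simp
  have r: "reversepath \<rho> \<in> Mh.lift_paths (\<pi> x0) a" using Mh.lift_paths_reverse[OF \<rho>(1)] c by simp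
  have "reversepath \<rho> 1 = \<beta> 1"
  proof (rule covering_lift_unique[OF Mh.cov connected_Icc, of 0 0 1 1])
    show "reversepath \<rho> 0 = \<beta> 0" using Mh.lift_paths_D(3)[OF r] Mh.lift_paths_D(3)[OF b(1)] by (simp add: pathstart_def)
    show "continuous_on {0..1} (reversepath \<rho>)" "reversepath \<rho> ` {0..1} \<subseteq> Mh" 
      using Mh.lift_paths_D(1,2)[OF r] by (auto simp: path_def path_image_def)
    show "continuous_on {0..1} \<beta>" "\<beta> ` {0..1} \<subseteq> Mh" using Mh.lift_paths_D(1,2)[OF b(1)] by (auto simp: path_def path_image_def)
    show "ph (reversepath \<rho> t) = ph (\<beta> t)" if "t \<in> {0..1}" for t
      using \<rho>(3)[rule_format, of "1 - t"] that by (simp add: reversepath_def)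
  qed auto
  then show ?thesis using Mh.lift_paths_D(4)[OF r] Mh.lift_paths_D(4)[OF b(1)] by (simp add: pathfinish_def)
qed

lemma loop_multiple:
  fixes n :: nat
  assumes d: "\<delta> \<in> Mh.paths (pt x0) (pt x0)"
  shows "\<exists>\<gamma>\<in>Mh.paths (pt x0) (pt x0). g (path_class M \<gamma>) = real n *\<^sub>R g (path_class M \<delta>) \<and> Mh.len \<gamma> = real n * Mh.len \<delta>"
proof (induction n)
  case 0
  show ?case
    by (rule bexI[OF _ Mh.paths_const[OF base_point(4)]]) (simp add: g_const Mh.dens_integral_const[OF Mh.gm_density base_point(4)])
next
  case (Suc n)
  then obtain \<gamma> where \<gamma>: "\<gamma> \<in> Mh.paths (pt x0) (pt x0)" "g (path_class M \<gamma>) = real n *\<^sub>R g (path_class M \<delta>)" "Mh.len \<gamma> = real n * Mh.len \<delta>" by blast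
  show ?case
    by (rule bexI[OF _ Mh.paths_join[OF \<gamma>(1) d]])
      (simp add: g_join[OF paths_loop[OF \<gamma>(1)] paths_loop[OF d]] Mh.dens_integral_join[OF Mh.gm_density \<gamma>(1) d] \<gamma>(2,3) algebra_simps)
qed

text \<open>Negative multiples run through the reversed loop, which has the same length since the
  metric norm is even.\<close>

lemma loop_int_multiple:
  assumes d: "\<delta> \<in> Mh.paths (pt x0) (pt x0)"
  shows "\<exists>\<gamma>\<in>Mh.paths (pt x0) (pt x0). g (path_class M \<gamma>) = of_int n *\<^sub>R g (path_class M \<delta>) \<and> Mh.len \<gamma> = \<bar>of_int n\<bar> * Mh.len \<delta>"
proof (cases "n \<ge> 0")
  case True
  then have "of_int n = real (nat n)" "\<bar>of_int n\<bar> = real (nat n)" by auto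
  then show ?thesis using loop_multiple[OF d, of "nat n"] by simp
next
  case False
  then have n: "of_int n = - real (nat (- n))" "\<bar>of_int n\<bar> = real (nat (- n))" by auto
  have "Mh.len (reversepath \<delta>) = Mh.len \<delta>"
    by (rule Mh.dens_integral_reverse[OF Mh.gm_density d]) (rule Mh.metric_norm_minus[OF gmA])
  then show ?thesis using loop_multiple[OF Mh.paths_reverse[OF d], of "nat (- n)"] g_reverse[OF paths_loop[OF d]] unfolding n by simp
qed

lemma lattice_loops:
  "\<exists>L\<ge>0. \<forall>n. \<exists>\<gamma>\<in>Mh.paths (pt x0) (pt x0). 
     g (path_class M \<gamma>) = (\<Sum>b\<in>B. of_int (n b) *\<^sub>R b) \<and> Mh.len \<gamma> \<le> L * (\<Sum>b\<in>B. \<bar>of_int (n b)\<bar>)"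
proof -
  have "\<exists>\<delta>\<in>Mh.paths (pt x0) (pt x0). g (path_class M \<delta>) = b" if b: "b \<in> B" for b
  proof -
    have "(\<Sum>c\<in>B. of_int (if c = b then 1 else 0) *\<^sub>R c) = (\<Sum>c\<in>B. if c = b then c else 0)" by (rule sum.cong) auto
    also have "\<dots> = b" using b cover_group(1) by simp
    finally have "b = (\<Sum>c\<in>B. of_int (if c = b then 1 else 0) *\<^sub>R c)" by simp
    then have "b \<in> carrier (lattice_group B)" unfolding lattice_group_def by auto
    then obtain \<gamma> where \<gamma>: "\<gamma> \<in> loops_at M (pt x0)" "b = g (path_class M \<gamma>)"
      unfolding cover_group(4)[symmetric] fundamental_group_def by auto
    then obtain \<delta> where "\<delta> \<in> Mh.paths (pt x0) (pt x0)" "homotopic_paths M \<gamma> \<delta>"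
      using Mh.homotopic_C1_path[of \<gamma>] unfolding loops_at_def by auto
    then show ?thesis using \<gamma>(2) path_class_eqI by metis
  qed
  then obtain \<delta> where \<delta>: "\<And>b. b \<in> B \<Longrightarrow> \<delta> b \<in> Mh.paths (pt x0) (pt x0)" "\<And>b. b \<in> B \<Longrightarrow> g (path_class M (\<delta> b)) = b" by metis
  \<comment> \<open>The sum of the lengths is a common bound for each of them, and is defined for
    empty \<open>B\<close> too.\<close>
  define L where "L = (\<Sum>b\<in>B. Mh.len (\<delta> b))"
  have nn: "0 \<le> Mh.len (\<delta> b)" if "b \<in> B" for b by (rule Mh.metric_dens_integral_nonneg[OF gmA \<delta>(1)[OF that]])
  have "L \<ge> 0" unfolding L_def by (rule sum_nonneg[OF nn])
  have le: "Mh.len (\<delta> b) \<le> L" if "b \<in> B" for b unfolding L_def by (rule member_le_sum[OF that]) (use nn cover_group(1) in auto)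
  have "\<exists>\<gamma>\<in>Mh.paths (pt x0) (pt x0). g (path_class M \<gamma>) = (\<Sum>b\<in>F. of_int (n b) *\<^sub>R b) \<and> Mh.len \<gamma> \<le> L * (\<Sum>b\<in>F. \<bar>of_int (n b)\<bar>)"
    if "finite F" "F \<subseteq> B" for F n
    using that
  proof (induction F rule: finite_induct)
    case empty
    show ?case
      by (rule bexI[OF _ Mh.paths_const[OF base_point(4)]]) (simp add: g_const Mh.dens_integral_const[OF Mh.gm_density base_point(4)])
  next
    case (insert b F)
    then obtain \<gamma> where \<gamma>: "\<gamma> \<in> Mh.paths (pt x0) (pt x0)" "g (path_class M \<gamma>) = (\<Sum>b\<in>F. of_int (n b) *\<^sub>R b)" 
      "Mh.len \<gamma> \<le> L * (\<Sum>b\<in>F. \<bar>of_int (n b)\<bar>)" by blast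
    have b: "b \<in> B" using insert.prems by blast
    obtain \<epsilon> where \<epsilon>: "\<epsilon> \<in> Mh.paths (pt x0) (pt x0)" "g (path_class M \<epsilon>) = of_int (n b) *\<^sub>R g (path_class M (\<delta> b))" 
      "Mh.len \<epsilon> = \<bar>of_int (n b)\<bar> * Mh.len (\<delta> b)" using loop_int_multiple[OF \<delta>(1)[OF b]] by blast
    have "Mh.len \<epsilon> \<le> \<bar>of_int (n b)\<bar> * L" unfolding \<epsilon>(3) by (rule mult_left_mono[OF le[OF b]]) simp
    then have "Mh.len (\<epsilon> +++ \<gamma>) \<le> L * (\<Sum>b\<in>insert b F. \<bar>of_int (n b)\<bar>)"
      using \<gamma>(3) insert.hyps Mh.dens_integral_join[OF Mh.gm_density \<epsilon>(1) \<gamma>(1)] by (simp add: distrib_left mult.commute)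
    moreover have "g (path_class M (\<epsilon> +++ \<gamma>)) = (\<Sum>b\<in>insert b F. of_int (n b) *\<^sub>R b)"
      using insert.hyps g_join[OF paths_loop[OF \<epsilon>(1)] paths_loop[OF \<gamma>(1)]] \<epsilon>(2) \<gamma>(2) \<delta>(2)[OF b] by simp
    ultimately show ?case using Mh.paths_join[OF \<epsilon>(1) \<gamma>(1)] by blast
  qed
  from this[OF cover_group(1) subset_refl] show ?thesis using \<open>L \<ge> 0\<close> by blast
qed

text \<open>A loop of class \<open>Gh z - Gh y\<close> lifted from \<open>y\<close> must end at
  \<open>z\<close> by \<open>lift_end_unique\<close>. The constant is the product of the length per
  lattice generator and the factor that bounds the coordinate 1-norm by \<open>N\<close>.\<close>

lemma fibre_distance:
  "\<exists>K\<ge>0. \<forall>y\<in>Mh. \<forall>z\<in>Mh. ph y = pt x0 \<longrightarrow> ph z = pt x0 \<longrightarrow> Mh.d y z \<le> K * N (Gh y - Gh z)"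
proof -
  obtain L where L: "L \<ge> 0" "\<forall>n. \<exists>\<gamma>\<in>Mh.paths (pt x0) (pt x0). 
     g (path_class M \<gamma>) = (\<Sum>b\<in>B. of_int (n b) *\<^sub>R b) \<and> Mh.len \<gamma> \<le> L * (\<Sum>b\<in>B. \<bar>of_int (n b)\<bar>)"
    using lattice_loops by blast
  obtain C where C: "C > 0" "\<forall>c. (\<Sum>b\<in>B. \<bar>c b\<bar>) \<le> C * N (\<Sum>b\<in>B. c b *\<^sub>R b)"
    using norm_on_coordinates_bound[OF norm_span cover_group(1,2)] by blast
  have "Mh.d y z \<le> (L * C) * N (Gh y - Gh z)" if yz: "y \<in> Mh" "z \<in> Mh" "ph y = pt x0" "ph z = pt x0" for y z
  proof -
    obtain \<alpha> where \<alpha>: "\<alpha> \<in> Mh.lift_paths (\<pi> x0) y" using Mh.lift_paths_nonempty[OF Mh.X_connected base_point(2) yz(1)] by blast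
    obtain \<beta> where \<beta>: "\<beta> \<in> Mh.lift_paths (\<pi> x0) z" using Mh.lift_paths_nonempty[OF Mh.X_connected base_point(2) yz(2)] by blast
    have P: "ph \<circ> \<alpha> \<in> Mh.paths (pt x0) (pt x0)" "ph \<circ> \<beta> \<in> Mh.paths (pt x0) (pt x0)"
      using Mh.lift_paths_D(5)[OF \<alpha>] Mh.lift_paths_D(5)[OF \<beta>] yz(3,4) base_point(3) by simp_all
    have lat: "\<exists>n :: 'v \<Rightarrow> int. g (path_class M \<gamma>) = (\<Sum>b\<in>B. of_int (n b) *\<^sub>R b)" if "\<gamma> \<in> Mh.paths (pt x0) (pt x0)" for \<gamma>
    proof -
      have "path_class M \<gamma> \<in> carrier (fundamental_group M (pt x0))" using paths_loop[OF that] unfolding fundamental_group_def by simp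
      then have "g (path_class M \<gamma>) \<in> carrier (lattice_group B)" using cover_group(4) by blast
      then show ?thesis unfolding lattice_group_def by auto
    qed
    obtain m :: "'v \<Rightarrow> int" where m: "g (path_class M (ph \<circ> \<alpha>)) = (\<Sum>b\<in>B. of_int (m b) *\<^sub>R b)" using lat[OF P(1)] by blast
    obtain n :: "'v \<Rightarrow> int" where n: "g (path_class M (ph \<circ> \<beta>)) = (\<Sum>b\<in>B. of_int (n b) *\<^sub>R b)" using lat[OF P(2)] by blast
    have Gy: "Gh y = (\<Sum>b\<in>B. of_int (m b) *\<^sub>R b)" and Gz: "Gh z = (\<Sum>b\<in>B. of_int (n b) *\<^sub>R b)"
      using Gh_fibre[OF \<alpha> yz(3)] Gh_fibre[OF \<beta> yz(4)] m n by simp_all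
    obtain \<delta> where \<delta>: "\<delta> \<in> Mh.paths (pt x0) (pt x0)" "g (path_class M \<delta>) = (\<Sum>b\<in>B. of_int (n b - m b) *\<^sub>R b)" 
      "Mh.len \<delta> \<le> L * (\<Sum>b\<in>B. \<bar>of_int (n b - m b)\<bar>)" using L(2)[rule_format, of "\<lambda>b. n b - m b"] by blast
    have \<delta>y: "\<delta> \<in> Mh.paths (ph y) (pt x0)" using \<delta>(1) yz(3) by simp
    obtain \<rho> w where \<rho>: "\<rho> \<in> Mh.lift_paths y w" "ph w = pt x0" "\<forall>t\<in>{0..1}. ph (\<rho> t) = \<delta> t" using Mh.lift_paths_lift[OF yz(1) \<delta>y] by blast
    have P\<rho>: "ph \<circ> \<rho> \<in> Mh.paths (pt x0) (pt x0)" using Mh.lift_paths_D(5)[OF \<rho>(1)] yz(3) \<rho>(2) by simp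
    have "homotopic_paths M \<delta> (ph \<circ> \<rho>)" by (rule homotopic_paths_eq[OF Mh.paths_D(1,2)[OF \<delta>(1)]]) (use \<rho>(3) in simp)
    then have "g (path_class M (ph \<circ> \<rho>)) = g (path_class M \<delta>)" using path_class_eqI by metis
    then have "g (path_class M (ph \<circ> (\<alpha> +++ \<rho>))) = (\<Sum>b\<in>B. of_int (m b) *\<^sub>R b) + (\<Sum>b\<in>B. of_int (n b - m b) *\<^sub>R b)"
      unfolding path_compose_join g_join[OF paths_loop[OF P(1)] paths_loop[OF P\<rho>]] using \<delta>(2) m by simp
    also have "\<dots> = g (path_class M (ph \<circ> \<beta>))" unfolding n sum.distrib[symmetric] by (simp add: scaleR_left_diff_distrib)
    finally have "w = z" by (rule lift_end_unique[OF Mh.lift_paths_join[OF \<alpha> \<rho>(1)] \<rho>(2) \<beta> yz(4)])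
    then have "Mh.d y z \<le> Mh.len (ph \<circ> \<rho>)" using Mh.d_le[OF \<rho>(1)] by simp
    also have "\<dots> = Mh.len \<delta>" by (rule dens_integral_cong) (use \<rho>(3) in simp)
    also have "\<dots> \<le> L * (\<Sum>b\<in>B. \<bar>of_int (n b - m b)\<bar>)" by (rule \<delta>(3))
    also have "\<dots> \<le> L * (C * N (\<Sum>b\<in>B. of_int (n b - m b) *\<^sub>R b))"
      by (rule mult_left_mono[OF _ L(1)]) (rule C(2)[rule_format])
    also have "(\<Sum>b\<in>B. of_int (n b - m b) *\<^sub>R b) = Gh z - Gh y"
      unfolding Gy Gz sum_subtractf[symmetric] by (simp add: scaleR_left_diff_distrib)
    also have "N (Gh z - Gh y) = N (Gh y - Gh z)" by (rule norm_on_minus[OF norm_span Gh_in[OF yz(2)] Gh_in[OF yz(1)]])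
    finally show ?thesis by (simp add: mult.assoc)
  qed
  moreover have "L * C \<ge> 0" using L(1) C(1) by simp
  ultimately show ?thesis by blast
qed

text \<open>Passing to fibre points costs at most \<open>2 * D\<close> in distance and, by the
  Lipschitz bound, at most \<open>2 * K' * D\<close> in \<open>N\<close>; these errors make up the
  additive constant. The factor is \<open>K + 1\<close> because \<open>K\<close> may be 0.\<close>

lemma Gh_lower: "\<exists>K>0. \<exists>D>0. \<forall>y\<in>Mh. \<forall>z\<in>Mh. Mh.d y z \<le> K * N (Gh y - Gh z) + D"
proof -
  obtain D where D: "D > 0" "\<forall>x\<in>M. \<exists>\<gamma>. \<gamma> \<in> Mh.paths x (pt x0) \<and> Mh.len \<gamma> \<le> D"
    using Mh.paths_uniformly_bounded[OF compact_M conn_M base_point(4) Mh.gm_density] by blast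
  obtain K where K: "K \<ge> 0" "\<forall>y\<in>Mh. \<forall>z\<in>Mh. ph y = pt x0 \<longrightarrow> ph z = pt x0 \<longrightarrow> Mh.d y z \<le> K * N (Gh y - Gh z)"
    using fibre_distance by blast
  obtain K' where K': "K' > 0" "\<forall>y\<in>Mh. \<forall>z\<in>Mh. N (Gh y - Gh z) \<le> K' * Mh.d y z"
    using Gh_Lipschitz by blast
  have near: "\<exists>y'\<in>Mh. ph y' = pt x0 \<and> Mh.d y y' \<le> D" if y: "y \<in> Mh" for y
  proof -
    obtain \<gamma> where \<gamma>: "\<gamma> \<in> Mh.paths (ph y) (pt x0)" "Mh.len \<gamma> \<le> D" using D(2) Mh.p_in[OF y] by blast
    then show ?thesis using Mh.d_lift[OF y \<gamma>(1)] by force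
  qed
  have "Mh.d y z \<le> (K + 1) * N (Gh y - Gh z) + (2 * D + K * (2 * K' * D))" if yz: "y \<in> Mh" "z \<in> Mh" for y z
  proof -
    obtain y' where y': "y' \<in> Mh" "ph y' = pt x0" "Mh.d y y' \<le> D" using near[OF yz(1)] by blast
    obtain z' where z': "z' \<in> Mh" "ph z' = pt x0" "Mh.d z z' \<le> D" using near[OF yz(2)] by blast
    have s: "Mh.d y' y = Mh.d y y'" "Mh.d z' z = Mh.d z z'" using Mh.d_sym y'(1) z'(1) yz by blast+
    have "Mh.d y z \<le> Mh.d y y' + Mh.d y' z" "Mh.d y' z \<le> Mh.d y' z' + Mh.d z' z"
      using Mh.d_triangle y'(1) z'(1) yz by blast+
    then have 1: "Mh.d y z \<le> 2 * D + Mh.d y' z'" using s y'(3) z'(3) by linarith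
    have Gy: "N (Gh y' - Gh y) \<le> K' * D"
    proof -
      have "N (Gh y' - Gh y) \<le> K' * Mh.d y' y" using K'(2) y'(1) yz(1) by blast
      also have "\<dots> \<le> K' * D" using s y'(3) K'(1) by simp
      finally show ?thesis .
    qed
    have Gz: "N (Gh z - Gh z') \<le> K' * D"
    proof -
      have "N (Gh z - Gh z') \<le> K' * Mh.d z z'" using K'(2) z'(1) yz(2) by blast
      also have "\<dots> \<le> K' * D" using z'(3) K'(1) by simp
      finally show ?thesis .
    qed
    note in_B = Gh_in[OF yz(1)] Gh_in[OF yz(2)] Gh_in[OF y'(1)] Gh_in[OF z'(1)]
    have "N (Gh y' - Gh z') \<le> N (Gh y' - Gh y) + N (Gh y - Gh z')" "N (Gh y - Gh z') \<le> N (Gh y - Gh z) + N (Gh z - Gh z')"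
      using norm_on_triangle[OF norm_span] in_B by blast+
    then have "N (Gh y' - Gh z') \<le> N (Gh y - Gh z) + 2 * K' * D" using Gy Gz by linarith
    then have "K * N (Gh y' - Gh z') \<le> K * (N (Gh y - Gh z) + 2 * K' * D)" by (rule mult_left_mono[OF _ K(1)])
    moreover have "Mh.d y' z' \<le> K * N (Gh y' - Gh z')" using K(2) y' z' by blast
    moreover have "0 \<le> N (Gh y - Gh z)" using norm_on_D(1)[OF norm_span] in_B by (simp add: span_diff)
    ultimately show ?thesis using 1 by (simp add: distrib_left distrib_right)
  qed
  moreover have "0 < K + 1" "0 < 2 * D + K * (2 * K' * D)" using K(1) D(1) K'(1) by (auto intro: add_pos_nonneg)
  ultimately show ?thesis by blast
qed

section \<open>Filling of the target by rescaled images, and the limit\<close>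

lemma fibre_point:
  fixes n :: "'v \<Rightarrow> int"
  shows "\<exists>z\<in>Mh. Gh z = (\<Sum>b\<in>B. of_int (n b) *\<^sub>R b)"
proof -
  obtain \<gamma> where \<gamma>: "\<gamma> \<in> Mh.paths (pt x0) (pt x0)" "g (path_class M \<gamma>) = (\<Sum>b\<in>B. of_int (n b) *\<^sub>R b)"
    using lattice_loops by blast
  then have "\<gamma> \<in> Mh.paths (ph (\<pi> x0)) (pt x0)" using base_point(3) by simp
  then obtain \<rho> z where \<rho>: "\<rho> \<in> Mh.lift_paths (\<pi> x0) z" "ph z = pt x0" "\<forall>t\<in>{0..1}. ph (\<rho> t) = \<gamma> t" using Mh.lift_paths_lift[OF base_point(2)] by blast
  have "homotopic_paths M \<gamma> (ph \<circ> \<rho>)" by (rule homotopic_paths_eq[OF Mh.paths_D(1,2)[OF \<gamma>(1)]]) (use \<rho>(3) in simp)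
  then have "path_class M \<gamma> = path_class M (ph \<circ> \<rho>)" by (rule path_class_eqI)
  then have "Gh z = (\<Sum>b\<in>B. of_int (n b) *\<^sub>R b)" using Gh_fibre[OF \<rho>(1,2)] \<gamma>(2) by simp
  then show ?thesis using Mh.lift_paths_D(7)[OF \<rho>(1)] by blast
qed

text \<open>Dividing the coordinates of \<open>y\<close> by \<open>e\<close> and rounding down to
  integers leaves an error below 1 in each, hence at most \<open>e\<close> after rescaling.\<close>

lemma scaled_lattice_dense:
  assumes y: "y \<in> span B"
  shows "\<exists>x. (\<forall>e>0. x e \<in> Mh) \<and> (\<exists>C\<ge>0. \<forall>e>0. N (e *\<^sub>R Gh (x e) - y) \<le> e * C)"
proof -
  obtain c where c: "y = (\<Sum>b\<in>B. c b *\<^sub>R b)" using y unfolding span_finite[OF cover_group(1)] by auto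
  \<comment> \<open>Values \<open>e \<le> 0\<close> are included, where the quotient still has a
    floor (division by 0 gives 0); the estimate is made for \<open>e > 0\<close>.\<close>
  have "\<forall>e. \<exists>z. z \<in> Mh \<and> Gh z = (\<Sum>b\<in>B. of_int \<lfloor>c b / e\<rfloor> *\<^sub>R b)"
    using fibre_point[of "\<lambda>b. \<lfloor>c b / _\<rfloor>"] by blast
  then obtain x where x: "\<And>e. x e \<in> Mh" "\<And>e. Gh (x e) = (\<Sum>b\<in>B. of_int \<lfloor>c b / e\<rfloor> *\<^sub>R b)" by metis
  have Nb: "0 \<le> N b" if "b \<in> B" for b using norm_on_D(1)[OF norm_span] that by (simp add: span_base)
  have "N (e *\<^sub>R Gh (x e) - y) \<le> e * (\<Sum>b\<in>B. N b)" if e: "e > 0" for e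
  proof -
    have "e *\<^sub>R Gh (x e) - y = (\<Sum>b\<in>B. (e * of_int \<lfloor>c b / e\<rfloor> - c b) *\<^sub>R b)"
      unfolding x(2) c by (simp add: scaleR_sum_right sum_subtractf scaleR_left_diff_distrib)
    then have "N (e *\<^sub>R Gh (x e) - y) \<le> (\<Sum>b\<in>B. \<bar>e * of_int \<lfloor>c b / e\<rfloor> - c b\<bar> * N b)"
      using norm_on_sum_le[OF norm_span cover_group(1), of "\<lambda>b. b" "\<lambda>b. e * of_int \<lfloor>c b / e\<rfloor> - c b"] by (simp add: span_base)
    also have "\<dots> \<le> (\<Sum>b\<in>B. e * N b)"
    proof (intro sum_mono mult_right_mono)
      fix b assume "b \<in> B"
      have "c b / e < of_int \<lfloor>c b / e\<rfloor> + 1" by linarith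
      then have "e * (c b / e) < e * (of_int \<lfloor>c b / e\<rfloor> + 1)" by (rule mult_strict_left_mono[OF _ e])
      moreover have "e * of_int \<lfloor>c b / e\<rfloor> \<le> e * (c b / e)" by (rule mult_left_mono[OF of_int_floor_le]) (use e in simp)
      ultimately have "e * of_int \<lfloor>c b / e\<rfloor> \<le> c b" "c b < e * of_int \<lfloor>c b / e\<rfloor> + e" using e by (simp_all add: distrib_left)
      then show "\<bar>e * of_int \<lfloor>c b / e\<rfloor> - c b\<bar> \<le> e" by linarith
    qed (rule Nb)
    also have "\<dots> = e * (\<Sum>b\<in>B. N b)" by (simp add: sum_distrib_left)
    finally show ?thesis .
  qed
  moreover have "0 \<le> (\<Sum>b\<in>B. N b)" by (rule sum_nonneg[OF Nb])
  ultimately show ?thesis using x(1) by blast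
qed

lemma rescaled_cover_converges:
  "spaces_converge (\<lambda>_. Mh) (\<lambda>e x y. e * Mh.d x y) (\<lambda>e x. e *\<^sub>R Gh x) (f ` real_homology A) (\<lambda>u v. N (u - v))"
proof -
  let ?W = "span B" and ?dW = "dist_on (span B) (\<lambda>u v. N (u - v))"
  have mW: "Metric_space ?W ?dW" by (rule norm_on_Metric_space[OF norm_span])
  have mX: "Metric_space Mh (dist_on Mh (\<lambda>x y. e * Mh.d x y))" if "e > 0" for e by (rule Mh.Metric_space_d[OF that])
  obtain K1 where K1: "K1 > 0" "\<And>y z. y \<in> Mh \<Longrightarrow> z \<in> Mh \<Longrightarrow> N (Gh y - Gh z) \<le> K1 * Mh.d y z"
    using Gh_Lipschitz by blast
  obtain K2 D where K2: "K2 > 0" "D > 0" "\<And>y z. y \<in> Mh \<Longrightarrow> z \<in> Mh \<Longrightarrow> Mh.d y z \<le> K2 * N (Gh y - Gh z) + D"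
    using Gh_lower by blast
  \<comment> \<open>One constant above 1 that dominates both \<open>K1\<close> and
    \<open>K2\<close>. As \<open>K > 1\<close>, dividing the lower estimate by it leaves a defect of
    at most \<open>D\<close>, which rescales to \<open>e * D\<close>.\<close>
  define K where "K = 1 + K1 + K2"
  have K: "K > 1" "K1 \<le> K" "K2 \<le> K" using K1(1) K2(1) unfolding K_def by auto
  have W: "e *\<^sub>R Gh x \<in> ?W" if "x \<in> Mh" for e x by (rule span_mul[OF Gh_in[OF that]])
  have Ne: "N (e *\<^sub>R Gh x - e *\<^sub>R Gh y) = e * N (Gh x - Gh y)" if "e > 0" "x \<in> Mh" "y \<in> Mh" for e x y
    using norm_on_D(3)[OF norm_span span_diff[OF Gh_in[OF that(2)] Gh_in[OF that(3)]], of e] that(1) by (simp add: scaleR_diff_right)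
  have upper: "N (e *\<^sub>R Gh x - e *\<^sub>R Gh y) \<le> K * (e * Mh.d x y)" if e: "e > 0" and xy: "x \<in> Mh" "y \<in> Mh" for e x y
  proof -
    have "N (Gh x - Gh y) \<le> K1 * Mh.d x y" by (rule K1(2)[OF xy])
    also have "\<dots> \<le> K * Mh.d x y" by (rule mult_right_mono[OF K(2) Mh.d_nonneg[OF xy]])
    finally have "e * N (Gh x - Gh y) \<le> e * (K * Mh.d x y)" using e by simp
    then show ?thesis using Ne[OF e xy] by (simp add: mult_ac)
  qed
  have lower: "inverse K * (e * Mh.d x y) - e * D \<le> N (e *\<^sub>R Gh x - e *\<^sub>R Gh y)" if e: "e > 0" and xy: "x \<in> Mh" "y \<in> Mh" for e x y
  proof -
    have n0: "0 \<le> N (Gh x - Gh y)" by (rule norm_on_D(1)[OF norm_span span_diff[OF Gh_in[OF xy(1)] Gh_in[OF xy(2)]]])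
    have "Mh.d x y \<le> K2 * N (Gh x - Gh y) + D" by (rule K2(3)[OF xy])
    also have "\<dots> \<le> K * N (Gh x - Gh y) + K * D"
      using mult_right_mono[OF K(3) n0] mult_right_mono[of 1 K D] K(1) K2(2) by linarith
    finally have "inverse K * Mh.d x y \<le> N (Gh x - Gh y) + D" using K(1) by (simp add: field_simps)
    then have "e * (inverse K * Mh.d x y) \<le> e * (N (Gh x - Gh y) + D)" using e by simp
    then show ?thesis using Ne[OF e xy] by (simp add: algebra_simps)
  qed
  have cont: "continuous_map (Metric_space.mtopology Mh (dist_on Mh (\<lambda>x y. e * Mh.d x y)))
      (Metric_space.mtopology ?W ?dW) (\<lambda>x. e *\<^sub>R Gh x)" if e: "e > 0" for e
    unfolding Metric_space.metric_continuous_map[OF mX[OF e] mW]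
  proof (intro conjI ballI allI impI)
    show "(\<lambda>x. e *\<^sub>R Gh x) ` Mh \<subseteq> ?W" using W by blast
    fix a \<epsilon> assume a: "a \<in> Mh" and \<epsilon>: "0 < (\<epsilon> :: real)"
    show "\<exists>\<delta>>0. \<forall>x. x \<in> Mh \<and> dist_on Mh (\<lambda>x y. e * Mh.d x y) a x < \<delta> \<longrightarrow> ?dW (e *\<^sub>R Gh a) (e *\<^sub>R Gh x) < \<epsilon>"
    proof (intro exI[of _ "\<epsilon> / K"] conjI allI impI)
      show "0 < \<epsilon> / K" using \<epsilon> K(1) by simp
      fix x assume x: "x \<in> Mh \<and> dist_on Mh (\<lambda>x y. e * Mh.d x y) a x < \<epsilon> / K"
      then have xM: "x \<in> Mh" and "dist_on Mh (\<lambda>x y. e * Mh.d x y) a x < \<epsilon> / K" by blast+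
      then have "K * (e * Mh.d a x) < \<epsilon>" using a K(1) by (simp add: dist_on_def field_simps)
      then show "?dW (e *\<^sub>R Gh a) (e *\<^sub>R Gh x) < \<epsilon>" using upper[OF e a, of x] x W a by (simp add: dist_on_def)
    qed
  qed
  have lim: "\<exists>x. (\<forall>e>0. x e \<in> Mh) \<and> limitin (Metric_space.mtopology ?W ?dW) (\<lambda>e. e *\<^sub>R Gh (x e)) y (at_right 0)"
    if y: "y \<in> ?W" for y
  proof -
    obtain x C where x: "\<forall>e>0. x e \<in> Mh" "C \<ge> 0" "\<forall>e>0. N (e *\<^sub>R Gh (x e) - y) \<le> e * C"
      using scaled_lattice_dense[OF y] by blast
    have "limitin (Metric_space.mtopology ?W ?dW) (\<lambda>e. e *\<^sub>R Gh (x e)) y (at_right 0)"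
      unfolding Metric_space.limitin_metric[OF mW]
    proof (intro conjI allI impI)
      fix \<epsilon> :: real assume \<epsilon>: "0 < \<epsilon>"
      have "\<forall>\<^sub>F e in at_right 0. e \<in> {0<..<\<epsilon> / (C + 1)}"
        \<comment> \<open>\<open>C\<close> may be 0, hence the quotient by
          \<open>C + 1\<close>.\<close>
        by (rule eventually_at_right_real) (use \<epsilon> x(2) in simp)
      then show "\<forall>\<^sub>F e in at_right 0. e *\<^sub>R Gh (x e) \<in> ?W \<and> ?dW (e *\<^sub>R Gh (x e)) y < \<epsilon>"
      proof eventually_elim
        case (elim e)
        then have e: "e > 0" "e * (C + 1) < \<epsilon>" using x(2) by (auto simp: field_simps)
        have "e * C < \<epsilon>" using e by (simp add: distrib_left)
        moreover have "N (e *\<^sub>R Gh (x e) - y) \<le> e * C" using x(3) e(1) by blast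
        ultimately have "N (e *\<^sub>R Gh (x e) - y) < \<epsilon>" by linarith
        then show ?case using W x(1) e(1) y by (simp add: dist_on_def)
      qed
    qed (rule y)
    then show ?thesis using x(1) by blast
  qed
  show ?thesis
    unfolding spaces_converge_def linear_f(2)
  proof (intro conjI allI impI ballI)
    show "\<exists>K>1. \<exists>A. (\<forall>e>0. A e > 0) \<and> (A \<longlongrightarrow> 0) (at_right 0) \<and> (\<forall>e>0. \<forall>x\<in>Mh. \<forall>y\<in>Mh.
        inverse K * (e * Mh.d x y) - A e \<le> N (e *\<^sub>R Gh x - e *\<^sub>R Gh y) \<and> N (e *\<^sub>R Gh x - e *\<^sub>R Gh y) \<le> K * (e * Mh.d x y))"
    proof (intro exI[of _ K] exI[of _ "\<lambda>e. e * D"] conjI allI impI ballI)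
      show "((\<lambda>e. e * D) \<longlongrightarrow> 0) (at_right 0)" by (auto intro!: tendsto_eq_intros)
    qed (use K(1) K2(2) lower upper in auto)
  qed (use mW mX cont lim in auto)
qed

end

theorem proposition1p3:
  fixes A :: "('a::t2_space, 'e::{real_inner,heine_borel}, 'i) atlas"
    and M :: "'a set"
    and gm :: "'i \<Rightarrow> 'a \<Rightarrow> 'e \<Rightarrow> 'e \<Rightarrow> real"
    and Mt :: "'c::topological_space set" and pt :: "'c \<Rightarrow> 'a" and x0 :: 'c
    and Mh :: "'b::topological_space set" and ph :: "'b \<Rightarrow> 'a"
    and \<pi> :: "'c \<Rightarrow> 'b"
    and k :: nat and \<omega> :: "nat \<Rightarrow> ('a, 'e, 'i) form"
    and G :: "'c \<Rightarrow> ('a, 'e, 'i) form \<Rightarrow> real"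
    and B :: "'v::real_vector set"
    and g :: "(real \<Rightarrow> 'a) set \<Rightarrow> 'v"
    and f :: "(('a, 'e, 'i) form \<Rightarrow> real) \<Rightarrow> 'v"
    and Gh :: "'b \<Rightarrow> 'v"
    and N :: "'v \<Rightarrow> real"
  assumes "smooth_manifold A M" and "riemannian_metric A gm"
    and "compact M" and "path_connected M"
    and "maximal_free_abelian_cover A M Mt pt x0"
    and "free_abelian_cover M Mh ph (\<pi> x0) B g"
    and "covering_space Mt \<pi> Mh" and "\<And>x. x \<in> Mt \<Longrightarrow> ph (\<pi> x) = pt x"
    and "cohomology_basis A k \<omega>"
    and "abel_map A M Mt pt x0 k \<omega> G"
    and "linearization A M (pt x0) B g f"
    and "\<And>x. x \<in> Mt \<Longrightarrow> Gh (\<pi> x) = f (G x)"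
    and "norm_on (f ` real_homology A) N"
  shows "spaces_converge (\<lambda>_. Mh)
           (\<lambda>\<epsilon> x y. \<epsilon> * riemannian_dist (lift_atlas A M ph Mh) (lift_tensor ph gm) Mh x y)
           (\<lambda>\<epsilon> x. \<epsilon> *\<^sub>R Gh x)
           (f ` real_homology A) (\<lambda>u v. N (u - v))"
proof -
  interpret abelian_cover_setup A M gm Mt pt x0 Mh ph \<pi> k \<omega> G B g f Gh N
    by (rule abelian_cover_setup.intro) (fact assms)+
  show ?thesis by (rule rescaled_cover_converges)
qed

end
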